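(* Let $A\to M$ be a vector bundle such that $A$ and $A^*$ are both Lie algebroids, with anchors $a$ and $a_*$. On $E=A\oplus A^*$ define, for $X,Y\in\Gamma(A)$, $\xi,\eta\in\Gamma(A^* )$, $$\langle X+\xi,Y+\eta\rangle=\xi(Y)+\eta(X),\qquad \rho(X+\xi)=a(X)+a_*(\xi),$$ $$(X+\xi)\circ(Y+\eta)=\big([X,Y]_A+L^{A^*}_\xi Y-i_\eta d_{A^*}X\big)+\big([\xi,\eta]_{A^*}+L_X^A\eta-i_Yd_A\xi\big),$$ and $\mathcal D:C^\infty(M)\to\Gamma(E)$ by $\langle\mathcal Df,e\rangle=\rho(e)f$. Let $\theta=\mu+L^*\gamma\in C^\infty(T^*\Pi A)$, where $\mu=h_{d_A}$, $\gamma=h_{d_{A^*}}$, and let $D=\{\theta,\cdot\}$. Let $p:T^*\Pi A\to\Pi(A\oplus A^* )$ be the canonical projection, and view sections of $E$ and functions on $M$ as functions on $\Pi(A\oplus A^* )$. Then for all $e_1,e_2\in\Gamma(E)$ and $f\in C^\infty(M)$: 1. $p^*\langle e_1,e_2\rangle=\{p^*e_1,p^*e_2\}$; 2. $p^*\mathcal Df=Dp^*f=\{\theta,p^*f\}$; 3. $p^*(e_1\circ e_2)=p^*e_1\circ_Dp^*e_2$, where $\circ_D$ is the derived bracket, so $p^*e_1\circ_Dp^*e_2=\{\{\theta,p^*e_1\},p^*e_2\}$.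
   Context: $\Pi A$ is the supermanifold with algebra of functions $\Gamma(\bigwedge A^* )$; local coordinates $(x^i,\xi^a)$, $\xi^a$ odd, corresponding to a local frame $e^a$ of $A^*$ dual to a frame $e_a$ of $A$. $\Pi A^*$ has coordinates $(x^i,\theta_a)$. $T^*\Pi A$ has Darboux coordinates $(x^i,\xi^a,x_i^*,\xi_a^* )$ with even canonical Poisson bracket $\{x_i^*,x^j\}=\delta_i^j$, $\{\xi_a^*,\xi^b\}=\delta_a^b$, other brackets of coordinates zero, $\{F,G\}=-(-1)^{\tilde F\tilde G}\{G,F\}$ and $\{F,\cdot\}$ a derivation of parity $\tilde F$. $T^*\Pi A^*$ has coordinates $(x^i,\theta_a,x_i^*,\theta_*^a)$. For a vector field $v=v^\alpha\partial_\alpha$ on a supermanifold, $h_v=v^\alpha x_\alpha^*$ is its hamiltonian lift to the cotangent bundle. The Legendre transform $L:T^*\Pi A\to T^*\Pi A^*$ is the canonical symplectomorphism given locally by $L^*x^i=x^i$, $L^*\theta_a=\xi_a^*$, $L^*x_i^*=x_i^*$, $L^*\theta_*^a=\xi^a$. The Lie algebroid differentials $d_A$ on $\Gamma(\bigwedge A^* )$ and $d_{A^*}$ on $\Gamma(\bigwedge A)$ (given by the Cartan formula) are viewed as odd vector fields on $\Pi A$ and $\Pi A^*$; e.g. $d_A=\xi^aA_a^i\partial_{x^i}-\frac12C_{ab}^c\xi^a\xi^b\partial_{\xi^c}$ with $a(e_a)=A_a^i\partial_{x^i}$, $[e_a,e_b]_A=C_{ab}^ce_c$. $i_X$ denotes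 contraction, $L_X^A=[d_A,i_X]$ (supercommutator), and similarly $L_\xi^{A^*}=[d_{A^*},i_\xi]$. The projection $p$ is given in local coordinates by $p^*x^i=x^i$, $p^*\xi^a=\xi^a$, $p^*\theta_a=\xi_a^*$; a section $X^ae_a+f_ae^a$ of $E$ is viewed as the function $X^a\theta_a+f_a\xi^a$ on $\Pi(A\oplus A^* )$. For an odd operator $D$ on $C^\infty(T^*\Pi A)$ the derived bracket is $F\circ_DG=(-1)^{\tilde F+1}\{DF,G\}$. No compatibility condition between the two Lie algebroid structures is assumed. *)

theory Defs
  imports "HOL-Analysis.Analysis" "HOL-Library.Function_Algebras"
begin

text \<open>Pointwise vector space structure on functions; it is used for fibres of a dual bundle
  (linear functionals) and for sections. Addition is the one of Function_Algebras.\<close>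

instantiation "fun" :: (type, real_vector) real_vector
begin

definition scaleR_fun :: "real \<Rightarrow> ('a \<Rightarrow> 'b) \<Rightarrow> 'a \<Rightarrow> 'b"
  where "scaleR_fun c f = (\<lambda>x. c *\<^sub>R f x)"

instance
  by standard (simp_all add: scaleR_fun_def fun_eq_iff scaleR_add_right scaleR_add_left)

end


section \<open>Smooth manifolds\<close>

text \<open>\<open>\<real>\<^sup>n\<close> is the library's \<^const>\<open>Euclidean_space\<close>: sequences vanishing from index \<open>n\<close> on.
  This keeps \<open>n = 0\<close> (Lie algebras as Lie algebroids over a point) in scope.\<close>

definition partial :: "nat \<Rightarrow> ((nat \<Rightarrow> real) \<Rightarrow> real) \<Rightarrow> (nat \<Rightarrow> real) \<Rightarrow> real"
  where "partial i g z = deriv (\<lambda>t. g (z(i := t))) (z i)"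

text \<open>\<open>C\<^sup>\<infinity>\<close> on an open subset of \<open>\<real>\<^sup>n\<close>: all iterated partial derivatives exist and are continuous.\<close>

definition smooth_Rn :: "nat \<Rightarrow> (nat \<Rightarrow> real) set \<Rightarrow> ((nat \<Rightarrow> real) \<Rightarrow> real) \<Rightarrow> bool"
  where "smooth_Rn n V g \<longleftrightarrow>
    (\<forall>ks. set ks \<subseteq> {..<n} \<longrightarrow>
       continuous_on V (foldr partial ks g) \<and>
       (\<forall>z\<in>V. \<forall>i<n. (\<lambda>t. foldr partial ks g (z(i := t))) field_differentiable at (z i)))"

type_synonym 'm chart = "'m set \<times> ('m \<Rightarrow> nat \<Rightarrow> real)"

record 'm manifold =
  mdim :: nat
  charts :: "'m chart set"

text \<open>The manifold is the whole type \<open>'m\<close>, with its Hausdorff, second countable topology.\<close>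

definition smooth_manifold :: "'m::{t2_space, second_countable_topology} manifold \<Rightarrow> bool"
  where "smooth_manifold M \<longleftrightarrow>
    (\<Union>(U, \<phi>)\<in>charts M. U) = UNIV \<and>
    (\<forall>(U, \<phi>)\<in>charts M. open U \<and> openin (Euclidean_space (mdim M)) (\<phi> ` U) \<and>
       homeomorphism U (\<phi> ` U) \<phi> (inv_into U \<phi>)) \<and>
    (\<forall>(U, \<phi>)\<in>charts M. \<forall>(W, \<psi>)\<in>charts M. \<forall>i<mdim M.
       smooth_Rn (mdim M) (\<phi> ` (U \<inter> W)) (\<lambda>z. \<psi> (inv_into U \<phi> z) i))"

definition smooth_fun :: "'m manifold \<Rightarrow> 'm set \<Rightarrow> ('m \<Rightarrow> real) \<Rightarrow> bool"
  where "smooth_fun M W f \<longleftrightarrow>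
    (\<forall>(U, \<phi>)\<in>charts M. smooth_Rn (mdim M) (\<phi> ` (U \<inter> W)) (f \<circ> inv_into U \<phi>))"

text \<open>Tangent vectors at \<open>x\<close> act on functions that are smooth near \<open>x\<close>, as combinations of
  the coordinate derivatives; the values of \<open>D\<close> on other functions are irrelevant.\<close>

definition smooth_near :: "'m::topological_space manifold \<Rightarrow> 'm \<Rightarrow> ('m \<Rightarrow> real) \<Rightarrow> bool"
  where "smooth_near M x f \<longleftrightarrow> (\<exists>W. open W \<and> x \<in> W \<and> smooth_fun M W f)"

definition tangent_vector ::
    "'m::topological_space manifold \<Rightarrow> 'm \<Rightarrow> (('m \<Rightarrow> real) \<Rightarrow> real) \<Rightarrow> bool"
  where "tangent_vector M x D \<longleftrightarrow>
    (\<forall>(U, \<phi>)\<in>charts M. x \<in> U \<longrightarrow>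
       (\<exists>v. \<forall>f. smooth_near M x f \<longrightarrow>
          D f = (\<Sum>i<mdim M. v i * partial i (f \<circ> inv_into U \<phi>) (\<phi> x))))"


section \<open>Vector bundles\<close>

text \<open>The fibres are subspaces of one real vector space \<open>'v\<close> without topology (for instance the
  direct sum of all fibres, so that every vector bundle arises); the smooth structure is given
  by an atlas of local frames \<open>(V, e)\<close> with smooth transition functions. Only the values
  \<open>e a x\<close> with \<open>a < brank A\<close> and \<open>x \<in> V\<close> matter.\<close>

type_synonym ('m, 'v) frame = "'m set \<times> (nat \<Rightarrow> 'm \<Rightarrow> 'v)"

record ('m, 'v) vbundle =
  brank :: nat
  fibre :: "'m \<Rightarrow> 'v set"
  frames :: "('m, 'v) frame set"

definition component :: "nat \<Rightarrow> (nat \<Rightarrow> 'm \<Rightarrow> 'v::real_vector) \<Rightarrow> 'm \<Rightarrow> 'v \<Rightarrow> nat \<Rightarrow> real"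
  where "component r e x v a = representation ((\<lambda>b. e b x) ` {..<r}) v (e a x)"

definition vector_bundle ::
    "'m::topological_space manifold \<Rightarrow> ('m, 'v::real_vector) vbundle \<Rightarrow> bool"
  where "vector_bundle M A \<longleftrightarrow>
    (\<Union>(V, e)\<in>frames A. V) = UNIV \<and>
    (\<forall>(V, e)\<in>frames A. open V \<and>
       (\<forall>x\<in>V. inj_on (\<lambda>a. e a x) {..<brank A} \<and>
              independent ((\<lambda>a. e a x) ` {..<brank A}) \<and>
              span ((\<lambda>a. e a x) ` {..<brank A}) = fibre A x)) \<and>
    (\<forall>(V, e)\<in>frames A. \<forall>(V', e')\<in>frames A. \<forall>a<brank A. \<forall>b<brank A.
       smooth_fun M (V \<inter> V') (\<lambda>x. component (brank A) e x (e' b x) a))"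

definition sections :: "'m manifold \<Rightarrow> ('m, 'v::real_vector) vbundle \<Rightarrow> ('m \<Rightarrow> 'v) set"
  where "sections M A = {X. (\<forall>x. X x \<in> fibre A x) \<and>
    (\<forall>(V, e)\<in>frames A. \<forall>a<brank A. smooth_fun M V (\<lambda>x. component (brank A) e x (X x) a))}"

text \<open>A functional on the fibre over \<open>x\<close> is extended by \<open>0\<close> outside the fibre.\<close>

definition dual_fibre :: "('m, 'v::real_vector) vbundle \<Rightarrow> 'm \<Rightarrow> ('v \<Rightarrow> real) set"
  where "dual_fibre A x = {\<alpha>.
    (\<forall>u\<in>fibre A x. \<forall>v\<in>fibre A x. \<forall>c. \<alpha> (c *\<^sub>R u + v) = c * \<alpha> u + \<alpha> v) \<and>
    (\<forall>v. v \<notin> fibre A x \<longrightarrow> \<alpha> v = 0)}"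

definition dual_frame ::
    "('m, 'v::real_vector) vbundle \<Rightarrow> (nat \<Rightarrow> 'm \<Rightarrow> 'v) \<Rightarrow> nat \<Rightarrow> 'm \<Rightarrow> 'v \<Rightarrow> real"
  where "dual_frame A e a x v = (if v \<in> fibre A x then component (brank A) e x v a else 0)"

definition dual_bundle :: "('m, 'v::real_vector) vbundle \<Rightarrow> ('m, 'v \<Rightarrow> real) vbundle"
  where "dual_bundle A = \<lparr>brank = brank A, fibre = dual_fibre A,
    frames = (\<lambda>(V, e). (V, dual_frame A e)) ` frames A\<rparr>"


section \<open>Lie algebroids and their differential\<close>

type_synonym ('m, 'v) anchor = "'m \<Rightarrow> 'v \<Rightarrow> ('m \<Rightarrow> real) \<Rightarrow> real"
type_synonym ('m, 'v) bracket = "('m \<Rightarrow> 'v) \<Rightarrow> ('m \<Rightarrow> 'v) \<Rightarrow> 'm \<Rightarrow> 'v"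

text \<open>That the anchor maps brackets to commutators follows from the Jacobi identity and the
  Leibniz rule.\<close>

definition lie_algebroid :: "'m::topological_space manifold \<Rightarrow> ('m, 'v::real_vector) vbundle \<Rightarrow>
    ('m, 'v) anchor \<Rightarrow> ('m, 'v) bracket \<Rightarrow> bool"
  where "lie_algebroid M A a br \<longleftrightarrow>
    (\<forall>x. \<forall>v\<in>fibre A x. tangent_vector M x (a x v)) \<and>
    (\<forall>x. \<forall>u\<in>fibre A x. \<forall>v\<in>fibre A x. \<forall>c f. smooth_near M x f \<longrightarrow>
       a x (c *\<^sub>R u + v) f = c * a x u f + a x v f) \<and>
    (\<forall>X\<in>sections M A. \<forall>W f. open W \<and> smooth_fun M W f \<longrightarrow>
       smooth_fun M W (\<lambda>x. a x (X x) f)) \<and>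
    (\<forall>X\<in>sections M A. \<forall>Y\<in>sections M A. br X Y \<in> sections M A \<and> br X Y = - br Y X) \<and>
    (\<forall>X\<in>sections M A. \<forall>Y\<in>sections M A. \<forall>Z\<in>sections M A. \<forall>c.
       br X (c *\<^sub>R Y + Z) = c *\<^sub>R br X Y + br X Z \<and>
       br X (br Y Z) + br Y (br Z X) + br Z (br X Y) = 0) \<and>
    (\<forall>X\<in>sections M A. \<forall>Y\<in>sections M A. \<forall>f. smooth_fun M UNIV f \<longrightarrow>
       br X (\<lambda>x. f x *\<^sub>R Y x) = (\<lambda>x. f x *\<^sub>R br X Y x + a x (X x) f *\<^sub>R Y x))"

text \<open>Elements of \<open>\<Gamma>(\<And>A\<^sup>*)\<close>, not necessarily homogeneous: the component of degree \<open>k\<close> is the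
  restriction of \<open>\<omega> x\<close> to lists of \<open>k\<close> vectors of the fibre over \<open>x\<close>. Applied to the dual
  bundle this gives \<open>\<Gamma>(\<And>A)\<close>.\<close>

type_synonym ('m, 'v) form = "'m \<Rightarrow> 'v list \<Rightarrow> real"

definition forms :: "'m manifold \<Rightarrow> ('m, 'v::real_vector) vbundle \<Rightarrow> ('m, 'v) form set"
  where "forms M A = {\<omega>.
    (\<forall>x vs. \<not> set vs \<subseteq> fibre A x \<longrightarrow> \<omega> x vs = 0) \<and>
    (\<forall>x us ws. \<forall>u\<in>fibre A x. \<forall>v\<in>fibre A x. \<forall>c. set us \<union> set ws \<subseteq> fibre A x \<longrightarrow>
       \<omega> x (us @ (c *\<^sub>R u + v) # ws) = c * \<omega> x (us @ u # ws) + \<omega> x (us @ v # ws)) \<and>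
    (\<forall>x vs. \<not> distinct vs \<longrightarrow> \<omega> x vs = 0) \<and>
    (\<forall>(V, e)\<in>frames A. \<forall>as. set as \<subseteq> {..<brank A} \<longrightarrow>
       smooth_fun M V (\<lambda>x. \<omega> x (map (\<lambda>a. e a x) as)))}"

definition omit :: "nat \<Rightarrow> 'b list \<Rightarrow> 'b list"
  where "omit i xs = take i xs @ drop (Suc i) xs"

text \<open>The Cartan formula for the value of \<open>d\<omega>\<close> at \<open>x\<close> on sections \<open>X\<^sub>0, \<dots>, X\<^sub>k\<close>.\<close>

definition cartan :: "('m, 'v) anchor \<Rightarrow> ('m, 'v) bracket \<Rightarrow> ('m, 'v) form \<Rightarrow>
    ('m \<Rightarrow> 'v) list \<Rightarrow> 'm \<Rightarrow> real"
  where "cartan a br \<omega> Xs x =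
    (\<Sum>i<length Xs. (-1) ^ i * a x ((Xs ! i) x) (\<lambda>y. \<omega> y (map (\<lambda>X. X y) (omit i Xs)))) +
    (\<Sum>j<length Xs. \<Sum>i<j. (-1) ^ (i + j) *
       \<omega> x (map (\<lambda>X. X x) (br (Xs ! i) (Xs ! j) # omit i (omit j Xs))))"

text \<open>The value of \<open>d\<omega>\<close> on vectors over \<open>x\<close> is computed by extending them to sections.\<close>

definition lie_d :: "'m manifold \<Rightarrow> ('m, 'v::real_vector) vbundle \<Rightarrow>
    ('m, 'v) anchor \<Rightarrow> ('m, 'v) bracket \<Rightarrow> ('m, 'v) form \<Rightarrow> ('m, 'v) form"
  where "lie_d M A a br \<omega> x vs = (if set vs \<subseteq> fibre A x
    then THE t. \<forall>Xs. set Xs \<subseteq> sections M A \<and> map (\<lambda>X. X x) Xs = vs \<longrightarrow> cartan a br \<omega> Xs x = t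
    else 0)"

definition contract :: "('m \<Rightarrow> 'v) \<Rightarrow> ('m, 'v) form \<Rightarrow> ('m, 'v) form"
  where "contract X \<omega> x vs = \<omega> x (X x # vs)"

text \<open>\<open>L\<^sub>X = [d, i\<^sub>X]\<close>, the supercommutator of two odd operators.\<close>

definition lie_deriv :: "'m manifold \<Rightarrow> ('m, 'v::real_vector) vbundle \<Rightarrow>
    ('m, 'v) anchor \<Rightarrow> ('m, 'v) bracket \<Rightarrow> ('m \<Rightarrow> 'v) \<Rightarrow> ('m, 'v) form \<Rightarrow> ('m, 'v) form"
  where "lie_deriv M A a br X \<omega> =
    lie_d M A a br (contract X \<omega>) + contract X (lie_d M A a br \<omega>)"

text \<open>Identification of \<open>\<Gamma>(A\<^sup>*)\<close> with the forms of degree 1 in \<open>\<Gamma>(\<And>A\<^sup>*)\<close>, and of \<open>\<Gamma>(A)\<close> with the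
  forms of degree 1 in \<open>\<Gamma>(\<And>A)\<close>, i.e. on the dual bundle.\<close>

definition cov_to_form :: "('m \<Rightarrow> 'v \<Rightarrow> real) \<Rightarrow> ('m, 'v) form"
  where "cov_to_form \<alpha> x vs = (case vs of [v] \<Rightarrow> \<alpha> x v | _ \<Rightarrow> 0)"

definition form_to_cov :: "('m, 'v) form \<Rightarrow> 'm \<Rightarrow> 'v \<Rightarrow> real"
  where "form_to_cov \<omega> x v = \<omega> x [v]"

definition vec_to_form ::
    "('m, 'v::real_vector) vbundle \<Rightarrow> ('m \<Rightarrow> 'v) \<Rightarrow> ('m, 'v \<Rightarrow> real) form"
  where "vec_to_form A X x \<alpha>s =
    (case \<alpha>s of [\<alpha>] \<Rightarrow> if \<alpha> \<in> dual_fibre A x then \<alpha> (X x) else 0 | _ \<Rightarrow> 0)"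

definition form_to_vec ::
    "('m, 'v::real_vector) vbundle \<Rightarrow> ('m, 'v \<Rightarrow> real) form \<Rightarrow> 'm \<Rightarrow> 'v"
  where "form_to_vec A \<omega> x = (THE v. v \<in> fibre A x \<and> (\<forall>\<alpha>\<in>dual_fibre A x. \<omega> x [\<alpha>] = \<alpha> v))"


section \<open>The structure on \<open>E = A \<oplus> A\<^sup>*\<close>\<close>

type_synonym ('m, 'v) esec = "('m \<Rightarrow> 'v) \<times> ('m \<Rightarrow> 'v \<Rightarrow> real)"

definition E_sections :: "'m manifold \<Rightarrow> ('m, 'v::real_vector) vbundle \<Rightarrow> ('m, 'v) esec set"
  where "E_sections M A = sections M A \<times> sections M (dual_bundle A)"

fun E_pairing :: "('m, 'v) esec \<Rightarrow> ('m, 'v) esec \<Rightarrow> 'm \<Rightarrow> real"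
  where "E_pairing (X, \<xi>) (Y, \<eta>) x = \<xi> x (Y x) + \<eta> x (X x)"

fun E_anchor :: "('m, 'v) anchor \<Rightarrow> ('m, 'v \<Rightarrow> real) anchor \<Rightarrow>
    ('m, 'v) esec \<Rightarrow> ('m \<Rightarrow> real) \<Rightarrow> 'm \<Rightarrow> real"
  where "E_anchor a a' (X, \<xi>) f x = a x (X x) f + a' x (\<xi> x) f"

fun E_bracket :: "'m manifold \<Rightarrow> ('m, 'v::real_vector) vbundle \<Rightarrow>
    ('m, 'v) anchor \<Rightarrow> ('m, 'v) bracket \<Rightarrow> ('m, 'v \<Rightarrow> real) anchor \<Rightarrow> ('m, 'v \<Rightarrow> real) bracket \<Rightarrow>
    ('m, 'v) esec \<Rightarrow> ('m, 'v) esec \<Rightarrow> ('m, 'v) esec"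
  where "E_bracket M A a br a' br' (X, \<xi>) (Y, \<eta>) =
    (br X Y
       + form_to_vec A (lie_deriv M (dual_bundle A) a' br' \<xi> (vec_to_form A Y))
       - form_to_vec A (contract \<eta> (lie_d M (dual_bundle A) a' br' (vec_to_form A X))),
     br' \<xi> \<eta>
       + form_to_cov (lie_deriv M A a br X (cov_to_form \<eta>))
       - form_to_cov (contract Y (lie_d M A a br (cov_to_form \<xi>))))"

definition E_D :: "'m manifold \<Rightarrow> ('m, 'v::real_vector) vbundle \<Rightarrow>
    ('m, 'v) anchor \<Rightarrow> ('m, 'v \<Rightarrow> real) anchor \<Rightarrow> ('m \<Rightarrow> real) \<Rightarrow> ('m, 'v) esec"
  where "E_D M A a a' f = (THE s. s \<in> E_sections M A \<and>
    (\<forall>e\<in>E_sections M A. E_pairing s e = E_anchor a a' e f))"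


section \<open>Functions on superdomains\<close>

text \<open>A function on a superdomain with even coordinates \<open>z 0, z 1, \<dots>\<close> and odd coordinates
  \<open>\<zeta>\<^sub>0, \<zeta>\<^sub>1, \<dots>\<close> is written \<open>\<Sum>\<^sub>S F S z \<zeta>\<^sup>S\<close>, where \<open>\<zeta>\<^sup>S\<close> is the product of the \<open>\<zeta>\<^sub>b\<close> with \<open>b \<in> S\<close>
  in increasing order.\<close>

type_synonym superfun = "nat set \<Rightarrow> (nat \<Rightarrow> real) \<Rightarrow> real"

definition base_fun :: "((nat \<Rightarrow> real) \<Rightarrow> real) \<Rightarrow> superfun"
  where "base_fun g S z = (if S = {} then g z else 0)"

abbreviation ecoord :: "nat \<Rightarrow> superfun"
  where "ecoord i \<equiv> base_fun (\<lambda>z. z i)"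

definition ocoord :: "nat \<Rightarrow> superfun"
  where "ocoord b S z = (if S = {b} then 1 else 0)"

text \<open>\<open>\<zeta>\<^sup>T \<zeta>\<^sup>T\<^sup>' = koszul T T' \<zeta>\<^sup>S\<close> for \<open>S\<close> the disjoint union of \<open>T\<close> and \<open>T'\<close>.\<close>

definition koszul :: "nat set \<Rightarrow> nat set \<Rightarrow> real"
  where "koszul T T' = (-1) ^ card {(i, j). i \<in> T \<and> j \<in> T' \<and> j < i}"

definition smult :: "superfun \<Rightarrow> superfun \<Rightarrow> superfun" (infixl "\<odot>" 70)
  where "(F \<odot> G) S z = (\<Sum>T\<in>Pow S. koszul T (S - T) * F T z * G (S - T) z)"

definition partial_even :: "nat \<Rightarrow> superfun \<Rightarrow> superfun"
  where "partial_even i F S = partial i (F S)"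

text \<open>Left and right derivatives with respect to \<open>\<zeta>\<^sub>b\<close>: move \<open>\<zeta>\<^sub>b\<close> to the front, resp. to the
  end, of each monomial and delete it.\<close>

definition left_odd :: "nat \<Rightarrow> superfun \<Rightarrow> superfun"
  where "left_odd b F S z =
    (if b \<in> S then 0 else (-1) ^ card {k\<in>S. k < b} * F (insert b S) z)"

definition right_odd :: "nat \<Rightarrow> superfun \<Rightarrow> superfun"
  where "right_odd b F S z =
    (if b \<in> S then 0 else (-1) ^ card {k\<in>S. b < k} * F (insert b S) z)"

text \<open>Pullback along the morphism given by the map \<open>u\<close> on even coordinates and by the images \<open>h b\<close>
  of the \<open>q\<close> odd coordinates. (The pullbacks of even coordinates have no nilpotent part here.)\<close>

definition pullback :: "nat \<Rightarrow> ((nat \<Rightarrow> real) \<Rightarrow> (nat \<Rightarrow> real)) \<Rightarrow> (nat \<Rightarrow> superfun) \<Rightarrow>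
    superfun \<Rightarrow> superfun"
  where "pullback q u h F T z = (\<Sum>S\<in>Pow {..<q}.
    F S (u z) * foldr (\<odot>) (map h (sorted_list_of_set S)) (base_fun (\<lambda>_. 1)) T z)"

definition trunc :: "nat \<Rightarrow> (nat \<Rightarrow> real) \<Rightarrow> nat \<Rightarrow> real"
  where "trunc n z i = (if i < n then z i else 0)"

text \<open>The canonical Poisson bracket on the cotangent bundle of \<open>\<real>\<^sup>n\<^sup>|\<^sup>r\<close>, with coordinates
  \<open>x\<^sup>i = z i\<close>, \<open>x\<^sup>*\<^sub>i = z (n + i)\<close> for \<open>i < n\<close> and \<open>\<xi>\<^sup>a = \<zeta>\<^sub>a\<close>, \<open>\<xi>\<^sup>*\<^sub>a = \<zeta>\<^sub>r\<^sub>+\<^sub>a\<close> for \<open>a < r\<close>. It is the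
  bracket determined by \<open>{x\<^sup>*\<^sub>i, x\<^sup>j} = \<delta>\<close>, \<open>{\<xi>\<^sup>*\<^sub>a, \<xi>\<^sup>b} = \<delta>\<close>, super-antisymmetry and the derivation
  property; the odd part has a plus sign because \<open>{\<xi>\<^sup>b, \<xi>\<^sup>*\<^sub>a} = {\<xi>\<^sup>*\<^sub>a, \<xi>\<^sup>b}\<close>.\<close>

definition poisson :: "nat \<Rightarrow> nat \<Rightarrow> superfun \<Rightarrow> superfun \<Rightarrow> superfun"
  where "poisson n r F G =
    (\<Sum>i<n. partial_even (n + i) F \<odot> partial_even i G - partial_even i F \<odot> partial_even (n + i) G) +
    (\<Sum>a<r. right_odd (r + a) F \<odot> left_odd a G + right_odd a F \<odot> left_odd (r + a) G)"


section \<open>Functions on \<open>\<Pi>A\<close>, \<open>T\<^sup>*\<Pi>A\<close> and \<open>\<Pi>(A \<oplus> A\<^sup>*)\<close>\<close>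

text \<open>A chart of \<open>M\<close> and a local frame of \<open>A\<close> give coordinate systems on all these supermanifolds:
  \<^item> \<open>\<Pi>A\<close>: \<open>x\<^sup>i = z i\<close>, \<open>\<xi>\<^sup>a = \<zeta>\<^sub>a\<close>;
  \<^item> \<open>T\<^sup>*\<Pi>A\<close>: \<open>x\<^sup>i = z i\<close>, \<open>x\<^sup>*\<^sub>i = z (n + i)\<close>, \<open>\<xi>\<^sup>a = \<zeta>\<^sub>a\<close>, \<open>\<xi>\<^sup>*\<^sub>a = \<zeta>\<^sub>r\<^sub>+\<^sub>a\<close>;
  \<^item> \<open>\<Pi>(A \<oplus> A\<^sup>*)\<close>: \<open>x\<^sup>i = z i\<close>, \<open>\<xi>\<^sup>a = \<zeta>\<^sub>a\<close>, \<open>\<theta>\<^sub>a = \<zeta>\<^sub>r\<^sub>+\<^sub>a\<close>.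
  A function on one of them is given by its expressions in all these coordinate systems.
  \<open>\<Pi>A\<^sup>*\<close> and \<open>T\<^sup>*\<Pi>A\<^sup>*\<close> are covered by taking \<open>A\<^sup>*\<close> for \<open>A\<close>: then \<open>\<theta>\<^sub>a = \<zeta>\<^sub>a\<close> and \<open>\<theta>\<^sub>*\<^sup>a = \<zeta>\<^sub>r\<^sub>+\<^sub>a\<close>.\<close>

type_synonym ('m, 'v) coords = "'m chart \<times> ('m, 'v) frame"
type_synonym ('m, 'v) gfun = "('m, 'v) coords \<Rightarrow> superfun"

definition coord_dom :: "('m, 'v) coords \<Rightarrow> (nat \<Rightarrow> real) set"
  where "coord_dom c = (case c of ((U, \<phi>), (V, e)) \<Rightarrow> \<phi> ` (U \<inter> V))"

definition base_point :: "nat \<Rightarrow> ('m, 'v) coords \<Rightarrow> (nat \<Rightarrow> real) \<Rightarrow> 'm"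
  where "base_point n c z = (case c of ((U, \<phi>), _) \<Rightarrow> inv_into U \<phi> (trunc n z))"

text \<open>Equality of functions on \<open>T\<^sup>*\<Pi>A\<close>: equality in every coordinate system, on its domain.\<close>

definition eq_TPi ::
    "'m manifold \<Rightarrow> ('m, 'v::real_vector) vbundle \<Rightarrow> ('m, 'v) gfun \<Rightarrow> ('m, 'v) gfun \<Rightarrow> bool"
  where "eq_TPi M A F G \<longleftrightarrow>
    (\<forall>c\<in>charts M \<times> frames A. \<forall>z\<in>topspace (Euclidean_space (2 * mdim M)).
       trunc (mdim M) z \<in> coord_dom c \<longrightarrow> (\<forall>S\<subseteq>{..<2 * brank A}. F c S z = G c S z))"

text \<open>\<open>\<Gamma>(\<And>A\<^sup>*) = C\<^sup>\<infinity>(\<Pi>A)\<close>: on a fibre, \<open>\<omega> = \<Sum> \<omega>(e\<^bsub>a\<^sub>1\<^esub>, \<dots>, e\<^bsub>a\<^sub>k\<^esub>) \<xi>\<^bsup>a\<^sub>1\<^esup> \<cdots> \<xi>\<^bsup>a\<^sub>k\<^esup>\<close> over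
  \<open>a\<^sub>1 < \<cdots> < a\<^sub>k\<close>.\<close>

definition form_fun :: "'m manifold \<Rightarrow> ('m, 'v) form \<Rightarrow> ('m, 'v) gfun"
  where "form_fun M \<omega> c S z =
    \<omega> (base_point (mdim M) c z)
      (map (\<lambda>a. snd (snd c) a (base_point (mdim M) c z)) (sorted_list_of_set S))"

text \<open>A vector field \<open>v\<close> on \<open>\<Pi>A\<close>, given as an operator on \<open>\<Gamma>(\<And>A\<^sup>*)\<close>, applied to a function \<open>G\<close> that
  is defined only in one coordinate system (such as a coordinate): near the point in question
  \<open>G\<close> is replaced by a global function with the same germ.\<close>

definition vf_apply :: "'m manifold \<Rightarrow> ('m, 'v::real_vector) vbundle \<Rightarrow>
    (('m, 'v) form \<Rightarrow> ('m, 'v) form) \<Rightarrow> ('m, 'v) coords \<Rightarrow> superfun \<Rightarrow> superfun"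
  where "vf_apply M A v c G S z = (THE t. \<forall>\<omega>\<in>forms M A.
    (\<exists>W. openin (Euclidean_space (mdim M)) W \<and> z \<in> W \<and> W \<subseteq> coord_dom c \<and>
       (\<forall>z'\<in>W. \<forall>S'\<subseteq>{..<brank A}. form_fun M \<omega> c S' z' = G S' z')) \<longrightarrow>
    form_fun M (v \<omega>) c S z = t)"

text \<open>The hamiltonian lift \<open>h\<^sub>v = v\<^sup>\<alpha> x\<^sup>*\<^sub>\<alpha>\<close>, where \<open>v\<^sup>\<alpha> = v x\<^sup>\<alpha>\<close> is pulled back from \<open>\<Pi>A\<close> to \<open>T\<^sup>*\<Pi>A\<close>.\<close>

definition ham_lift :: "'m manifold \<Rightarrow> ('m, 'v::real_vector) vbundle \<Rightarrow>
    (('m, 'v) form \<Rightarrow> ('m, 'v) form) \<Rightarrow> ('m, 'v) gfun"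
  where "ham_lift M A v c =
    (let n = mdim M; r = brank A; \<pi> = pullback r (trunc n) ocoord in
      (\<Sum>i<n. \<pi> (vf_apply M A v c (ecoord i)) \<odot> ecoord (n + i)) +
      (\<Sum>a<r. \<pi> (vf_apply M A v c (ocoord a)) \<odot> ocoord (r + a)))"

text \<open>Pullback by the Legendre transform: \<open>L\<^sup>*\<theta>\<^sub>a = \<xi>\<^sup>*\<^sub>a\<close>, \<open>L\<^sup>*\<theta>\<^sub>*\<^sup>a = \<xi>\<^sup>a\<close>, identity on even coordinates.\<close>

definition legendre_pull :: "('m, 'v::real_vector) vbundle \<Rightarrow> ('m, 'v \<Rightarrow> real) gfun \<Rightarrow> ('m, 'v) gfun"
  where "legendre_pull A G c = (case c of (k, (V, e)) \<Rightarrow>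
    pullback (2 * brank A) (\<lambda>z. z)
      (\<lambda>b. if b < brank A then ocoord (brank A + b) else ocoord (b - brank A))
      (G (k, (V, dual_frame A e))))"

text \<open>Functions on \<open>M\<close> and sections of \<open>E\<close> as functions on \<open>\<Pi>(A \<oplus> A\<^sup>*)\<close>; a section is
  \<open>X\<^sup>a \<theta>\<^sub>a + f\<^sub>a \<xi>\<^sup>a\<close>.\<close>

definition base_gfun :: "'m manifold \<Rightarrow> ('m \<Rightarrow> real) \<Rightarrow> ('m, 'v) gfun"
  where "base_gfun M f c = base_fun (\<lambda>z. f (base_point (mdim M) c z))"

fun E_gfun :: "'m manifold \<Rightarrow> ('m, 'v::real_vector) vbundle \<Rightarrow> ('m, 'v) esec \<Rightarrow> ('m, 'v) gfun"
  where "E_gfun M A (X, \<xi>) c =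
    (let r = brank A; e = snd (snd c) in
      (\<Sum>a<r. base_gfun M (\<lambda>x. component r e x (X x) a) c \<odot> ocoord (r + a) +
             base_gfun M (\<lambda>x. component r (dual_frame A e) x (\<xi> x) a) c \<odot> ocoord a))"

text \<open>The projection \<open>p\<close>: \<open>p\<^sup>*x\<^sup>i = x\<^sup>i\<close>, \<open>p\<^sup>*\<xi>\<^sup>a = \<xi>\<^sup>a\<close>, \<open>p\<^sup>*\<theta>\<^sub>a = \<xi>\<^sup>*\<^sub>a\<close>; with the numbering above
  the odd coordinates keep their index.\<close>

definition p_pull :: "'m manifold \<Rightarrow> ('m, 'v::real_vector) vbundle \<Rightarrow> ('m, 'v) gfun \<Rightarrow> ('m, 'v) gfun"
  where "p_pull M A F c = pullback (2 * brank A) (trunc (mdim M)) ocoord (F c)"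

definition poisson_TPi :: "'m manifold \<Rightarrow> ('m, 'v::real_vector) vbundle \<Rightarrow>
    ('m, 'v) gfun \<Rightarrow> ('m, 'v) gfun \<Rightarrow> ('m, 'v) gfun"
  where "poisson_TPi M A F G c = poisson (mdim M) (brank A) (F c) (G c)"

definition parity_part :: "nat \<Rightarrow> ('m, 'v) gfun \<Rightarrow> ('m, 'v) gfun"
  where "parity_part k F c S z = (if card S mod 2 = k then F c S z else 0)"

text \<open>The derived bracket \<open>(-1)\<^bsup>|F| + 1\<^esup> {D F, G}\<close> for homogeneous \<open>F\<close>, extended by additivity in \<open>F\<close>.\<close>

definition derived_bracket :: "'m manifold \<Rightarrow> ('m, 'v::real_vector) vbundle \<Rightarrow>
    (('m, 'v) gfun \<Rightarrow> ('m, 'v) gfun) \<Rightarrow> ('m, 'v) gfun \<Rightarrow> ('m, 'v) gfun \<Rightarrow> ('m, 'v) gfun"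
  where "derived_bracket M A D F G =
    (\<Sum>k<2. (-1) ^ (k + 1) *\<^sub>R poisson_TPi M A (D (parity_part k F)) G)"

end

theory Submission
  imports Defs
begin

text \<open>
  Equality of functions on \<open>T\<^sup>*\<Pi>A\<close> is tested in the coordinate systems given by a chart of \<open>M\<close> and a frame
  \<open>e\<close> of \<open>A\<close>. Number the odd coordinates as \<open>\<zeta>\<^sub>a = \<xi>\<^sup>a\<close> and \<open>\<zeta>\<^sub>r\<^sub>+\<^sub>a = \<xi>\<^sup>*\<^sub>a\<close>. Then a section of \<open>E\<close> is a
  linear function \<open>\<Sum> w\<^sub>b \<zeta>\<^sub>b\<close>, and over each point of the base the generating function is
  \<open>\<theta> = \<Sum> \<alpha> b i x\<^sup>*\<^sub>i \<zeta>\<^sub>b + 1/6 \<Sum> K k l d \<zeta>\<^sub>k \<zeta>\<^sub>l \<zeta>\<^sub>d\<close>. Here \<open>\<alpha>\<close> lists the coefficients of both anchors, and the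
  alternating \<open>K\<close> contains the structure functions of both brackets: \<open>K p q (r + m) = - C p q m\<close> and
  \<open>K m (r + p) (r + q) = - C' p q m\<close>, all other values being permutations of these or zero
  (\<open>generator_cubic\<close>; the Legendre transform exchanges \<open>\<zeta>\<^sub>a\<close> and \<open>\<zeta>\<^sub>r\<^sub>+\<^sub>a\<close> without a sign in the
  monomials that occur).

  With this form of \<open>\<theta>\<close> the three claims are finite computations. The bracket of two linear functions
  pairs the coefficients with indices \<open>a\<close> and \<open>r + a\<close>, which is the pairing on \<open>E\<close>. The bracket of \<open>\<theta>\<close> with
  a function \<open>f\<close> on \<open>M\<close> has the coefficients \<open>\<Sum> \<alpha> b i \<partial>\<^sub>i f\<close>, the derivatives of \<open>f\<close> along both anchors.
  The coefficient of \<open>\<zeta>\<^sub>b\<close> in the iterated bracket consists of the anchors of the two sections applied to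
  their \<open>b\<close>-th components, of the \<open>b\<close>-th anchor applied to the components of the first section and paired with
  the second, and of \<open>K b\<close> contracted with both (\<open>iterated_bracket\<close>). On the other side, the Cartan
  formula expresses the Lie derivatives and contractions in the bracket on \<open>E\<close> through the same anchors
  and structure functions (\<open>bracket_covector_coeff\<close> and \<open>bracket_vector_coeff\<close>). Using the antisymmetry of the
  structure functions, both expressions agree term by term (\<open>bracket_eq_iterated\<close>).

  The differentials and brackets are defined on global objects, so their coordinate expressions
  rest on two facts. First, frames, coordinates and dual frames extend, near a given point, to
  global sections, functions and forms; this uses bump functions (\<open>bump_function\<close>, \<open>frame_extension\<close>).
  Second, the operations are local: the Leibniz rule turns the bracket of sections into
  the usual expression with structure functions at a point (\<open>structure_fun_exists\<close>), and this makes the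
  Cartan formula depend only on the values of the sections there (\<open>lie_d_two\<close>). Hence the components
  of \<open>d\<^sub>A\<close> as a vector field are the anchor and the structure functions (\<open>vf_apply_even\<close>, \<open>vf_apply_odd\<close>).
\<close>

section \<open>Smooth functions on open subsets of real n-space\<close>

abbreviation Rn :: "nat \<Rightarrow> (nat \<Rightarrow> real) set"
  where "Rn n \<equiv> {z. \<forall>i\<ge>n. z i = 0}"

lemma Euclidean_space_top_of_set: "Euclidean_space n = top_of_set (Rn n)"
  unfolding Euclidean_space_def euclidean_product_topology ..

lemma openin_Euclidean_space_subset: "openin (Euclidean_space n) V \<Longrightarrow> V \<subseteq> Rn n"
  using openin_subset topspace_Euclidean_space by blast

text \<open>A basic open set of the product topology restricts each coordinate to an open set, and those
  with index at least \<open>n\<close> vanish on \<open>\<real>\<^sup>n\<close>; only the first \<open>n\<close> restrictions remain, and finitely many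
  positive radii have a positive minimum.\<close>

lemma openin_Euclidean_space_box:
  assumes V: "openin (Euclidean_space n) V" and z: "z \<in> V"
  shows "\<exists>\<epsilon>>0. \<forall>z'. z' \<in> Rn n \<and> (\<forall>i<n. \<bar>z' i - z i\<bar> < \<epsilon>) \<longrightarrow> z' \<in> V"
proof -
  obtain T where T: "open T" "V = Rn n \<inter> T"
    using V unfolding Euclidean_space_top_of_set openin_open by blast
  have "openin (product_topology (\<lambda>i. euclidean) UNIV) T"
    using T(1) by (simp add: euclidean_product_topology)
  moreover have "z \<in> T" using z T by blast
  ultimately obtain X where X: "z \<in> (\<Pi>\<^sub>E i\<in>UNIV. X i)" "\<And>i. open (X i)" "(\<Pi>\<^sub>E i\<in>UNIV. X i) \<subseteq> T"
    using product_topology_open_contains_basis[of "\<lambda>i. euclidean" UNIV T z] by auto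
  have zV: "z \<in> Rn n" using z T by blast
  have "\<exists>e>0. \<forall>t. \<bar>t - z i\<bar> < e \<longrightarrow> t \<in> X i" for i
    using X(1) X(2)[of i] unfolding open_dist by (auto simp: dist_real_def PiE_iff)
  then obtain e where e: "\<And>i. e i > 0" "\<And>i t. \<bar>t - z i\<bar> < e i \<Longrightarrow> t \<in> X i" by metis
  define \<epsilon> where "\<epsilon> = Min (insert 1 (e ` {..<n}))"
  have "\<epsilon> > 0" unfolding \<epsilon>_def using e(1) by (subst Min_gr_iff) auto
  then show ?thesis
  proof (intro exI[of _ \<epsilon>] conjI allI impI; (elim conjE)?)
    fix z' assume that: "z' \<in> Rn n" "\<forall>i<n. \<bar>z' i - z i\<bar> < \<epsilon>"
    have "z' i \<in> X i" for i
    proof (cases "i < n")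
      case True
      then have "\<epsilon> \<le> e i" unfolding \<epsilon>_def by (intro Min_le) auto
      then show ?thesis using e(2)[of "z' i" i] that(2)[rule_format, OF True] by linarith
    next
      case False
      then show ?thesis using that(1) zV e(2)[of "z' i" i] e(1)[of i] by simp
    qed
    then have "z' \<in> T" using X(3) by (auto simp: PiE_UNIV_domain)
    then show "z' \<in> V" using T(2) that(1) by blast
  qed
qed

lemma eventually_slice_in:
  assumes V: "openin (Euclidean_space n) V" and z: "z \<in> V" and i: "i < n"
  shows "\<forall>\<^sub>F t in nhds (z i). z(i := t) \<in> V"
proof -
  obtain \<epsilon> where \<epsilon>: "\<epsilon> > 0" "\<And>z'. z' \<in> Rn n \<and> (\<forall>i<n. \<bar>z' i - z i\<bar> < \<epsilon>) \<Longrightarrow> z' \<in> V"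
    using openin_Euclidean_space_box[OF V z] by blast
  have "z \<in> Rn n" using openin_Euclidean_space_subset[OF V] z by blast
  then have "z(i := t) \<in> V" if "dist t (z i) < \<epsilon>" for t
    using that i \<epsilon> by (intro \<epsilon>(2)) (auto simp: dist_real_def)
  then show ?thesis using \<epsilon>(1) unfolding eventually_nhds_metric by blast
qed

abbreviation slice_diff :: "nat \<Rightarrow> ((nat \<Rightarrow> real) \<Rightarrow> real) \<Rightarrow> (nat \<Rightarrow> real) \<Rightarrow> bool"
  where "slice_diff i g z \<equiv> (\<lambda>t. g (z(i := t))) field_differentiable at (z i)"

lemma partial_cong:
  assumes "openin (Euclidean_space n) V" "z \<in> V" "i < n" "\<And>z. z \<in> V \<Longrightarrow> g z = h z"
  shows "partial i g z = partial i h z"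
  unfolding partial_def
  by (rule deriv_cong_ev) (use eventually_slice_in[OF assms(1-3)] assms(4) in \<open>auto elim: eventually_mono\<close>)

lemma slice_diff_cong:
  assumes "openin (Euclidean_space n) V" "z \<in> V" "i < n" "\<And>z. z \<in> V \<Longrightarrow> g z = h z"
    and "slice_diff i h z"
  shows "slice_diff i g z"
proof -
  obtain d where d: "((\<lambda>t. h (z(i := t))) has_field_derivative d) (at (z i))"
    using assms(5) unfolding field_differentiable_def by blast
  have "\<forall>\<^sub>F t in nhds (z i). g (z(i := t)) = h (z(i := t))"
    using eventually_slice_in[OF assms(1-3)] by (rule eventually_mono) (use assms(4) in auto)
  then have "((\<lambda>t. g (z(i := t))) has_field_derivative d) (at (z i))"
    using d by (subst has_field_derivative_cong_ev[of "z i" "z i" UNIV _ "\<lambda>t. h (z(i := t))" d d UNIV])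
      (auto elim: eventually_mono)
  then show ?thesis unfolding field_differentiable_def by blast
qed

lemma smooth_Rn_continuous: "smooth_Rn n V g \<Longrightarrow> continuous_on V g"
  unfolding smooth_Rn_def by (metis empty_subsetI foldr_Nil id_apply list.set(1))

lemma smooth_Rn_slice_diff: "smooth_Rn n V g \<Longrightarrow> z \<in> V \<Longrightarrow> i < n \<Longrightarrow> slice_diff i g z"
  unfolding smooth_Rn_def by (drule spec[of _ "[]"]) simp

lemma smooth_Rn_partial:
  assumes "smooth_Rn n V g" "i < n"
  shows "smooth_Rn n V (partial i g)"
  unfolding smooth_Rn_def
proof (intro allI impI)
  fix ks assume "set ks \<subseteq> {..<n}"
  then have "set (ks @ [i]) \<subseteq> {..<n}" using assms(2) by simp
  then show "continuous_on V (foldr partial ks (partial i g)) \<and>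
       (\<forall>z\<in>V. \<forall>j<n. slice_diff j (foldr partial ks (partial i g)) z)"
    using assms(1)[unfolded smooth_Rn_def, rule_format, of "ks @ [i]"] by simp
qed

lemma smooth_Rn_subset: "smooth_Rn n V g \<Longrightarrow> W \<subseteq> V \<Longrightarrow> smooth_Rn n W g"
  unfolding smooth_Rn_def by (meson continuous_on_subset subsetD)

text \<open>Smoothness is a coinductive notion: it suffices to exhibit a class of functions that are
  continuous and partially differentiable and whose partial derivatives lie in the class again.
  All closure properties below are obtained this way.\<close>

lemma smooth_Rn_coinduct:
  assumes V: "openin (Euclidean_space n) V" and g: "P g"
    and step: "\<And>g. P g \<Longrightarrow> continuous_on V g \<and> (\<forall>i<n. (\<forall>z\<in>V. slice_diff i g z) \<and>
                 (\<exists>h. P h \<and> (\<forall>z\<in>V. partial i g z = h z)))"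
  shows "smooth_Rn n V g"
proof -
  have *: "\<exists>h. P h \<and> (\<forall>z\<in>V. foldr partial ks g z = h z)" if "set ks \<subseteq> {..<n}" for ks
    using that
  proof (induction ks)
    case Nil
    then show ?case using g by auto
  next
    case (Cons k ks)
    then obtain h where h: "P h" "\<forall>z\<in>V. foldr partial ks g z = h z" by auto
    then obtain h' where h': "P h'" "\<forall>z\<in>V. partial k h z = h' z" using step[OF h(1)] Cons.prems by auto
    have "\<forall>z\<in>V. foldr partial (k # ks) g z = h' z"
      using h' h(2) Cons.prems partial_cong[OF V, of _ k "foldr partial ks g" h] by simp
    then show ?case using h'(1) by blast
  qed
  show ?thesis unfolding smooth_Rn_def
  proof (intro allI impI)
    fix ks assume ks: "set ks \<subseteq> {..<n}"
    obtain h where h: "P h" "\<forall>z\<in>V. foldr partial ks g z = h z" using *[OF ks] by blast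
    have "continuous_on V h" using step[OF h(1)] by blast
    then have "continuous_on V (foldr partial ks g)"
      using h(2) continuous_on_cong by blast
    moreover have "slice_diff i (foldr partial ks g) z" if "z \<in> V" "i < n" for z i
      using slice_diff_cong[OF V that, of "foldr partial ks g" h] h step[OF h(1)] that by blast
    ultimately show "continuous_on V (foldr partial ks g) \<and>
       (\<forall>z\<in>V. \<forall>i<n. slice_diff i (foldr partial ks g) z)" by blast
  qed
qed

lemma smooth_Rn_cong:
  assumes "openin (Euclidean_space n) V" "smooth_Rn n V h" "\<And>z. z \<in> V \<Longrightarrow> g z = h z"
  shows "smooth_Rn n V g"
proof (rule smooth_Rn_coinduct[OF assms(1), where P = "\<lambda>g. \<exists>h. smooth_Rn n V h \<and> (\<forall>z\<in>V. g z = h z)"])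
  show "\<exists>h. smooth_Rn n V h \<and> (\<forall>z\<in>V. g z = h z)" using assms by blast
next
  fix g assume "\<exists>h. smooth_Rn n V h \<and> (\<forall>z\<in>V. g z = h z)"
  then obtain h where h: "smooth_Rn n V h" "\<forall>z\<in>V. g z = h z" by blast
  show "continuous_on V g \<and> (\<forall>i<n. (\<forall>z\<in>V. slice_diff i g z) \<and>
          (\<exists>h'. (\<exists>h. smooth_Rn n V h \<and> (\<forall>z\<in>V. h' z = h z)) \<and> (\<forall>z\<in>V. partial i g z = h' z)))"
  proof (intro conjI allI impI ballI)
    show "continuous_on V g" using smooth_Rn_continuous[OF h(1)] h(2) continuous_on_cong by blast
    fix i assume i: "i < n"
    show "slice_diff i g z" if "z \<in> V" for z
      using slice_diff_cong[OF assms(1) that i, of g h] h smooth_Rn_slice_diff[OF h(1) that i] by blast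
    show "\<exists>h'. (\<exists>h. smooth_Rn n V h \<and> (\<forall>z\<in>V. h' z = h z)) \<and> (\<forall>z\<in>V. partial i g z = h' z)"
      using smooth_Rn_partial[OF h(1) i] partial_cong[OF assms(1) _ i, of _ g h] h(2) by blast
  qed
qed

text \<open>Being open in the sense of the subspace, neighbourhoods of \<open>z\<close> in \<open>V\<close> and in \<open>W\<close> give the
  same filter, so smoothness can be checked near each point.\<close>

lemma smooth_Rn_local:
  assumes V: "V \<subseteq> Rn n"
    and loc: "\<And>z. z \<in> V \<Longrightarrow> \<exists>W. openin (Euclidean_space n) W \<and> z \<in> W \<and> smooth_Rn n W g"
  shows "smooth_Rn n V g"
  unfolding smooth_Rn_def
proof (intro allI impI)
  fix ks assume ks: "set ks \<subseteq> {..<n}"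
  have cont: "continuous (at z within V) (foldr partial ks g)" if z: "z \<in> V" for z
  proof -
    obtain W where W: "openin (Euclidean_space n) W" "z \<in> W" "smooth_Rn n W g"
      using loc[OF z] by blast
    have "continuous_on W (foldr partial ks g)" using W(3) ks unfolding smooth_Rn_def by blast
    then have c: "continuous (at z within W) (foldr partial ks g)"
      using W(2) continuous_on_eq_continuous_within by blast
    obtain T where T: "open T" "W = Rn n \<inter> T"
      using W(1) unfolding Euclidean_space_top_of_set openin_open by blast
    have "continuous (at z within (V \<inter> T)) (foldr partial ks g)"
      using c by (rule continuous_within_subset) (use T V in auto)
    moreover have "at z within (V \<inter> T) = at z within V"
      by (rule at_within_nhd[of z T]) (use T W(2) in auto)
    ultimately show ?thesis by simp
  qed
  have "slice_diff i (foldr partial ks g) z" if z: "z \<in> V" and i: "i < n" for z i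
    using loc[OF z] ks i unfolding smooth_Rn_def by blast
  then show "continuous_on V (foldr partial ks g) \<and>
       (\<forall>z\<in>V. \<forall>i<n. slice_diff i (foldr partial ks g) z)"
    using cont continuous_on_eq_continuous_within by blast
qed

subsection \<open>The flat functions\<close>

text \<open>The class of the functions \<open>p(1/x) e\<^bsup>-1/x\<^esup>\<close> on the positive half line, extended by zero,
  is closed under differentiation. For \<open>p = 1\<close> this is the usual flat function from which bump
  functions are made; keeping \<open>p\<close> general is what makes the class closed.\<close>

definition flat :: "real poly \<Rightarrow> real \<Rightarrow> real"
  where "flat p x = (if x > 0 then poly p (1 / x) * exp (- (1 / x)) else 0)"

definition flat_deriv :: "real poly \<Rightarrow> real poly"
  where "flat_deriv p = pCons 0 (pCons 0 (p - pderiv p))"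

text \<open>With \<open>t = 1/x\<close> this says that the exponential function outgrows polynomials.\<close>

lemma flat_tendsto_0: "(flat p \<longlongrightarrow> 0) (at_right 0)"
proof -
  have "((\<lambda>t. \<Sum>i\<le>degree p. coeff p i * (t ^ i / exp t)) \<longlongrightarrow> (\<Sum>i\<le>degree p. coeff p i * 0)) at_top"
    by (intro tendsto_intros tendsto_power_div_exp_0)
  then have "((\<lambda>t. poly p t * exp (- t)) \<longlongrightarrow> 0) at_top"
    by (simp add: poly_altdef sum_distrib_right exp_minus field_class.field_divide_inverse mult.assoc)
  then have "((\<lambda>x. poly p (inverse x) * exp (- (inverse x))) \<longlongrightarrow> 0) (at_right 0)"
    by (rule filterlim_compose[OF _ filterlim_inverse_at_top_right])
  then show ?thesis
    by (rule Lim_transform_eventually)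
      (auto simp: flat_def eventually_at_right_field inverse_eq_divide intro: exI[of _ 1])
qed

lemma flat_has_derivative: "(flat p has_real_derivative flat (flat_deriv p) x) (at x)"
proof (cases x "0 :: real" rule: linorder_cases)
  case less
  have "((\<lambda>x. 0) has_real_derivative 0) (at x)" by simp
  then have "(flat p has_real_derivative 0) (at x)"
    by (rule has_field_derivative_transform_within_open[of _ _ _ "{..<0}"]) (use less in \<open>auto simp: flat_def\<close>)
  then show ?thesis using less by (simp add: flat_def)
next
  case greater
  have "((\<lambda>x. poly p (1 / x) * exp (- (1 / x))) has_real_derivative
      poly (flat_deriv p) (1 / x) * exp (- (1 / x))) (at x)"
    using greater
    by (auto intro!: derivative_eq_intros simp: flat_deriv_def power2_eq_square field_simps)
  then have "(flat p has_real_derivative poly (flat_deriv p) (1 / x) * exp (- (1 / x))) (at x)"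
    by (rule has_field_derivative_transform_within_open[of _ _ _ "{0<..}"]) (use greater in \<open>auto simp: flat_def\<close>)
  then show ?thesis using greater by (simp add: flat_def)
next
  case equal
  \<comment> \<open>dividing by \<open>y\<close> multiplies the polynomial in \<open>1/y\<close> by its variable\<close>
  have "((\<lambda>y. (flat p y - flat p 0) / (y - 0)) \<longlongrightarrow> 0) (at_right 0)"
    using flat_tendsto_0[of "pCons 0 p"]
    by (rule Lim_transform_eventually) (auto simp: flat_def eventually_at_right_field intro: exI[of _ 1])
  moreover have "((\<lambda>y. (flat p y - flat p 0) / (y - 0)) \<longlongrightarrow> 0) (at_left 0)"
    by (rule Lim_transform_eventually[OF tendsto_const])
      (auto simp: flat_def eventually_at_left_field intro: exI[of _ "-1"])
  ultimately show ?thesis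
    using equal by (simp add: has_field_derivative_iff flat_def filterlim_at_split)
qed

lemma continuous_on_flat: "continuous_on UNIV (flat p)"
  using flat_has_derivative by (meson DERIV_continuous_on has_field_derivative_at_within)

lemma flat_pos: "x > 0 \<Longrightarrow> flat 1 x > 0"
  by (simp add: flat_def)

lemma flat_mono: "x \<le> y \<Longrightarrow> flat 1 x \<le> flat 1 y"
  by (auto simp: flat_def frac_le)

subsection \<open>Closure properties\<close>

text \<open>Products are differentiated by the Leibniz rule and compositions with flat functions by the
  one-variable chain rule, so the class generated from smooth functions by these operations
  is closed under partial derivatives.\<close>

inductive smooth_alg :: "nat \<Rightarrow> (nat \<Rightarrow> real) set \<Rightarrow> ((nat \<Rightarrow> real) \<Rightarrow> real) \<Rightarrow> bool"
  for n V where
  base: "smooth_Rn n V g \<Longrightarrow> smooth_alg n V g"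
| const: "smooth_alg n V (\<lambda>z. c)"
| add: "smooth_alg n V g \<Longrightarrow> smooth_alg n V h \<Longrightarrow> smooth_alg n V (\<lambda>z. g z + h z)"
| mult: "smooth_alg n V g \<Longrightarrow> smooth_alg n V h \<Longrightarrow> smooth_alg n V (\<lambda>z. g z * h z)"
| flat: "smooth_alg n V g \<Longrightarrow> smooth_alg n V (\<lambda>z. flat p (g z))"

abbreviation slice_deriv ::
    "nat \<Rightarrow> ((nat \<Rightarrow> real) \<Rightarrow> real) \<Rightarrow> ((nat \<Rightarrow> real) \<Rightarrow> real) \<Rightarrow> (nat \<Rightarrow> real) \<Rightarrow> bool"
  where "slice_deriv i g h z \<equiv> ((\<lambda>t. g (z(i := t))) has_field_derivative h z) (at (z i))"

lemma smooth_alg_step: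
  assumes "smooth_alg n V g"
  shows "continuous_on V g \<and> (\<forall>i<n. \<exists>h. smooth_alg n V h \<and> (\<forall>z\<in>V. slice_deriv i g h z))"
  using assms
proof induction
  case (base g)
  show ?case
  proof (intro conjI allI impI)
    fix i assume i: "i < n"
    have "slice_deriv i g (partial i g) z" if "z \<in> V" for z
      using smooth_Rn_slice_diff[OF base that i] unfolding partial_def
      by (simp add: DERIV_deriv_iff_field_differentiable)
    moreover have "smooth_alg n V (partial i g)"
      by (rule smooth_alg.base[OF smooth_Rn_partial[OF base i]])
    ultimately show "\<exists>h. smooth_alg n V h \<and> (\<forall>z\<in>V. slice_deriv i g h z)" by blast
  qed (rule smooth_Rn_continuous[OF base])
next
  case (const c)
  have "smooth_alg n V (\<lambda>z. 0)" by (rule smooth_alg.const)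
  then show ?case by (auto intro!: exI[of _ "\<lambda>z. 0"])
next
  case (add g h)
  show ?case
  proof (intro conjI allI impI)
    show "continuous_on V (\<lambda>z. g z + h z)" using add by (auto intro: continuous_on_add)
    fix i assume i: "i < n"
    obtain g' where g': "smooth_alg n V g'" "\<forall>z\<in>V. slice_deriv i g g' z" using add.IH(1) i by blast
    obtain h' where h': "smooth_alg n V h'" "\<forall>z\<in>V. slice_deriv i h h' z" using add.IH(2) i by blast
    have "slice_deriv i (\<lambda>z. g z + h z) (\<lambda>z. g' z + h' z) z" if "z \<in> V" for z
      using that g'(2) h'(2) by (intro DERIV_add) auto
    then show "\<exists>k. smooth_alg n V k \<and> (\<forall>z\<in>V. slice_deriv i (\<lambda>z. g z + h z) k z)"
      using smooth_alg.add[OF g'(1) h'(1)] by blast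
  qed
next
  case (mult g h)
  show ?case
  proof (intro conjI allI impI)
    show "continuous_on V (\<lambda>z. g z * h z)" using mult by (auto intro: continuous_on_mult)
    fix i assume i: "i < n"
    obtain g' where g': "smooth_alg n V g'" "\<forall>z\<in>V. slice_deriv i g g' z" using mult.IH(1) i by blast
    obtain h' where h': "smooth_alg n V h'" "\<forall>z\<in>V. slice_deriv i h h' z" using mult.IH(2) i by blast
    have "slice_deriv i (\<lambda>z. g z * h z) (\<lambda>z. g' z * h z + h' z * g z) z" if "z \<in> V" for z
      using DERIV_mult[OF bspec[OF g'(2) that] bspec[OF h'(2) that]] by simp
    then show "\<exists>k. smooth_alg n V k \<and> (\<forall>z\<in>V. slice_deriv i (\<lambda>z. g z * h z) k z)"
      using smooth_alg.add[OF smooth_alg.mult[OF g'(1) mult.hyps(2)] smooth_alg.mult[OF h'(1) mult.hyps(1)]]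
      by blast
  qed
next
  case (flat g p)
  show ?case
  proof (intro conjI allI impI)
    show "continuous_on V (\<lambda>z. flat p (g z))"
      using flat by (auto intro: continuous_on_compose2[OF continuous_on_flat])
    fix i assume i: "i < n"
    obtain g' where g': "smooth_alg n V g'" "\<forall>z\<in>V. slice_deriv i g g' z" using flat.IH i by blast
    have "slice_deriv i (\<lambda>z. flat p (g z)) (\<lambda>z. flat (flat_deriv p) (g z) * g' z) z" if "z \<in> V" for z
      using DERIV_chain2[where g = "\<lambda>t. g (z(i := t))", OF flat_has_derivative bspec[OF g'(2) that]] by simp
    then show "\<exists>k. smooth_alg n V k \<and> (\<forall>z\<in>V. slice_deriv i (\<lambda>z. flat p (g z)) k z)"
      using smooth_alg.mult[OF smooth_alg.flat[OF flat.hyps] g'(1)] by blast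
  qed
qed

lemma partialI:
  "slice_deriv i g h z \<Longrightarrow> slice_diff i g z \<and> partial i g z = h z"
  unfolding partial_def by (auto simp: field_differentiable_def DERIV_imp_deriv)

lemma smooth_alg_imp_smooth_Rn:
  assumes "openin (Euclidean_space n) V" "smooth_alg n V g"
  shows "smooth_Rn n V g"
proof (rule smooth_Rn_coinduct[OF assms(1), where P = "smooth_alg n V"])
  fix g assume "smooth_alg n V g"
  from smooth_alg_step[OF this]
  show "continuous_on V g \<and> (\<forall>i<n. (\<forall>z\<in>V. slice_diff i g z) \<and>
           (\<exists>h. smooth_alg n V h \<and> (\<forall>z\<in>V. partial i g z = h z)))"
    using partialI by meson
qed (rule assms(2))

lemmas smooth_Rn_const = smooth_alg_imp_smooth_Rn[OF _ smooth_alg.const]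
  and smooth_Rn_add = smooth_alg_imp_smooth_Rn[OF _ smooth_alg.add[OF smooth_alg.base smooth_alg.base]]
  and smooth_Rn_mult = smooth_alg_imp_smooth_Rn[OF _ smooth_alg.mult[OF smooth_alg.base smooth_alg.base]]
  and smooth_Rn_flat = smooth_alg_imp_smooth_Rn[OF _ smooth_alg.flat[OF smooth_alg.base]]

section \<open>Smooth functions and bump functions on a manifold\<close>

locale manifold_on =
  fixes M :: "'m::{t2_space, second_countable_topology} manifold"
  assumes manifold: "smooth_manifold M"
begin

lemma chart_at: "\<exists>U \<phi>. (U, \<phi>) \<in> charts M \<and> x \<in> U"
proof -
  have "(\<Union>(U, \<phi>)\<in>charts M. U) = UNIV"
    using manifold unfolding smooth_manifold_def by (rule conjunct1)
  then obtain c where "c \<in> charts M" "x \<in> (case c of (U, \<phi>) \<Rightarrow> U)" by (metis UNIV_I UN_E)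
  then show ?thesis by (cases c) auto
qed

context
  fixes U \<phi> assumes chart: "(U, \<phi>) \<in> charts M"
begin

lemma chart_open: "open U"
  and chart_homeomorphism: "homeomorphism U (\<phi> ` U) \<phi> (inv_into U \<phi>)"
  and chart_image_openin: "openin (Euclidean_space (mdim M)) (\<phi> ` U)"
  using conjunct1[OF conjunct2[OF manifold[unfolded smooth_manifold_def]]] chart by auto

lemma chart_inv [simp]: "x \<in> U \<Longrightarrow> inv_into U \<phi> (\<phi> x) = x"
  using chart_homeomorphism unfolding homeomorphism_def by blast

lemma chart_inv_in: "z \<in> \<phi> ` (U \<inter> W) \<Longrightarrow> inv_into U \<phi> z \<in> U \<inter> W"
  by auto

lemma chart_inv_inv: "z \<in> \<phi> ` (U \<inter> W) \<Longrightarrow> \<phi> (inv_into U \<phi> z) = z"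
  by auto

lemma chart_openin:
  assumes "open W"
  shows "openin (Euclidean_space (mdim M)) (\<phi> ` (U \<inter> W))"
proof -
  have "openin (top_of_set (\<phi> ` U)) (\<phi> ` (U \<inter> W))"
    by (rule homeomorphism_imp_open_map[OF chart_homeomorphism]) (use assms in \<open>auto simp: openin_open\<close>)
  then show ?thesis
    using chart_image_openin unfolding Euclidean_space_top_of_set by (rule openin_trans)
qed

lemma chart_in_Rn: "x \<in> U \<Longrightarrow> \<phi> x \<in> Rn (mdim M)"
  using openin_Euclidean_space_subset[OF chart_image_openin] by blast

lemma chart_preimage_open:
  assumes "openin (Euclidean_space (mdim M)) W"
  shows "open {x \<in> U. \<phi> x \<in> W}"
proof -
  obtain T where T: "open T" "W = Rn (mdim M) \<inter> T"
    using assms unfolding Euclidean_space_top_of_set openin_open by blast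
  have "continuous_on U \<phi>" using chart_homeomorphism unfolding homeomorphism_def by blast
  then have "open (\<phi> -` T \<inter> U)" using continuous_on_open_vimage[OF chart_open] T(1) by blast
  moreover have "{x \<in> U. \<phi> x \<in> W} = \<phi> -` T \<inter> U" using chart_in_Rn T(2) by blast
  ultimately show ?thesis by simp
qed

lemma smooth_fun_in_chart:
  "smooth_fun M W f \<Longrightarrow> smooth_Rn (mdim M) (\<phi> ` (U \<inter> W)) (f \<circ> inv_into U \<phi>)"
  using chart unfolding smooth_fun_def by blast

lemma smooth_fun_chart_coord: "i < mdim M \<Longrightarrow> smooth_fun M U (\<lambda>x. \<phi> x i)"
  using manifold chart unfolding smooth_manifold_def smooth_fun_def comp_def by fast

end

lemma smooth_funI:
  assumes "\<And>U \<phi>. (U, \<phi>) \<in> charts M \<Longrightarrow> smooth_Rn (mdim M) (\<phi> ` (U \<inter> W)) (\<lambda>z. f (inv_into U \<phi> z))"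
  shows "smooth_fun M W f"
  using assms unfolding smooth_fun_def comp_def by blast

lemma smooth_fun_cong:
  assumes "open W" "smooth_fun M W f" "\<And>x. x \<in> W \<Longrightarrow> f x = g x"
  shows "smooth_fun M W g"
proof (rule smooth_funI)
  fix U \<phi> assume c: "(U, \<phi>) \<in> charts M"
  show "smooth_Rn (mdim M) (\<phi> ` (U \<inter> W)) (\<lambda>z. g (inv_into U \<phi> z))"
    by (rule smooth_Rn_cong[OF chart_openin[OF c assms(1)] smooth_fun_in_chart[OF c assms(2)]])
      (use assms(3) c in auto)
qed

lemma smooth_fun_subset: "smooth_fun M W f \<Longrightarrow> W' \<subseteq> W \<Longrightarrow> smooth_fun M W' f"
proof (rule smooth_funI)
  fix U \<phi> assume "smooth_fun M W f" "W' \<subseteq> W" and c: "(U, \<phi>) \<in> charts M"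
  then show "smooth_Rn (mdim M) (\<phi> ` (U \<inter> W')) (\<lambda>z. f (inv_into U \<phi> z))"
    using smooth_Rn_subset[OF smooth_fun_in_chart[OF c, of W f], of "\<phi> ` (U \<inter> W')"]
    unfolding comp_def by blast
qed

lemma smooth_fun_local:
  assumes "\<And>x. x \<in> W \<Longrightarrow> \<exists>W'. open W' \<and> x \<in> W' \<and> smooth_fun M W' f"
  shows "smooth_fun M W f"
proof (rule smooth_funI)
  fix U \<phi> assume c: "(U, \<phi>) \<in> charts M"
  show "smooth_Rn (mdim M) (\<phi> ` (U \<inter> W)) (\<lambda>z. f (inv_into U \<phi> z))"
  proof (rule smooth_Rn_local)
    show "\<phi> ` (U \<inter> W) \<subseteq> Rn (mdim M)" using chart_in_Rn[OF c] by blast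
    fix z assume z: "z \<in> \<phi> ` (U \<inter> W)"
    then obtain x where x: "x \<in> U" "x \<in> W" "z = \<phi> x" by blast
    obtain W' where W': "open W'" "x \<in> W'" "smooth_fun M W' f" using assms[OF x(2)] by blast
    show "\<exists>V. openin (Euclidean_space (mdim M)) V \<and> z \<in> V \<and> smooth_Rn (mdim M) V (\<lambda>z. f (inv_into U \<phi> z))"
      using chart_openin[OF c W'(1)] smooth_fun_in_chart[OF c W'(3)] x W'(2) unfolding comp_def by blast
  qed
qed

lemma smooth_fun_const: "open W \<Longrightarrow> smooth_fun M W (\<lambda>x. c)"
  by (rule smooth_funI) (intro smooth_Rn_const chart_openin)

context
  fixes W f assumes W: "open W" and f: "smooth_fun M W f"
begin

lemma smooth_fun_add:
  assumes g: "smooth_fun M W g"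
  shows "smooth_fun M W (\<lambda>x. f x + g x)"
proof (rule smooth_funI)
  fix U \<phi> assume c: "(U, \<phi>) \<in> charts M"
  show "smooth_Rn (mdim M) (\<phi> ` (U \<inter> W)) (\<lambda>z. f (inv_into U \<phi> z) + g (inv_into U \<phi> z))"
    using smooth_Rn_add[OF chart_openin[OF c W] smooth_fun_in_chart[OF c f] smooth_fun_in_chart[OF c g]]
    by (simp add: comp_def)
qed

lemma smooth_fun_mult:
  assumes g: "smooth_fun M W g"
  shows "smooth_fun M W (\<lambda>x. f x * g x)"
proof (rule smooth_funI)
  fix U \<phi> assume c: "(U, \<phi>) \<in> charts M"
  show "smooth_Rn (mdim M) (\<phi> ` (U \<inter> W)) (\<lambda>z. f (inv_into U \<phi> z) * g (inv_into U \<phi> z))"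
    using smooth_Rn_mult[OF chart_openin[OF c W] smooth_fun_in_chart[OF c f] smooth_fun_in_chart[OF c g]]
    by (simp add: comp_def)
qed

lemma smooth_fun_flat: "smooth_fun M W (\<lambda>x. flat p (f x))"
proof (rule smooth_funI)
  fix U \<phi> assume c: "(U, \<phi>) \<in> charts M"
  show "smooth_Rn (mdim M) (\<phi> ` (U \<inter> W)) (\<lambda>z. flat p (f (inv_into U \<phi> z)))"
    using smooth_Rn_flat[OF chart_openin[OF c W] smooth_fun_in_chart[OF c f]] by (simp add: comp_def)
qed

end

lemma smooth_fun_sum:
  assumes "open W" "finite I" "\<And>i. i \<in> I \<Longrightarrow> smooth_fun M W (f i)"
  shows "smooth_fun M W (\<lambda>x. \<Sum>i\<in>I. f i x)"
  using assms(2,3) by induction (auto intro: smooth_fun_const smooth_fun_add assms(1))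

text \<open>The product is smooth on \<open>V\<close>, where \<open>g\<close> is defined, and vanishes on the open complement of \<open>K\<close>;
  these two sets cover everything. This is how local data become global ones.\<close>

lemma smooth_fun_extend_zero:
  assumes "open V" "closed K" "K \<subseteq> V" "open W"
    and "smooth_fun M W \<beta>" "\<And>x. x \<notin> K \<Longrightarrow> \<beta> x = 0" "smooth_fun M (V \<inter> W) g"
  shows "smooth_fun M W (\<lambda>x. if x \<in> V then \<beta> x * g x else 0)"
proof (rule smooth_fun_local)
  fix x assume x: "x \<in> W"
  show "\<exists>W'. open W' \<and> x \<in> W' \<and> smooth_fun M W' (\<lambda>x. if x \<in> V then \<beta> x * g x else 0)"
  proof (cases "x \<in> K")
    case True
    have o: "open (V \<inter> W)" using assms by blast
    have "smooth_fun M (V \<inter> W) (\<lambda>x. \<beta> x * g x)"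
      by (intro smooth_fun_mult[OF o] assms(7) smooth_fun_subset[OF assms(5)]) auto
    then have "smooth_fun M (V \<inter> W) (\<lambda>x. if x \<in> V then \<beta> x * g x else 0)"
      by (rule smooth_fun_cong[OF o]) auto
    then show ?thesis using o x True assms(3) by blast
  next
    case False
    have o: "open (- K)" using assms(2) by blast
    have "smooth_fun M (- K) (\<lambda>x. if x \<in> V then \<beta> x * g x else 0)"
      by (rule smooth_fun_cong[OF o smooth_fun_const[OF o, of 0]]) (use assms(6) in auto)
    then show ?thesis using o False by blast
  qed
qed

text \<open>With \<open>u = e\<^bsup>-1/x\<^esup>\<close> extended by zero, \<open>u (u 3 - u (q - 1)) / u 3\<close> is \<open>1\<close> where \<open>q \<le> 1\<close> and \<open>0\<close>
  where \<open>q \<ge> 4\<close>. For \<open>q\<close> the squared distance from a point in a chart, scaled so that \<open>q \<le> 4\<close>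
  describes a compact part of the chart, this is a bump function. The
  Hausdorff property enters through the closedness of the compact support.\<close>

lemma bump_function:
  assumes V: "open V" and x: "x \<in> V"
  shows "\<exists>\<beta> K N. smooth_fun M UNIV \<beta> \<and> closed K \<and> K \<subseteq> V \<and> (\<forall>y. y \<notin> K \<longrightarrow> \<beta> y = 0) \<and>
    open N \<and> x \<in> N \<and> N \<subseteq> V \<and> (\<forall>y\<in>N. \<beta> y = 1)"
proof -
  obtain U \<phi> where c: "(U, \<phi>) \<in> charts M" and xU: "x \<in> U" using chart_at by blast
  let ?n = "mdim M"
  have "\<phi> x \<in> \<phi> ` (U \<inter> V)" using x xU by blast
  then obtain \<epsilon> where \<epsilon>: "\<epsilon> > 0"
    "\<And>z. z \<in> Rn ?n \<and> (\<forall>i<?n. \<bar>z i - \<phi> x i\<bar> < \<epsilon>) \<Longrightarrow> z \<in> \<phi> ` (U \<inter> V)"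
    using openin_Euclidean_space_box[OF chart_openin[OF c V]] by blast
  \<comment> \<open>\<open>q \<le> 4\<close> means distance at most \<open>2 d < \<epsilon>\<close>, so the support stays in the chart\<close>
  define d where "d = \<epsilon> / 3"
  have d: "d > 0" using \<epsilon>(1) by (simp add: d_def)
  define q where "q z = (\<Sum>i<?n. ((z i - \<phi> x i) / d) * ((z i - \<phi> x i) / d))" for z :: "nat \<Rightarrow> real"
  have q_cont: "continuous_on S q" for S
    unfolding q_def
    by (intro continuous_intros continuous_on_subset[OF continuous_on_product_coordinates]) (use d in auto)
  have q_bound: "\<bar>z i - \<phi> x i\<bar> \<le> 2 * d" if "q z \<le> 4" "i < ?n" for z i
  proof -
    have "((z i - \<phi> x i) / d) * ((z i - \<phi> x i) / d) \<le> q z"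
      unfolding q_def using that(2) by (intro member_le_sum) auto
    then have "((z i - \<phi> x i) / d)\<^sup>2 \<le> 2\<^sup>2" using that(1) by (simp add: power2_eq_square)
    then have "\<bar>(z i - \<phi> x i) / d\<bar> \<le> 2" using abs_le_square_iff[of "(z i - \<phi> x i) / d" 2] by simp
    then show ?thesis using d by (simp add: abs_divide divide_simps mult.commute)
  qed
  define Z where "Z = {z \<in> Rn ?n. q z \<le> 4}"
  have Z_sub: "Z \<subseteq> \<phi> ` (U \<inter> V)"
  proof
    fix z assume z: "z \<in> Z"
    then have "\<bar>z i - \<phi> x i\<bar> < \<epsilon>" if "i < ?n" for i
      using q_bound[of z i] that \<epsilon>(1) unfolding Z_def d_def by simp
    then show "z \<in> \<phi> ` (U \<inter> V)" using \<epsilon>(2)[of z] z unfolding Z_def by blast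
  qed
  have "compact Z"
  proof -
    define B where "B i = (if i < ?n then {\<phi> x i - 2 * d .. \<phi> x i + 2 * d} else {0})" for i
    have "compactin (product_topology (\<lambda>i. euclidean) UNIV) (PiE UNIV B)"
      by (subst compactin_PiE) (auto simp: B_def)
    then have B: "compact (PiE UNIV B)" by (simp add: euclidean_product_topology)
    have "closed {z. q z \<le> 4}"
      by (rule closed_Collect_le[OF q_cont continuous_on_const])
    then have "compact (PiE UNIV B \<inter> {z. q z \<le> 4})"
      by (rule compact_Int_closed[OF B])
    moreover have "PiE UNIV B \<inter> {z. q z \<le> 4} = Z"
    proof -
      have "z \<in> PiE UNIV B \<and> q z \<le> 4 \<longleftrightarrow> z \<in> Z" for z
      proof -
        have B1: "z i \<in> B i \<longleftrightarrow> \<bar>z i - \<phi> x i\<bar> \<le> 2 * d" if "i < ?n" for i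
          using that unfolding B_def abs_le_iff by simp linarith
        have B2: "z i \<in> B i \<longleftrightarrow> z i = 0" if "i \<ge> ?n" for i
          using that unfolding B_def by simp
        have "z \<in> PiE UNIV B \<longleftrightarrow> (\<forall>i. z i \<in> B i)" by (simp add: PiE_UNIV_domain Pi_iff)
        also have "\<dots> \<longleftrightarrow> (\<forall>i<?n. z i \<in> B i) \<and> (\<forall>i\<ge>?n. z i \<in> B i)" by (meson not_le)
        finally have *: "z \<in> PiE UNIV B \<longleftrightarrow> (\<forall>i<?n. \<bar>z i - \<phi> x i\<bar> \<le> 2 * d) \<and> z \<in> Rn ?n"
          using B1 B2 by simp
        have "q z \<le> 4 \<Longrightarrow> \<forall>i<?n. \<bar>z i - \<phi> x i\<bar> \<le> 2 * d" using q_bound by simp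
        then show ?thesis unfolding * Z_def by simp argo
      qed
      then show ?thesis by blast
    qed
    ultimately show ?thesis by simp
  qed
  define K where "K = inv_into U \<phi> ` Z"
  have "continuous_on (\<phi> ` U) (inv_into U \<phi>)"
    using chart_homeomorphism[OF c] unfolding homeomorphism_def by blast
  then have "continuous_on Z (inv_into U \<phi>)" by (rule continuous_on_subset) (use Z_sub in auto)
  then have "compact K" unfolding K_def using \<open>compact Z\<close> by (rule compact_continuous_image)
  then have K: "closed K" by (rule compact_imp_closed)
  have KV: "K \<subseteq> V" "K \<subseteq> U" using Z_sub c unfolding K_def by auto
  define m where "m = flat 1 3"
  have m: "m > 0" unfolding m_def by (rule flat_pos) simp
  \<comment> \<open>written with sums and products only, to match the closure properties of smooth functions\<close>
  define \<psi> where "\<psi> y = flat 1 (m + (-1) * flat 1 (q (\<phi> y) + (-1))) * (1 / flat 1 m)" for y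
  have \<psi>_U: "smooth_fun M U \<psi>"
  proof -
    have "smooth_fun M U (\<lambda>y. ((\<phi> y i + (- \<phi> x i)) * (1 / d)) * ((\<phi> y i + (- \<phi> x i)) * (1 / d)))" if "i < ?n" for i
      by (intro smooth_fun_mult smooth_fun_add smooth_fun_const smooth_fun_chart_coord[OF c that] chart_open[OF c])
    then have "smooth_fun M U (\<lambda>y. \<Sum>i<?n. ((\<phi> y i + (- \<phi> x i)) * (1 / d)) * ((\<phi> y i + (- \<phi> x i)) * (1 / d)))"
      by (intro smooth_fun_sum chart_open[OF c]) auto
    then have "smooth_fun M U (\<lambda>y. q (\<phi> y))" by (simp add: q_def)
    then show ?thesis unfolding \<psi>_def
      by (intro smooth_fun_mult smooth_fun_add smooth_fun_flat smooth_fun_const chart_open[OF c])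
  qed
  define \<beta> where "\<beta> y = (if y \<in> U then \<psi> y else 0)" for y
  have \<beta>0: "\<beta> y = 0" if "y \<notin> K" for y
  proof (cases "y \<in> U")
    case True
    have "\<phi> y \<notin> Z" using that True chart_inv[OF c True] unfolding K_def by (metis imageI)
    then have "q (\<phi> y) > 4" using chart_in_Rn[OF c True] unfolding Z_def by auto
    then have "m \<le> flat 1 (q (\<phi> y) + (-1))" unfolding m_def by (intro flat_mono) simp
    then show ?thesis using True by (simp add: \<beta>_def \<psi>_def flat_def)
  qed (simp add: \<beta>_def)
  have "smooth_fun M UNIV \<beta>"
  proof (rule smooth_fun_local)
    fix y :: 'm
    show "\<exists>W'. open W' \<and> y \<in> W' \<and> smooth_fun M W' \<beta>"
    proof (cases "y \<in> U")
      case True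
      have "smooth_fun M U \<beta>" by (rule smooth_fun_cong[OF chart_open[OF c] \<psi>_U]) (simp add: \<beta>_def)
      then show ?thesis using True chart_open[OF c] by blast
    next
      case False
      have o: "open (- K)" using K by blast
      have "smooth_fun M (- K) \<beta>" by (rule smooth_fun_cong[OF o smooth_fun_const[OF o, of 0]]) (use \<beta>0 in auto)
      then show ?thesis using o False KV by blast
    qed
  qed
  moreover define N where "N = {y \<in> U \<inter> V. q (\<phi> y) < 1}"
  have "open N"
  proof -
    have "open {z. q z < 1}" by (rule open_Collect_less[OF q_cont continuous_on_const])
    moreover have "continuous_on (U \<inter> V) \<phi>"
      using chart_homeomorphism[OF c] unfolding homeomorphism_def by (meson continuous_on_subset inf_le1)
    ultimately have "open (\<phi> -` {z. q z < 1} \<inter> (U \<inter> V))"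
      using continuous_on_open_vimage[of "U \<inter> V" \<phi>] V chart_open[OF c] by blast
    moreover have "N = \<phi> -` {z. q z < 1} \<inter> (U \<inter> V)" unfolding N_def by blast
    ultimately show ?thesis by simp
  qed
  moreover have "x \<in> N" using x xU by (simp add: N_def q_def)
  moreover have "\<beta> y = 1" if "y \<in> N" for y
  proof -
    have "flat 1 (q (\<phi> y) + (-1)) = 0" using that by (simp add: N_def flat_def)
    then show ?thesis using that flat_pos[OF m] by (simp add: \<beta>_def \<psi>_def N_def)
  qed
  moreover have "N \<subseteq> V" unfolding N_def by blast
  ultimately show ?thesis using K KV(1) \<beta>0 by blast
qed

section \<open>Tangent vectors as derivations\<close>

lemma smooth_near_fun: "open W \<Longrightarrow> x \<in> W \<Longrightarrow> smooth_fun M W f \<Longrightarrow> smooth_near M x f"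
  unfolding smooth_near_def by blast

lemma smooth_near_cong:
  assumes "smooth_near M x f" "open N" "x \<in> N" "\<And>y. y \<in> N \<Longrightarrow> f y = g y"
  shows "smooth_near M x g"
proof -
  obtain W where W: "open W" "x \<in> W" "smooth_fun M W f" using assms(1) unfolding smooth_near_def by blast
  have "smooth_fun M (W \<inter> N) g"
    by (rule smooth_fun_cong[OF _ smooth_fun_subset[OF W(3)]]) (simp_all add: W(1) assms(2) open_Int assms(4))
  moreover have "open (W \<inter> N)" "x \<in> W \<inter> N" using W(1,2) assms(2,3) by auto
  ultimately show ?thesis unfolding smooth_near_def by blast
qed

lemma smooth_near_common:
  assumes "smooth_near M x f" "smooth_near M x g"
  shows "\<exists>W. open W \<and> x \<in> W \<and> smooth_fun M W f \<and> smooth_fun M W g"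
proof -
  obtain W W' where "open W" "x \<in> W" "smooth_fun M W f" "open W'" "x \<in> W'" "smooth_fun M W' g"
    using assms unfolding smooth_near_def by blast
  then show ?thesis
    using smooth_fun_subset[of W f "W \<inter> W'"] smooth_fun_subset[of W' g "W \<inter> W'"] by blast
qed

lemma smooth_near_const: "smooth_near M x (\<lambda>y. c)"
  by (rule smooth_near_fun[of UNIV]) (simp_all add: smooth_fun_const)

lemma smooth_near_add: "smooth_near M x f \<Longrightarrow> smooth_near M x g \<Longrightarrow> smooth_near M x (\<lambda>y. f y + g y)"
  using smooth_near_common[of x f g] smooth_fun_add[of _ f g] unfolding smooth_near_def by blast

lemma smooth_near_mult: "smooth_near M x f \<Longrightarrow> smooth_near M x g \<Longrightarrow> smooth_near M x (\<lambda>y. f y * g y)"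
  using smooth_near_common[of x f g] smooth_fun_mult[of _ f g] unfolding smooth_near_def by blast

lemma smooth_near_sum:
  "finite I \<Longrightarrow> (\<And>i. i \<in> I \<Longrightarrow> smooth_near M x (f i)) \<Longrightarrow> smooth_near M x (\<lambda>y. \<Sum>i\<in>I. f i y)"
  by (induction rule: finite_induct) (auto intro: smooth_near_const smooth_near_add)

lemma smooth_near_slice_diff:
  assumes "smooth_near M x f" "(U, \<phi>) \<in> charts M" "x \<in> U" "i < mdim M"
  shows "slice_diff i (\<lambda>z. f (inv_into U \<phi> z)) (\<phi> x)"
proof -
  obtain W where W: "open W" "x \<in> W" "smooth_fun M W f" using assms(1) unfolding smooth_near_def by blast
  show ?thesis
    using smooth_Rn_slice_diff[OF smooth_fun_in_chart[OF assms(2) W(3)] _ assms(4), of "\<phi> x"] assms(3) W(2)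
    unfolding comp_def by blast
qed

lemma partial_chart_cong:
  assumes "(U, \<phi>) \<in> charts M" "x \<in> U" "i < mdim M" "open N" "x \<in> N" "\<And>y. y \<in> N \<Longrightarrow> f y = g y"
  shows "partial i (\<lambda>z. f (inv_into U \<phi> z)) (\<phi> x) = partial i (\<lambda>z. g (inv_into U \<phi> z)) (\<phi> x)"
  by (rule partial_cong[OF chart_openin[OF assms(1,4)]]) (use assms in auto)

context
  fixes x D assumes D: "tangent_vector M x D"
begin

lemma tangent_vector_coords:
  assumes "(U, \<phi>) \<in> charts M" "x \<in> U"
  shows "\<exists>v. \<forall>f. smooth_near M x f \<longrightarrow> D f = (\<Sum>i<mdim M. v i * partial i (\<lambda>z. f (inv_into U \<phi> z)) (\<phi> x))"
  using D assms unfolding tangent_vector_def comp_def by fast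

text \<open>Tangent vectors are local operators; functions that are only defined near \<open>x\<close> may be extended
  arbitrarily.\<close>

lemma tangent_vector_cong:
  assumes f: "smooth_near M x f" and N: "open N" "x \<in> N" "\<And>y. y \<in> N \<Longrightarrow> f y = g y"
  shows "D f = D g"
proof -
  obtain U \<phi> where c: "(U, \<phi>) \<in> charts M" "x \<in> U" using chart_at by blast
  obtain v where v: "\<And>f. smooth_near M x f \<Longrightarrow> D f = (\<Sum>i<mdim M. v i * partial i (\<lambda>z. f (inv_into U \<phi> z)) (\<phi> x))"
    using tangent_vector_coords[OF c] by metis
  have g: "smooth_near M x g" by (rule smooth_near_cong[OF f N])
  show ?thesis
    unfolding v[OF f] v[OF g]
    by (intro sum.cong arg_cong2[where f = "(*)"] refl partial_chart_cong[OF c _ N]) auto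
qed

lemma tangent_vector_add:
  assumes f: "smooth_near M x f" and g: "smooth_near M x g"
  shows "D (\<lambda>y. f y + g y) = D f + D g"
proof -
  obtain U \<phi> where c: "(U, \<phi>) \<in> charts M" "x \<in> U" using chart_at by blast
  obtain v where v: "\<And>f. smooth_near M x f \<Longrightarrow> D f = (\<Sum>i<mdim M. v i * partial i (\<lambda>z. f (inv_into U \<phi> z)) (\<phi> x))"
    using tangent_vector_coords[OF c] by metis
  have "partial i (\<lambda>z. f (inv_into U \<phi> z) + g (inv_into U \<phi> z)) (\<phi> x) =
      partial i (\<lambda>z. f (inv_into U \<phi> z)) (\<phi> x) + partial i (\<lambda>z. g (inv_into U \<phi> z)) (\<phi> x)"
    if i: "i < mdim M" for i
    using smooth_near_slice_diff[OF f c i] smooth_near_slice_diff[OF g c i]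
    unfolding partial_def by (rule deriv_add)
  then show ?thesis
    using v[OF f] v[OF g] v[OF smooth_near_add[OF f g]] by (simp add: distrib_left sum.distrib)
qed

lemma tangent_vector_mult:
  assumes f: "smooth_near M x f" and g: "smooth_near M x g"
  shows "D (\<lambda>y. f y * g y) = D f * g x + f x * D g"
proof -
  obtain U \<phi> where c: "(U, \<phi>) \<in> charts M" "x \<in> U" using chart_at by blast
  obtain v where v: "\<And>f. smooth_near M x f \<Longrightarrow> D f = (\<Sum>i<mdim M. v i * partial i (\<lambda>z. f (inv_into U \<phi> z)) (\<phi> x))"
    using tangent_vector_coords[OF c] by metis
  have "partial i (\<lambda>z. f (inv_into U \<phi> z) * g (inv_into U \<phi> z)) (\<phi> x) =
      partial i (\<lambda>z. f (inv_into U \<phi> z)) (\<phi> x) * g x + f x * partial i (\<lambda>z. g (inv_into U \<phi> z)) (\<phi> x)"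
    if i: "i < mdim M" for i
    using deriv_mult[OF smooth_near_slice_diff[OF f c i] smooth_near_slice_diff[OF g c i]]
    unfolding partial_def by (simp add: chart_inv[OF c] add.commute)
  then have "D (\<lambda>y. f y * g y) = (\<Sum>i<mdim M. (v i * partial i (\<lambda>z. f (inv_into U \<phi> z)) (\<phi> x)) * g x +
      f x * (v i * partial i (\<lambda>z. g (inv_into U \<phi> z)) (\<phi> x)))"
    using v[OF smooth_near_mult[OF f g]] by (simp add: algebra_simps)
  then show ?thesis
    using v[OF f] v[OF g] by (simp add: sum.distrib sum_distrib_right sum_distrib_left)
qed

lemma tangent_vector_const: "D (\<lambda>y. c) = 0"
proof -
  obtain U \<phi> where c: "(U, \<phi>) \<in> charts M" "x \<in> U" using chart_at by blast
  obtain v where v: "\<And>f. smooth_near M x f \<Longrightarrow> D f = (\<Sum>i<mdim M. v i * partial i (\<lambda>z. f (inv_into U \<phi> z)) (\<phi> x))"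
    using tangent_vector_coords[OF c] by metis
  show ?thesis using v[OF smooth_near_const] by (simp add: partial_def)
qed

lemma tangent_vector_sum:
  "finite I \<Longrightarrow> (\<And>i. i \<in> I \<Longrightarrow> smooth_near M x (f i)) \<Longrightarrow> D (\<lambda>y. \<Sum>i\<in>I. f i y) = (\<Sum>i\<in>I. D (f i))"
proof (induction rule: finite_induct)
  case empty
  then show ?case using tangent_vector_const[of 0] by simp
next
  case (insert i I)
  then show ?case using tangent_vector_add[of "f i" "\<lambda>y. \<Sum>i\<in>I. f i y"] by (simp add: smooth_near_sum)
qed

end

text \<open>Applying a tangent vector to the coordinates of a chart, whose partial derivatives are zero and one,
  determines its coefficients.\<close>

lemma tangent_vector_chart:
  assumes D: "tangent_vector M x D" and c: "(U, \<phi>) \<in> charts M" "x \<in> U" and f: "smooth_near M x f"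
  shows "D f = (\<Sum>i<mdim M. D (\<lambda>y. \<phi> y i) * partial i (\<lambda>z. f (inv_into U \<phi> z)) (\<phi> x))"
proof -
  obtain v where v: "\<And>f. smooth_near M x f \<Longrightarrow> D f = (\<Sum>i<mdim M. v i * partial i (\<lambda>z. f (inv_into U \<phi> z)) (\<phi> x))"
    using tangent_vector_coords[OF D c] by metis
  have "D (\<lambda>y. \<phi> y j) = v j" if j: "j < mdim M" for j
  proof -
    have "partial i (\<lambda>z. \<phi> (inv_into U \<phi> z) j) (\<phi> x) = (if i = j then 1 else 0)" if i: "i < mdim M" for i
    proof -
      have "partial i (\<lambda>z. \<phi> (inv_into U \<phi> z) j) (\<phi> x) = partial i (\<lambda>z. z j) (\<phi> x)"
        by (rule partial_cong[OF chart_image_openin[OF c(1)] _ i]) (use c in auto)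
      also have "\<dots> = (if i = j then 1 else 0)"
        unfolding partial_def by (auto intro!: DERIV_imp_deriv)
      finally show ?thesis .
    qed
    moreover have "smooth_near M x (\<lambda>y. \<phi> y j)"
      by (rule smooth_near_fun[OF chart_open[OF c(1)] c(2) smooth_fun_chart_coord[OF c(1) j]])
    ultimately have "D (\<lambda>y. \<phi> y j) = (\<Sum>i<mdim M. v i * (if i = j then 1 else 0))"
      using v by simp
    then show ?thesis using j by (simp add: if_distrib[of "(*) _"] cong: if_cong)
  qed
  then show ?thesis using v[OF f] by simp
qed

end

section \<open>Vector bundles and their duals\<close>

lemma sum_fun_apply: "(\<Sum>i\<in>I. F i) x = (\<Sum>i\<in>I. F i x)"
  by (induction I rule: infinite_finite_induct) auto

lemma scaleR_fun_apply [simp]: "(c *\<^sub>R f) x = c *\<^sub>R f x"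
  by (simp add: scaleR_fun_def)

locale vbundle_on = manifold_on M
  for M :: "'m::{t2_space, second_countable_topology} manifold" +
  fixes A :: "('m, 'v::real_vector) vbundle"
  assumes vbundle: "vector_bundle M A"
begin

lemma frame_at: "\<exists>V e. (V, e) \<in> frames A \<and> x \<in> V"
proof -
  have "(\<Union>(V, e)\<in>frames A. V) = UNIV"
    using vbundle unfolding vector_bundle_def by (rule conjunct1)
  then obtain c where "c \<in> frames A" "x \<in> (case c of (V, e) \<Rightarrow> V)" by (metis UNIV_I UN_E)
  then show ?thesis by (cases c) auto
qed

lemma transition_smooth:
  assumes "(V, e) \<in> frames A" "(V', e') \<in> frames A" "a < brank A" "b < brank A"
  shows "smooth_fun M (V \<inter> V') (\<lambda>x. component (brank A) e x (e' b x) a)"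
  using bspec[OF conjunct2[OF conjunct2[OF vbundle[unfolded vector_bundle_def]]] assms(1)]
  by (simp, drule_tac bspec[OF _ assms(2)]) (simp add: assms(3,4))

lemma frame_open: "(V, e) \<in> frames A \<Longrightarrow> open V"
  using conjunct1[OF conjunct2[OF vbundle[unfolded vector_bundle_def]]] by auto

context
  fixes V e x assumes frame: "(V, e) \<in> frames A" and x: "x \<in> V"
begin

lemma frame_inj: "inj_on (\<lambda>a. e a x) {..<brank A}"
  and frame_independent: "independent ((\<lambda>a. e a x) ` {..<brank A})"
  and frame_span: "span ((\<lambda>a. e a x) ` {..<brank A}) = fibre A x"
  using conjunct1[OF conjunct2[OF vbundle[unfolded vector_bundle_def]]] frame x by auto

lemma frame_in_fibre: "a < brank A \<Longrightarrow> e a x \<in> fibre A x"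
  unfolding frame_span[symmetric] by (intro span_base) auto

lemma component_expansion:
  assumes "v \<in> fibre A x"
  shows "v = (\<Sum>a<brank A. component (brank A) e x v a *\<^sub>R e a x)"
proof -
  have "v = (\<Sum>b\<in>(\<lambda>a. e a x) ` {..<brank A}. representation ((\<lambda>b. e b x) ` {..<brank A}) v b *\<^sub>R b)"
    by (rule sum_representation_eq[symmetric, OF frame_independent])
      (use assms frame_span in auto)
  then show ?thesis unfolding component_def sum.reindex[OF frame_inj] by simp
qed

lemma component_add:
  assumes "u \<in> fibre A x" "v \<in> fibre A x"
  shows "component (brank A) e x (u + v) a = component (brank A) e x u a + component (brank A) e x v a"
  unfolding component_def
  using representation_add[OF frame_independent, of v u] assms frame_span by simp

lemma component_scaleR:
  assumes "v \<in> fibre A x"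
  shows "component (brank A) e x (c *\<^sub>R v) a = c * component (brank A) e x v a"
  unfolding component_def
  using representation_scale[OF frame_independent, of v c] assms frame_span by simp

lemma component_frame:
  assumes "a < brank A" "b < brank A"
  shows "component (brank A) e x (e b x) a = (if a = b then 1 else 0)"
  unfolding component_def
  using representation_basis[OF frame_independent, of "e b x"] assms inj_on_eq_iff[OF frame_inj, of b a] by auto

end

lemma fibre_subspace: "subspace (fibre A x)"
proof -
  obtain V e where "(V, e) \<in> frames A" "x \<in> V" using frame_at by blast
  then show ?thesis using frame_span subspace_span by metis
qed

lemmas fibre_zero = subspace_0[OF fibre_subspace]
  and fibre_add = subspace_add[OF fibre_subspace]
  and fibre_diff = subspace_diff[OF fibre_subspace]
  and fibre_scaleR = subspace_scale[OF fibre_subspace]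
  and fibre_sum = subspace_sum[OF fibre_subspace]

lemma component_zero: "(V, e) \<in> frames A \<Longrightarrow> x \<in> V \<Longrightarrow> component (brank A) e x 0 a = 0"
  using component_scaleR[of V e x 0 0 a] fibre_zero by simp

lemma component_diff:
  assumes "(V, e) \<in> frames A" "x \<in> V" "u \<in> fibre A x" "v \<in> fibre A x"
  shows "component (brank A) e x (u - v) a = component (brank A) e x u a - component (brank A) e x v a"
  using component_add[OF assms(1,2) fibre_diff[OF assms(3,4)] assms(4), of a] by simp

lemma component_sum:
  assumes "(V, e) \<in> frames A" "x \<in> V" "\<And>i. i \<in> I \<Longrightarrow> F i \<in> fibre A x"
  shows "component (brank A) e x (\<Sum>i\<in>I. F i) a = (\<Sum>i\<in>I. component (brank A) e x (F i) a)"
  using assms(3)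
proof (induction I rule: infinite_finite_induct)
  case (insert i I)
  then show ?case using component_add[OF assms(1,2), of "F i" "\<Sum>i\<in>I. F i" a] fibre_sum[of I F x] by simp
qed (simp_all add: component_zero[OF assms(1,2)])

lemma component_frame_sum:
  assumes "(V, e) \<in> frames A" "x \<in> V" "a < brank A"
  shows "component (brank A) e x (\<Sum>b<brank A. t b *\<^sub>R e b x) a = t a"
proof -
  have "component (brank A) e x (\<Sum>b<brank A. t b *\<^sub>R e b x) a =
      (\<Sum>b<brank A. component (brank A) e x (t b *\<^sub>R e b x) a)"
    by (rule component_sum[OF assms(1,2)]) (auto intro: fibre_scaleR frame_in_fibre[OF assms(1,2)])
  also have "\<dots> = (\<Sum>b<brank A. t b * (if a = b then 1 else 0))"
    by (rule sum.cong) (auto simp: component_scaleR[OF assms(1,2)] frame_in_fibre[OF assms(1,2)]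
        component_frame[OF assms(1,2)] assms(3))
  also have "\<dots> = t a" using assms(3) by (simp add: if_distrib[of "(*) _"] cong: if_cong)
  finally show ?thesis .
qed

subsection \<open>Sections\<close>

lemma section_in_fibre: "X \<in> sections M A \<Longrightarrow> X x \<in> fibre A x"
  unfolding sections_def by blast

lemma section_component_smooth:
  "X \<in> sections M A \<Longrightarrow> (V, e) \<in> frames A \<Longrightarrow> a < brank A \<Longrightarrow>
    smooth_fun M V (\<lambda>x. component (brank A) e x (X x) a)"
  unfolding sections_def by auto

lemma section_component_smooth_near:
  "X \<in> sections M A \<Longrightarrow> (V, e) \<in> frames A \<Longrightarrow> a < brank A \<Longrightarrow> x \<in> V \<Longrightarrow>
    smooth_near M x (\<lambda>y. component (brank A) e y (X y) a)"
  by (rule smooth_near_fun[OF frame_open _ section_component_smooth])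

lemma sectionsI:
  assumes "\<And>x. X x \<in> fibre A x"
    and "\<And>V e a. (V, e) \<in> frames A \<Longrightarrow> a < brank A \<Longrightarrow> smooth_fun M V (\<lambda>x. component (brank A) e x (X x) a)"
  shows "X \<in> sections M A"
  using assms unfolding sections_def by blast

lemma sections_add:
  assumes X: "X \<in> sections M A" and Y: "Y \<in> sections M A"
  shows "X + Y \<in> sections M A"
proof (rule sectionsI)
  fix V e a assume f: "(V, e) \<in> frames A" "a < brank A"
  show "smooth_fun M V (\<lambda>x. component (brank A) e x ((X + Y) x) a)"
    by (rule smooth_fun_cong[OF frame_open[OF f(1)] smooth_fun_add[OF frame_open[OF f(1)]
          section_component_smooth[OF X f] section_component_smooth[OF Y f]]])
      (simp add: component_add[OF f(1)] section_in_fibre X Y)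
qed (simp add: fibre_add section_in_fibre X Y)

lemma sections_smooth_scaleR:
  assumes g: "smooth_fun M UNIV g" and X: "X \<in> sections M A"
  shows "(\<lambda>x. g x *\<^sub>R X x) \<in> sections M A"
proof (rule sectionsI)
  fix V e a assume f: "(V, e) \<in> frames A" "a < brank A"
  show "smooth_fun M V (\<lambda>x. component (brank A) e x (g x *\<^sub>R X x) a)"
    by (rule smooth_fun_cong[OF frame_open[OF f(1)] smooth_fun_mult[OF frame_open[OF f(1)]
          smooth_fun_subset[OF g subset_UNIV] section_component_smooth[OF X f]]])
      (simp add: component_scaleR[OF f(1)] section_in_fibre X)
qed (simp add: fibre_scaleR section_in_fibre X)

lemma sections_zero: "0 \<in> sections M A"
proof (rule sectionsI)
  fix V e a assume f: "(V, e) \<in> frames A" "a < brank A"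
  show "smooth_fun M V (\<lambda>x. component (brank A) e x (0 x) a)"
    by (rule smooth_fun_cong[OF frame_open[OF f(1)] smooth_fun_const[OF frame_open[OF f(1)], of 0]])
      (simp add: component_zero[OF f(1)])
qed (simp add: fibre_zero)

lemma sections_sum:
  "(\<And>i. i \<in> I \<Longrightarrow> F i \<in> sections M A) \<Longrightarrow> (\<Sum>i\<in>I. F i) \<in> sections M A"
  by (induction I rule: infinite_finite_induct) (auto intro: sections_add sections_zero)

lemma sections_scaleR: "X \<in> sections M A \<Longrightarrow> c *\<^sub>R X \<in> sections M A"
  using sections_smooth_scaleR[OF smooth_fun_const, of X c] by (simp add: scaleR_fun_def)

text \<open>A bump function \<open>\<beta>\<close> makes global sections \<open>E\<^sub>a = \<beta> e\<^sub>a\<close> from a local frame. Multiplying a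
  section by \<open>h = \<beta>\<^sup>2\<close> and its coordinate functions by only one factor \<open>\<beta>\<close> turns the local
  expansion in the frame into the global one \<open>h X = \<Sum> (\<beta> X\<^sup>a) E\<^sub>a\<close>, to which the Leibniz rule of a
  bracket of global sections applies.\<close>

lemma frame_extension:
  assumes f: "(V, e) \<in> frames A" and x: "x \<in> V"
  shows "\<exists>E N h. open N \<and> x \<in> N \<and> N \<subseteq> V \<and> smooth_fun M UNIV h \<and> (\<forall>y\<in>N. h y = 1) \<and>
    (\<forall>a<brank A. E a \<in> sections M A \<and> (\<forall>y\<in>N. E a y = e a y)) \<and>
    (\<forall>X\<in>sections M A. \<exists>g. (\<forall>a<brank A. smooth_fun M UNIV (g a) \<and>
        (\<forall>y\<in>N. g a y = component (brank A) e y (X y) a)) \<and>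
      (\<lambda>y. h y *\<^sub>R X y) = (\<Sum>a<brank A. (\<lambda>y. g a y *\<^sub>R E a y)))"
proof -
  obtain \<beta> K N where \<beta>: "smooth_fun M UNIV \<beta>" and K: "closed K" "K \<subseteq> V" "\<forall>y. y \<notin> K \<longrightarrow> \<beta> y = 0"
    and N: "open N" "x \<in> N" "N \<subseteq> V" "\<forall>y\<in>N. \<beta> y = 1"
    using bump_function[OF frame_open[OF f] x] by metis
  define E where "E a y = (if y \<in> V then \<beta> y *\<^sub>R e a y else 0)" for a y
  have E: "E a \<in> sections M A" if a: "a < brank A" for a
  proof (rule sectionsI)
    fix V' e' b assume f': "(V', e') \<in> frames A" and b: "b < brank A"
    have "smooth_fun M V' (\<lambda>y. if y \<in> V then \<beta> y * component (brank A) e' y (e a y) b else 0)"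
      by (rule smooth_fun_extend_zero[OF frame_open[OF f] K(1,2) frame_open[OF f']])
        (use \<beta> K(3) transition_smooth[OF f' f b a] in \<open>auto intro: smooth_fun_subset simp: Int_commute\<close>)
    then show "smooth_fun M V' (\<lambda>y. component (brank A) e' y (E a y) b)"
      by (rule smooth_fun_cong[OF frame_open[OF f']])
        (auto simp: E_def component_zero[OF f'] component_scaleR[OF f'] frame_in_fibre[OF f _ a])
  qed (auto simp: E_def fibre_zero intro: fibre_scaleR frame_in_fibre[OF f _ a])
  have main: "\<exists>g. (\<forall>a<brank A. smooth_fun M UNIV (g a) \<and> (\<forall>y\<in>N. g a y = component (brank A) e y (X y) a)) \<and>
      (\<lambda>y. (\<beta> y * \<beta> y) *\<^sub>R X y) = (\<Sum>a<brank A. (\<lambda>y. g a y *\<^sub>R E a y))" if X: "X \<in> sections M A" for X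
  proof -
    define g where "g a y = (if y \<in> V then \<beta> y * component (brank A) e y (X y) a else 0)" for a y
    have "smooth_fun M UNIV (g a)" if a: "a < brank A" for a
      unfolding g_def
      by (rule smooth_fun_extend_zero[OF frame_open[OF f] K(1,2) open_UNIV \<beta>])
        (use K(3) section_component_smooth[OF X f a] in auto)
    moreover have "g a y = component (brank A) e y (X y) a" if "y \<in> N" for a y
      using that N(3,4) unfolding g_def by auto
    moreover have "(\<beta> y * \<beta> y) *\<^sub>R X y = (\<Sum>a<brank A. g a y *\<^sub>R E a y)" for y
    proof (cases "y \<in> V")
      case True
      have "(\<beta> y * \<beta> y) *\<^sub>R X y = (\<beta> y * \<beta> y) *\<^sub>R (\<Sum>a<brank A. component (brank A) e y (X y) a *\<^sub>R e a y)"
        using component_expansion[OF f True section_in_fibre[OF X]] by simp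
      then show ?thesis using True by (simp add: g_def E_def scaleR_sum_right mult_ac)
    next
      case False
      then have "\<beta> y = 0" using K(2,3) by blast
      then show ?thesis using False by (simp add: g_def)
    qed
    ultimately show ?thesis by (intro exI[of _ g]) (auto simp: fun_eq_iff sum_fun_apply)
  qed
  have "smooth_fun M UNIV (\<lambda>y. \<beta> y * \<beta> y)" by (rule smooth_fun_mult[OF open_UNIV \<beta> \<beta>])
  moreover have "\<forall>y\<in>N. E a y = e a y" for a using N by (auto simp: E_def)
  ultimately show ?thesis
    using N E main by (intro exI[of _ E] exI[of _ N] exI[of _ "\<lambda>y. \<beta> y * \<beta> y"]) simp
qed

lemma frame_section:
  assumes f: "(V, e) \<in> frames A" and x: "x \<in> V" and m: "m < brank A"
  shows "\<exists>X N. X \<in> sections M A \<and> open N \<and> x \<in> N \<and> N \<subseteq> V \<and> (\<forall>y\<in>N. X y = e m y)"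
proof -
  obtain E N where N: "open N" "x \<in> N" "N \<subseteq> V"
    and E: "\<And>a. a < brank A \<Longrightarrow> E a \<in> sections M A \<and> (\<forall>y\<in>N. E a y = e a y)"
    using frame_extension[OF f x] by metis
  show ?thesis by (intro exI[of _ "E m"] exI[of _ N] conjI N) (simp_all add: E[OF m])
qed

lemma section_through:
  assumes "v \<in> fibre A x"
  shows "\<exists>X\<in>sections M A. X x = v"
proof -
  obtain V e where f: "(V, e) \<in> frames A" "x \<in> V" using frame_at by blast
  obtain E N where E: "x \<in> N" "\<And>a. a < brank A \<Longrightarrow> E a \<in> sections M A \<and> (\<forall>y\<in>N. E a y = e a y)"
    using frame_extension[OF f] by metis
  have "(\<Sum>a<brank A. component (brank A) e x v a *\<^sub>R E a) \<in> sections M A"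
    using E by (intro sections_sum sections_scaleR) auto
  moreover have "(\<Sum>a<brank A. component (brank A) e x v a *\<^sub>R E a) x = v"
    using component_expansion[OF f assms] E by (simp add: sum_fun_apply)
  ultimately show ?thesis by blast
qed

lemma sections_through:
  "set vs \<subseteq> fibre A x \<Longrightarrow> \<exists>Xs. set Xs \<subseteq> sections M A \<and> map (\<lambda>X. X x) Xs = vs"
proof (induction vs)
  case (Cons v vs)
  then obtain Xs X where "set Xs \<subseteq> sections M A" "map (\<lambda>X. X x) Xs = vs" "X \<in> sections M A" "X x = v"
    using section_through[of v x] by auto
  then show ?case by (intro exI[of _ "X # Xs"]) auto
qed auto

subsection \<open>The dual bundle\<close>

lemma dual_fibre_linear:
  assumes \<alpha>: "\<alpha> \<in> dual_fibre A x"
  shows "u \<in> fibre A x \<Longrightarrow> v \<in> fibre A x \<Longrightarrow> \<alpha> (u + v) = \<alpha> u + \<alpha> v"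
    and "u \<in> fibre A x \<Longrightarrow> \<alpha> (c *\<^sub>R u) = c * \<alpha> u"
proof -
  have *: "\<alpha> (c *\<^sub>R u + v) = c * \<alpha> u + \<alpha> v" if "u \<in> fibre A x" "v \<in> fibre A x" for c u v
    using \<alpha> that unfolding dual_fibre_def by blast
  have 0: "\<alpha> 0 = 0" using *[of 0 0 1] fibre_zero by simp
  show "u \<in> fibre A x \<Longrightarrow> v \<in> fibre A x \<Longrightarrow> \<alpha> (u + v) = \<alpha> u + \<alpha> v" using *[of u v 1] by simp
  show "u \<in> fibre A x \<Longrightarrow> \<alpha> (c *\<^sub>R u) = c * \<alpha> u" using *[of u 0 c] fibre_zero 0 by simp
qed

lemma dual_fibre_sum:
  assumes \<alpha>: "\<alpha> \<in> dual_fibre A x" and F: "\<And>i. i \<in> I \<Longrightarrow> F i \<in> fibre A x"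
  shows "\<alpha> (\<Sum>i\<in>I. F i) = (\<Sum>i\<in>I. \<alpha> (F i))"
  using F
proof (induction I rule: infinite_finite_induct)
  case (insert i I)
  then show ?case using dual_fibre_linear(1)[OF \<alpha>, of "F i" "\<Sum>i\<in>I. F i"] fibre_sum[of I F x] by simp
qed (use dual_fibre_linear(2)[OF \<alpha> fibre_zero, of 0] in auto)

lemma dual_fibre_eval:
  assumes f: "(V, e) \<in> frames A" "x \<in> V" and \<alpha>: "\<alpha> \<in> dual_fibre A x" and v: "v \<in> fibre A x"
  shows "\<alpha> v = (\<Sum>a<brank A. component (brank A) e x v a * \<alpha> (e a x))"
proof -
  have "\<alpha> v = \<alpha> (\<Sum>a<brank A. component (brank A) e x v a *\<^sub>R e a x)"
    using component_expansion[OF f v] by simp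
  also have "\<dots> = (\<Sum>a<brank A. \<alpha> (component (brank A) e x v a *\<^sub>R e a x))"
    by (rule dual_fibre_sum[OF \<alpha>]) (simp add: fibre_scaleR frame_in_fibre[OF f])
  also have "\<dots> = (\<Sum>a<brank A. component (brank A) e x v a * \<alpha> (e a x))"
    by (intro sum.cong) (auto simp: dual_fibre_linear(2)[OF \<alpha>] frame_in_fibre[OF f])
  finally show ?thesis .
qed

lemma dual_fibreI:
  assumes "\<And>u v c. u \<in> fibre A x \<Longrightarrow> v \<in> fibre A x \<Longrightarrow> \<alpha> (c *\<^sub>R u + v) = c * \<alpha> u + \<alpha> v"
    and "\<And>v. v \<notin> fibre A x \<Longrightarrow> \<alpha> v = 0"
  shows "\<alpha> \<in> dual_fibre A x"
  using assms unfolding dual_fibre_def by blast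

lemma dual_fibre_outside: "\<alpha> \<in> dual_fibre A x \<Longrightarrow> v \<notin> fibre A x \<Longrightarrow> \<alpha> v = 0"
  unfolding dual_fibre_def by blast

lemma dual_fibre_add: "\<alpha> \<in> dual_fibre A x \<Longrightarrow> \<beta> \<in> dual_fibre A x \<Longrightarrow> \<alpha> + \<beta> \<in> dual_fibre A x"
  unfolding dual_fibre_def by (simp add: algebra_simps)

lemma dual_fibre_scaleR: "\<alpha> \<in> dual_fibre A x \<Longrightarrow> c *\<^sub>R \<alpha> \<in> dual_fibre A x"
  unfolding dual_fibre_def by (simp add: algebra_simps)

lemma dual_fibre_subspace: "subspace (dual_fibre A x)"
proof -
  have "0 \<in> dual_fibre A x" unfolding dual_fibre_def by simp
  then show ?thesis unfolding subspace_def using dual_fibre_add dual_fibre_scaleR by blast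
qed

lemma dual_frame_in: 
  assumes f: "(V, e) \<in> frames A" "x \<in> V"
  shows "dual_frame A e a x \<in> dual_fibre A x"
  by (rule dual_fibreI)
    (auto simp: dual_frame_def component_add[OF f] component_scaleR[OF f] fibre_add fibre_scaleR)

lemma dual_frame_eval:
  assumes f: "(V, e) \<in> frames A" "x \<in> V" and "a < brank A" "b < brank A"
  shows "dual_frame A e a x (e b x) = (if a = b then 1 else 0)"
  using assms(3,4) frame_in_fibre[OF f] by (simp add: dual_frame_def component_frame[OF f])

lemma dual_frame_expansion:
  assumes f: "(V, e) \<in> frames A" "x \<in> V" and \<alpha>: "\<alpha> \<in> dual_fibre A x"
  shows "\<alpha> = (\<Sum>a<brank A. \<alpha> (e a x) *\<^sub>R dual_frame A e a x)"
proof
  fix v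
  show "\<alpha> v = (\<Sum>a<brank A. \<alpha> (e a x) *\<^sub>R dual_frame A e a x) v"
  proof (cases "v \<in> fibre A x")
    case True
    then show ?thesis
      using dual_fibre_eval[OF f \<alpha> True] by (simp add: sum_fun_apply dual_frame_def mult.commute)
  next
    case False
    then show ?thesis using dual_fibre_outside[OF \<alpha> False] by (simp add: sum_fun_apply dual_frame_def)
  qed
qed

lemma dual_frame_sum_eval:
  assumes f: "(V, e) \<in> frames A" "x \<in> V" and b: "b < brank A"
  shows "(\<Sum>a<brank A. t a *\<^sub>R dual_frame A e a x) (e b x) = t b"
proof -
  have "(\<Sum>a<brank A. t a *\<^sub>R dual_frame A e a x) (e b x) = (\<Sum>a<brank A. t a * (if a = b then 1 else 0))"
    unfolding sum_fun_apply by (intro sum.cong) (auto simp: dual_frame_eval[OF f _ b])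
  also have "\<dots> = t b" using b by (simp add: if_distrib[of "(*) _"] cong: if_cong)
  finally show ?thesis .
qed

context
  fixes V e x assumes f: "(V, e) \<in> frames A" "x \<in> V"
begin

lemma dual_frame_inj: "inj_on (\<lambda>a. dual_frame A e a x) {..<brank A}"
proof (rule inj_onI)
  fix a b assume ab: "a \<in> {..<brank A}" "b \<in> {..<brank A}" "dual_frame A e a x = dual_frame A e b x"
  then have "dual_frame A e a x (e a x) = dual_frame A e b x (e a x)" by simp
  then show "a = b" using ab(1,2) by (simp add: dual_frame_eval[OF f] split: if_splits)
qed

lemma dual_frame_independent: "independent ((\<lambda>a. dual_frame A e a x) ` {..<brank A})"
proof (rule independent_if_scalars_zero)
  fix t \<alpha>
  assume t: "(\<Sum>\<alpha>\<in>(\<lambda>a. dual_frame A e a x) ` {..<brank A}. t \<alpha> *\<^sub>R \<alpha>) = 0"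
    and "\<alpha> \<in> (\<lambda>a. dual_frame A e a x) ` {..<brank A}"
  then obtain b where b: "b < brank A" "\<alpha> = dual_frame A e b x" by blast
  have "(\<Sum>a<brank A. t (dual_frame A e a x) *\<^sub>R dual_frame A e a x) = 0"
    using t by (simp add: sum.reindex[OF dual_frame_inj])
  then show "t \<alpha> = 0"
    using dual_frame_sum_eval[OF f b(1), of "\<lambda>a. t (dual_frame A e a x)"] b(2) by simp
qed simp

lemma dual_frame_span: "span ((\<lambda>a. dual_frame A e a x) ` {..<brank A}) = dual_fibre A x"
proof
  show "span ((\<lambda>a. dual_frame A e a x) ` {..<brank A}) \<subseteq> dual_fibre A x"
    by (rule span_minimal) (use dual_frame_in[OF f] dual_fibre_subspace in auto)
  show "dual_fibre A x \<subseteq> span ((\<lambda>a. dual_frame A e a x) ` {..<brank A})"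
  proof
    fix \<alpha> assume "\<alpha> \<in> dual_fibre A x"
    from dual_frame_expansion[OF f this]
    show "\<alpha> \<in> span ((\<lambda>a. dual_frame A e a x) ` {..<brank A})"
      by (metis (no_types, lifting) imageI span_base span_scale span_sum)
  qed
qed

lemma component_dual_frame:
  assumes "\<alpha> \<in> dual_fibre A x" "b < brank A"
  shows "component (brank A) (dual_frame A e) x \<alpha> b = \<alpha> (e b x)"
proof -
  let ?B = "(\<lambda>a. dual_frame A e a x) ` {..<brank A}"
  have "\<alpha> = (\<Sum>\<beta>\<in>?B. representation ?B \<alpha> \<beta> *\<^sub>R \<beta>)"
    by (rule sum_representation_eq[symmetric, OF dual_frame_independent])
      (use assms dual_frame_span in auto)
  then have "\<alpha> = (\<Sum>a<brank A. component (brank A) (dual_frame A e) x \<alpha> a *\<^sub>R dual_frame A e a x)"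
    unfolding component_def sum.reindex[OF dual_frame_inj] by simp
  then have "\<alpha> (e b x) = (\<Sum>a<brank A. component (brank A) (dual_frame A e) x \<alpha> a *\<^sub>R dual_frame A e a x) (e b x)"
    by simp
  then show ?thesis by (simp add: dual_frame_sum_eval[OF f assms(2)])
qed

end

lemma dual_bundle_simps [simp]:
  "brank (dual_bundle A) = brank A" "fibre (dual_bundle A) = dual_fibre A"
  "(V, \<epsilon>) \<in> frames (dual_bundle A) \<longleftrightarrow> (\<exists>e. \<epsilon> = dual_frame A e \<and> (V, e) \<in> frames A)"
  unfolding dual_bundle_def by auto

text \<open>A transition function of the dual frames is the transition function of the frames in the
  opposite direction, with exchanged indices.\<close>

lemma dual_vector_bundle: "vector_bundle M (dual_bundle A)"
proof -
  have "(\<Union>(V, e)\<in>frames (dual_bundle A). V) = UNIV"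
  proof -
    have "\<exists>c\<in>frames (dual_bundle A). x \<in> (case c of (V, e) \<Rightarrow> V)" for x
    proof -
      obtain V e where "(V, e) \<in> frames A" "x \<in> V" using frame_at by blast
      then show ?thesis by (intro bexI[of _ "(V, dual_frame A e)"]) auto
    qed
    then show ?thesis by blast
  qed
  moreover have "smooth_fun M (V \<inter> V') (\<lambda>x. component (brank A) (dual_frame A e) x (dual_frame A e' b x) a)"
    if f: "(V, e) \<in> frames A" "(V', e') \<in> frames A" "a < brank A" "b < brank A" for V e V' e' a b
  proof (rule smooth_fun_cong)
    show "open (V \<inter> V')" using frame_open f by blast
    show "smooth_fun M (V \<inter> V') (\<lambda>x. component (brank A) e' x (e a x) b)"
      using transition_smooth[OF f(2,1,4,3)] by (simp add: Int_commute)
    fix x assume x: "x \<in> V \<inter> V'"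
    then show "component (brank A) e' x (e a x) b = component (brank A) (dual_frame A e) x (dual_frame A e' b x) a"
      using component_dual_frame[OF f(1) _ dual_frame_in[OF f(2)] f(3)] frame_in_fibre[OF f(1) _ f(3)]
      by (simp add: dual_frame_def)
  qed
  ultimately show ?thesis
    unfolding vector_bundle_def
    using frame_open dual_frame_inj dual_frame_independent dual_frame_span by auto
qed

lemma dual_vbundle_on: "vbundle_on M (dual_bundle A)"
  by (unfold_locales) (rule dual_vector_bundle)

lemma fibre_eqI:
  assumes "u \<in> fibre A x" "v \<in> fibre A x" "\<And>\<alpha>. \<alpha> \<in> dual_fibre A x \<Longrightarrow> \<alpha> u = \<alpha> v"
  shows "u = v"
proof -
  obtain V e where f: "(V, e) \<in> frames A" "x \<in> V" using frame_at by blast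
  have "component (brank A) e x u a = component (brank A) e x v a" for a
    using assms(3)[OF dual_frame_in[OF f]] assms(1,2) by (simp add: dual_frame_def)
  then show ?thesis using component_expansion[OF f assms(1)] component_expansion[OF f assms(2)] by simp
qed

text \<open>A finite-dimensional space is its own bidual: the components of the vector are the values of the
  functional on the dual frame, and functionals separate vectors.\<close>

lemma bidual_vector:
  assumes lin: "\<And>\<alpha> \<beta> c. \<alpha> \<in> dual_fibre A x \<Longrightarrow> \<beta> \<in> dual_fibre A x \<Longrightarrow> L (c *\<^sub>R \<alpha> + \<beta>) = c * L \<alpha> + L \<beta>"
  shows "\<exists>!v. v \<in> fibre A x \<and> (\<forall>\<alpha>\<in>dual_fibre A x. L \<alpha> = \<alpha> v)"
proof -
  obtain V e where f: "(V, e) \<in> frames A" "x \<in> V" using frame_at by blast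
  interpret dual: vbundle_on M "dual_bundle A" by (rule dual_vbundle_on)
  \<comment> \<open>extended by zero, \<open>L\<close> is an element of the fibre of the bidual bundle\<close>
  define L' where "L' \<alpha> = (if \<alpha> \<in> dual_fibre A x then L \<alpha> else 0)" for \<alpha>
  have L': "L' \<in> dual_fibre (dual_bundle A) x"
    by (rule dual.dual_fibreI) (auto simp: L'_def lin dual_fibre_add dual_fibre_scaleR)
  define v where "v = (\<Sum>a<brank A. L (dual_frame A e a x) *\<^sub>R e a x)"
  have v: "v \<in> fibre A x" unfolding v_def
    by (intro fibre_sum fibre_scaleR frame_in_fibre[OF f]) auto
  have "L \<alpha> = \<alpha> v" if \<alpha>: "\<alpha> \<in> dual_fibre A x" for \<alpha>
  proof -
    have "L \<alpha> = (\<Sum>a<brank A. \<alpha> (e a x) * L (dual_frame A e a x))"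
      using dual.dual_fibre_eval[of V "dual_frame A e" x L' \<alpha>] f L' \<alpha> component_dual_frame[OF f \<alpha>]
        dual_frame_in[OF f] by (auto simp: L'_def)
    also have "\<dots> = \<alpha> v"
      using dual_fibre_eval[OF f \<alpha> v] component_frame_sum[OF f] by (simp add: v_def mult.commute)
    finally show ?thesis .
  qed
  then show ?thesis using v fibre_eqI[of _ x v] by (intro ex1I[of _ v]) auto
qed

end

section \<open>Forms\<close>

context vbundle_on
begin

context
  fixes \<omega> assumes \<omega>: "\<omega> \<in> forms M A"
begin

lemma form_outside: "\<not> set vs \<subseteq> fibre A x \<Longrightarrow> \<omega> x vs = 0"
  using \<omega> unfolding forms_def by blast

lemma form_linear:
  "u \<in> fibre A x \<Longrightarrow> v \<in> fibre A x \<Longrightarrow> set us \<union> set ws \<subseteq> fibre A x \<Longrightarrow>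
    \<omega> x (us @ (c *\<^sub>R u + v) # ws) = c * \<omega> x (us @ u # ws) + \<omega> x (us @ v # ws)"
  using \<omega> unfolding forms_def by blast

lemma form_alternating: "\<not> distinct vs \<Longrightarrow> \<omega> x vs = 0"
  using \<omega> unfolding forms_def by blast

lemma form_smooth:
  "(V, e) \<in> frames A \<Longrightarrow> set as \<subseteq> {..<brank A} \<Longrightarrow> smooth_fun M V (\<lambda>x. \<omega> x (map (\<lambda>a. e a x) as))"
  using \<omega> unfolding forms_def by auto

text \<open>Varying one argument of a form gives a functional on the fibre, so that forms can be expanded in
  a frame one argument at a time.\<close>

lemma form_slot_dual:
  assumes "set us \<union> set ws \<subseteq> fibre A x"
  shows "(\<lambda>v. \<omega> x (us @ v # ws)) \<in> dual_fibre A x"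
proof (rule dual_fibreI)
  fix u v c assume "u \<in> fibre A x" "v \<in> fibre A x"
  then show "\<omega> x (us @ (c *\<^sub>R u + v) # ws) = c * \<omega> x (us @ u # ws) + \<omega> x (us @ v # ws)"
    using assms by (rule form_linear)
qed (simp add: form_outside)

text \<open>Expand the value on a list in which \<open>u + v\<close> appears twice; it is zero.\<close>

lemma form_swap:
  assumes "set us \<union> set ws \<subseteq> fibre A x" "u \<in> fibre A x" "v \<in> fibre A x"
  shows "\<omega> x (us @ u # v # ws) = - \<omega> x (us @ v # u # ws)"
proof -
  have l: "\<omega> x (us @ p # (u + v) # ws) = \<omega> x (us @ p # u # ws) + \<omega> x (us @ p # v # ws)" if "p \<in> fibre A x" for p
    using form_linear[of u x v "us @ [p]" ws 1] assms that by simp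
  have "0 = \<omega> x (us @ (u + v) # (u + v) # ws)" by (simp add: form_alternating)
  also have "\<dots> = \<omega> x (us @ u # (u + v) # ws) + \<omega> x (us @ v # (u + v) # ws)"
    using form_linear[of u x v us "(u + v) # ws" 1] assms by (simp add: fibre_add)
  also have "\<dots> = \<omega> x (us @ u # v # ws) + \<omega> x (us @ v # u # ws)"
    using l assms by (simp add: form_alternating)
  finally show ?thesis by simp
qed

text \<open>Insertion sort reorders a list by transpositions of neighbours, which change a form by a sign
  only. The prefix \<open>us\<close> is kept general because the induction moves elements into it.\<close>

lemma form_insort_zero:
  assumes f: "\<And>a. a \<in> set (a0 # as) \<Longrightarrow> f a \<in> fibre A x"
    and "set us \<subseteq> fibre A x" "\<omega> x (us @ map f (insort a0 as)) = 0"
  shows "\<omega> x (us @ map f (a0 # as)) = 0"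
  using assms
proof (induction as arbitrary: us)
  case (Cons b bs)
  show ?case
  proof (cases "a0 \<le> b")
    case False
    have "\<omega> x ((us @ [f b]) @ map f (a0 # bs)) = 0"
      by (rule Cons.IH) (use Cons.prems False in auto)
    then show ?thesis
      using form_swap[of us "map f bs" x "f a0" "f b"] Cons.prems by auto
  qed (use Cons.prems in auto)
qed simp

lemma form_sort_zero:
  assumes "\<And>a. a \<in> set as \<Longrightarrow> f a \<in> fibre A x" "set us \<subseteq> fibre A x" "\<omega> x (us @ map f (sort as)) = 0"
  shows "\<omega> x (us @ map f as) = 0"
  using assms
proof (induction as arbitrary: us)
  case (Cons a as)
  have "\<omega> x (us @ map f (a # sort as)) = 0"
    by (rule form_insort_zero) (use Cons.prems in auto)
  then have "\<omega> x ((us @ [f a]) @ map f as) = 0"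
    by (intro Cons.IH) (use Cons.prems in auto)
  then show ?case by simp
qed simp

text \<open>Sorting reduces arbitrary lists of frame vectors to increasing ones, and expanding the arguments
  from the right reduces arbitrary vectors to frame vectors.\<close>

lemma form_degree_zero:
  assumes f: "(V, e) \<in> frames A" "x \<in> V"
    and z: "\<And>S. S \<subseteq> {..<brank A} \<Longrightarrow> card S = k \<Longrightarrow> \<omega> x (map (\<lambda>a. e a x) (sorted_list_of_set S)) = 0"
    and vs: "set vs \<subseteq> fibre A x" "length vs = k"
  shows "\<omega> x vs = 0"
proof -
  have *: "\<omega> x (map (\<lambda>a. e a x) as) = 0" if as: "set as \<subseteq> {..<brank A}" "length as = k" for as
  proof (cases "distinct as")
    case True
    then have "sorted_list_of_set (set as) = sort as" "card (set as) = k"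
      using as(2) by (simp_all add: sorted_list_of_set_sort_remdups distinct_remdups_id distinct_card)
    then have "\<omega> x (map (\<lambda>a. e a x) (sort as)) = 0"
      using z[OF as(1)] by metis
    then show ?thesis
      using form_sort_zero[of as "\<lambda>a. e a x" x "[]"] as(1) frame_in_fibre[OF f] by auto
  next
    case False
    then show ?thesis by (intro form_alternating) (simp add: distinct_map)
  qed
  have "\<omega> x (vs @ map (\<lambda>a. e a x) as) = 0"
    if "set as \<subseteq> {..<brank A}" "set vs \<subseteq> fibre A x" "length vs + length as = k" for as vs
    using that
  proof (induction vs arbitrary: as rule: rev_induct)
    case (snoc v vs)
    have "\<omega> x (vs @ v # map (\<lambda>a. e a x) as) =
        (\<Sum>b<brank A. component (brank A) e x v b * \<omega> x (vs @ e b x # map (\<lambda>a. e a x) as))"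
      by (rule dual_fibre_eval[OF f form_slot_dual]) (use snoc.prems frame_in_fibre[OF f] in auto)
    also have "\<dots> = 0"
    proof (rule sum.neutral, rule ballI)
      fix b assume "b \<in> {..<brank A}"
      then have "\<omega> x (vs @ map (\<lambda>a. e a x) (b # as)) = 0" using snoc.prems by (intro snoc.IH) auto
      then show "component (brank A) e x v b * \<omega> x (vs @ e b x # map (\<lambda>a. e a x) as) = 0" by simp
    qed
    finally show ?case by simp
  qed (use * in simp)
  from this[of "[]" vs] show ?thesis using vs by simp
qed

lemma one_form_dual: "(\<lambda>v. \<omega> x [v]) \<in> dual_fibre A x"
  using form_slot_dual[of "[]" "[]" x] by simp

lemma one_form_eval:
  assumes "(V, e) \<in> frames A" "x \<in> V" "v \<in> fibre A x"
  shows "\<omega> x [v] = (\<Sum>m<brank A. component (brank A) e x v m * \<omega> x [e m x])"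
  using dual_fibre_eval[OF assms(1,2) one_form_dual assms(3)] by simp

lemma one_form_coefficient_smooth:
  assumes "(V, e) \<in> frames A" "x \<in> V" "m < brank A"
  shows "smooth_near M x (\<lambda>y. \<omega> y [e m y])"
  using smooth_near_fun[OF frame_open[OF assms(1)] assms(2) form_smooth[OF assms(1), of "[m]"]] assms(3)
  by simp

lemma one_form_section_smooth:
  assumes X: "X \<in> sections M A"
  shows "smooth_near M x (\<lambda>y. \<omega> y [X y])"
proof -
  obtain V e where f: "(V, e) \<in> frames A" "x \<in> V" using frame_at by blast
  have "smooth_near M x (\<lambda>y. \<Sum>m<brank A. component (brank A) e y (X y) m * \<omega> y [e m y])"
    by (intro smooth_near_sum smooth_near_mult section_component_smooth_near[OF X f(1) _ f(2)]
        one_form_coefficient_smooth[OF f]) auto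
  then show ?thesis
    by (rule smooth_near_cong[OF _ frame_open[OF f(1)] f(2)])
      (simp add: one_form_eval[OF f(1) _ section_in_fibre[OF X], symmetric])
qed

end

lemma cov_to_form_degree: "length vs \<noteq> 1 \<Longrightarrow> cov_to_form \<alpha> x vs = 0"
  by (auto simp: cov_to_form_def split: list.split)

text \<open>Applied to the bundle this makes covectors one-forms, applied to its dual it does so for vectors.\<close>

lemma cov_to_form_in_forms:
  assumes d: "\<And>x. \<alpha> x \<in> dual_fibre A x"
    and s: "\<And>V e m. (V, e) \<in> frames A \<Longrightarrow> m < brank A \<Longrightarrow> smooth_fun M V (\<lambda>x. \<alpha> x (e m x))"
  shows "cov_to_form \<alpha> \<in> forms M A"
  unfolding forms_def mem_Collect_eq
proof (intro conjI allI impI ballI)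
  fix x vs assume "\<not> set vs \<subseteq> fibre A x"
  then show "cov_to_form \<alpha> x vs = 0"
    using dual_fibre_outside[OF d] by (auto simp: cov_to_form_def split: list.split)
next
  fix x us ws u v c assume uv: "u \<in> fibre A x" "v \<in> fibre A x"
  show "cov_to_form \<alpha> x (us @ (c *\<^sub>R u + v) # ws) =
      c * cov_to_form \<alpha> x (us @ u # ws) + cov_to_form \<alpha> x (us @ v # ws)"
  proof (cases "us = [] \<and> ws = []")
    case True
    then show ?thesis
      using dual_fibre_linear(1)[OF d fibre_scaleR[OF uv(1)] uv(2)] dual_fibre_linear(2)[OF d uv(1)]
      by (simp add: cov_to_form_def)
  next
    case False
    then have "cov_to_form \<alpha> x (us @ w # ws) = 0" for w by (intro cov_to_form_degree) auto
    then show ?thesis by simp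
  qed
next
  fix x vs assume "\<not> distinct (vs :: 'v list)"
  then show "cov_to_form \<alpha> x vs = 0" by (auto simp: cov_to_form_def split: list.split)
next
  fix c assume c: "c \<in> frames A"
  obtain V e where Ve: "c = (V, e)" by (cases c)
  then have f: "(V, e) \<in> frames A" using c by simp
  have "smooth_fun M V (\<lambda>x. cov_to_form \<alpha> x (map (\<lambda>a. e a x) as))" if as: "set as \<subseteq> {..<brank A}" for as
  proof -
    consider m where "as = [m]" | "length as \<noteq> 1"
      by (cases as rule: remdups_adj.cases) auto
    then show ?thesis
    proof cases
      case 1
      then show ?thesis using s[OF f] as by (simp add: cov_to_form_def)
    next
      case 2
      then have "cov_to_form \<alpha> x (map (\<lambda>a. e a x) as) = 0" for x
        by (intro cov_to_form_degree) simp
      then show ?thesis using smooth_fun_const[OF frame_open[OF f], of 0] by simp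
    qed
  qed
  then show "case c of (V, e) \<Rightarrow> \<forall>as. set as \<subseteq> {..<brank A} \<longrightarrow>
       smooth_fun M V (\<lambda>x. cov_to_form \<alpha> x (map (\<lambda>a. e a x) as))"
    using Ve by simp
qed

lemma cov_to_form_section:
  assumes \<xi>: "\<xi> \<in> sections M (dual_bundle A)"
  shows "cov_to_form \<xi> \<in> forms M A"
proof -
  interpret dual: vbundle_on M "dual_bundle A" by (rule dual_vbundle_on)
  show ?thesis
  proof (rule cov_to_form_in_forms)
    show d: "\<xi> x \<in> dual_fibre A x" for x using dual.section_in_fibre[OF \<xi>, of x] by simp
    fix V e m assume f: "(V, e) \<in> frames A" "m < brank A"
    show "smooth_fun M V (\<lambda>x. \<xi> x (e m x))"
    proof (rule smooth_fun_cong[OF frame_open[OF f(1)]])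
      show "smooth_fun M V (\<lambda>x. component (brank A) (dual_frame A e) x (\<xi> x) m)"
        using dual.section_component_smooth[OF \<xi>, of V "dual_frame A e" m] f by auto
    qed (simp add: component_dual_frame[OF f(1) _ d f(2)])
  qed
qed

text \<open>As a form on the dual bundle, a vector is the functional that evaluates at it.\<close>

lemma vec_to_form_section:
  assumes X: "X \<in> sections M A"
  shows "vec_to_form A X \<in> forms M (dual_bundle A)"
proof -
  interpret dual: vbundle_on M "dual_bundle A" by (rule dual_vbundle_on)
  define \<alpha> where "\<alpha> x \<beta> = (if \<beta> \<in> dual_fibre A x then \<beta> (X x) else 0)" for x \<beta>
  have "vec_to_form A X = cov_to_form \<alpha>"
    by (intro ext) (simp add: vec_to_form_def cov_to_form_def \<alpha>_def split: list.split)
  moreover have "cov_to_form \<alpha> \<in> forms M (dual_bundle A)"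
  proof (rule dual.cov_to_form_in_forms)
    show "\<alpha> x \<in> dual_fibre (dual_bundle A) x" for x
      by (rule dual.dual_fibreI) (auto simp: \<alpha>_def dual_fibre_add dual_fibre_scaleR)
    fix V \<epsilon> m assume f: "(V, \<epsilon>) \<in> frames (dual_bundle A)" and "m < brank (dual_bundle A)"
    then obtain e where e: "\<epsilon> = dual_frame A e" "(V, e) \<in> frames A" and m: "m < brank A" by auto
    show "smooth_fun M V (\<lambda>x. \<alpha> x (\<epsilon> m x))"
      by (rule smooth_fun_cong[OF frame_open[OF e(2)] section_component_smooth[OF X e(2) m]])
        (simp add: \<alpha>_def e(1) dual_frame_in[OF e(2)], simp add: dual_frame_def section_in_fibre[OF X])
  qed
  ultimately show ?thesis by simp
qed

lemma zero_form_in_forms: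
  assumes g: "smooth_fun M UNIV g"
  shows "(\<lambda>x vs. if vs = [] then g x else 0) \<in> forms M A"
proof -
  have "smooth_fun M V (\<lambda>x. if map (\<lambda>a. e a x) as = [] then g x else 0)" if f: "(V, e) \<in> frames A" for V e as
    using smooth_fun_subset[OF g subset_UNIV] smooth_fun_const[OF frame_open[OF f], of 0] by (cases as) simp_all
  then show ?thesis unfolding forms_def by auto
qed

end

section \<open>Lie algebroids\<close>

locale algebroid_on = vbundle_on M A
  for M :: "'m::{t2_space, second_countable_topology} manifold" and A :: "('m, 'v::real_vector) vbundle" +
  fixes a br
  assumes algebroid: "lie_algebroid M A a br"
begin

lemma anchor_tangent: "v \<in> fibre A x \<Longrightarrow> tangent_vector M x (a x v)"
  using conjunct1[OF algebroid[unfolded lie_algebroid_def]] by blast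

lemma anchor_linear:
  assumes "u \<in> fibre A x" "v \<in> fibre A x" "smooth_near M x f"
  shows "a x (c *\<^sub>R u + v) f = c * a x u f + a x v f"
  using spec[OF spec[OF bspec[OF bspec[OF spec[OF conjunct1[OF conjunct2[OF algebroid[unfolded lie_algebroid_def]]]] assms(1)] assms(2)]]] assms(3) by (rule mp)

lemma anchor_smooth:
  "X \<in> sections M A \<Longrightarrow> open W \<Longrightarrow> smooth_fun M W f \<Longrightarrow> smooth_fun M W (\<lambda>x. a x (X x) f)"
  using conjunct1[OF conjunct2[OF conjunct2[OF algebroid[unfolded lie_algebroid_def]]]] by blast

context
  fixes X Y assumes X: "X \<in> sections M A" and Y: "Y \<in> sections M A"
begin

lemma br_section: "br X Y \<in> sections M A"
  and br_antisym: "br X Y = - br Y X"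
  using bspec[OF bspec[OF conjunct1[OF conjunct2[OF conjunct2[OF conjunct2[OF algebroid[unfolded lie_algebroid_def]]]]] X] Y] by (rule conjunct1, rule conjunct2)

end

lemma br_linear:
  assumes "X \<in> sections M A" "Y \<in> sections M A" "Z \<in> sections M A"
  shows "br X (c *\<^sub>R Y + Z) = c *\<^sub>R br X Y + br X Z"
  using spec[OF bspec[OF bspec[OF bspec[OF conjunct1[OF conjunct2[OF conjunct2[OF conjunct2[OF conjunct2[OF algebroid[unfolded lie_algebroid_def]]]]]] assms(1)] assms(2)] assms(3)]] by (rule conjunct1)

lemma br_leibniz:
  assumes "X \<in> sections M A" "Y \<in> sections M A" "smooth_fun M UNIV f"
  shows "br X (\<lambda>x. f x *\<^sub>R Y x) = (\<lambda>x. f x *\<^sub>R br X Y x + a x (X x) f *\<^sub>R Y x)"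
  using spec[OF bspec[OF bspec[OF conjunct2[OF conjunct2[OF conjunct2[OF conjunct2[OF conjunct2[OF algebroid[unfolded lie_algebroid_def]]]]]] assms(1)] assms(2)]] assms(3) by (rule mp)

lemma br_sum:
  assumes X: "X \<in> sections M A" and F: "\<And>i. i \<in> I \<Longrightarrow> F i \<in> sections M A"
  shows "br X (\<Sum>i\<in>I. F i) = (\<Sum>i\<in>I. br X (F i))"
proof -
  have 0: "br X 0 = 0" using br_linear[OF X sections_zero sections_zero, of 1] by simp
  show ?thesis
    using F
  proof (induction I rule: infinite_finite_induct)
    case (insert i I)
    have "(\<Sum>i\<in>I. F i) \<in> sections M A" using insert.prems by (intro sections_sum) auto
    then have step: "br X (F i + (\<Sum>i\<in>I. F i)) = br X (F i) + br X (\<Sum>i\<in>I. F i)"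
      using br_linear[OF X, of "F i" "\<Sum>i\<in>I. F i" 1] insert.prems by simp
    have "br X (\<Sum>i\<in>I. F i) = (\<Sum>i\<in>I. br X (F i))" by (rule insert.IH) (use insert.prems in auto)
    then show ?case by (simp only: sum.insert[OF insert.hyps] step)
  qed (simp_all add: 0)
qed

lemma anchor_dual:
  assumes f: "smooth_near M x f"
  shows "(\<lambda>v. if v \<in> fibre A x then a x v f else 0) \<in> dual_fibre A x"
  by (rule dual_fibreI) (auto simp: anchor_linear f fibre_add fibre_scaleR)

lemma anchor_eval:
  assumes fr: "(V, e) \<in> frames A" "x \<in> V" and v: "v \<in> fibre A x" and f: "smooth_near M x f"
  shows "a x v f = (\<Sum>m<brank A. component (brank A) e x v m * a x (e m x) f)"
  using dual_fibre_eval[OF fr anchor_dual[OF f] v] v frame_in_fibre[OF fr] by simp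

subsection \<open>Structure functions\<close>

text \<open>The numbers \<open>C\<close> are the structure functions of a local frame at the point \<open>x\<close>:
  \<open>[e\<^sub>p, e\<^sub>q] = \<Sum> C p q m e\<^sub>m\<close>. As the bracket is defined on global sections only, they are
  characterized by the local expression of the bracket that they yield.\<close>

definition structure_fun :: "(nat \<Rightarrow> 'm \<Rightarrow> 'v) \<Rightarrow> 'm \<Rightarrow> (nat \<Rightarrow> nat \<Rightarrow> nat \<Rightarrow> real) \<Rightarrow> bool"
  where "structure_fun e x C \<longleftrightarrow> (\<forall>p q m. C p q m = - C q p m) \<and>
    (\<forall>X\<in>sections M A. \<forall>Y\<in>sections M A. \<forall>m<brank A.
      component (brank A) e x (br X Y x) m =
        (\<Sum>p<brank A. \<Sum>q<brank A. component (brank A) e x (X x) p * component (brank A) e x (Y x) q * C p q m)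
        + a x (X x) (\<lambda>y. component (brank A) e y (Y y) m) - a x (Y x) (\<lambda>y. component (brank A) e y (X y) m))"

text \<open>Here the bump function does its work: near \<open>x\<close> the section \<open>X\<close> agrees with \<open>h X = \<Sum> g\<^sub>p E\<^sub>p\<close>, the Leibniz
  rule applies to both sides, and \<open>h\<close> has derivative zero at \<open>x\<close>.\<close>

lemma br_frame_expansion:
  assumes f: "(V, e) \<in> frames A" "x \<in> V"
  shows "\<exists>E. (\<forall>p<brank A. E p \<in> sections M A \<and> E p x = e p x) \<and>
    (\<forall>Y\<in>sections M A. \<forall>X\<in>sections M A. br Y X x =
      (\<Sum>p<brank A. component (brank A) e x (X x) p *\<^sub>R br Y (E p) x
         + a x (Y x) (\<lambda>y. component (brank A) e y (X y) p) *\<^sub>R e p x))"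
proof -
  obtain E N h where N: "open N" "x \<in> N" "N \<subseteq> V" and h: "smooth_fun M UNIV h" "\<forall>y\<in>N. h y = 1"
    and E: "\<forall>p<brank A. E p \<in> sections M A \<and> (\<forall>y\<in>N. E p y = e p y)"
    and ex: "\<forall>X\<in>sections M A. \<exists>g. (\<forall>p<brank A. smooth_fun M UNIV (g p) \<and>
        (\<forall>y\<in>N. g p y = component (brank A) e y (X y) p)) \<and>
      (\<lambda>y. h y *\<^sub>R X y) = (\<Sum>p<brank A. (\<lambda>y. g p y *\<^sub>R E p y))"
    using frame_extension[OF f] by (elim exE conjE) (rule that)
  have "br Y X x = (\<Sum>p<brank A. component (brank A) e x (X x) p *\<^sub>R br Y (E p) x
         + a x (Y x) (\<lambda>y. component (brank A) e y (X y) p) *\<^sub>R e p x)"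
    if X: "X \<in> sections M A" and Y: "Y \<in> sections M A" for X Y
  proof -
    obtain g where g: "\<And>p. p < brank A \<Longrightarrow> smooth_fun M UNIV (g p)"
      "\<And>p y. p < brank A \<Longrightarrow> y \<in> N \<Longrightarrow> g p y = component (brank A) e y (X y) p"
      and hX: "(\<lambda>y. h y *\<^sub>R X y) = (\<Sum>p<brank A. (\<lambda>y. g p y *\<^sub>R E p y))"
      using bspec[OF ex X] by blast
    note tY = anchor_tangent[OF section_in_fibre[OF Y], of x]
    have near: "smooth_near M x g'" if "smooth_fun M UNIV g'" for g'
      by (rule smooth_near_fun[OF open_UNIV UNIV_I that])
    have "a x (Y x) h = a x (Y x) (\<lambda>y. 1)"
      by (rule tangent_vector_cong[OF tY near[OF h(1)] N(1,2)]) (use h(2) in simp)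
    also have "\<dots> = 0" by (rule tangent_vector_const[OF tY])
    finally have "br Y X x = br Y (\<lambda>y. h y *\<^sub>R X y) x"
      using br_leibniz[OF Y X h(1)] h(2) N(2) by simp
    also have "\<dots> = (\<Sum>p<brank A. br Y (\<lambda>y. g p y *\<^sub>R E p y)) x"
      unfolding hX by (subst br_sum[OF Y]) (use g(1) E in \<open>auto intro: sections_smooth_scaleR\<close>)
    also have "\<dots> = (\<Sum>p<brank A. br Y (\<lambda>y. g p y *\<^sub>R E p y) x)" by (rule sum_fun_apply)
    also have "\<dots> = (\<Sum>p<brank A. component (brank A) e x (X x) p *\<^sub>R br Y (E p) x
         + a x (Y x) (\<lambda>y. component (brank A) e y (X y) p) *\<^sub>R e p x)"
    proof (rule sum.cong[OF refl])
      fix p assume "p \<in> {..<brank A}"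
      then have p: "p < brank A" by simp
      have "a x (Y x) (g p) = a x (Y x) (\<lambda>y. component (brank A) e y (X y) p)"
        by (rule tangent_vector_cong[OF tY near[OF g(1)[OF p]] N(1,2)]) (use g(2)[OF p] in simp)
      then show "br Y (\<lambda>y. g p y *\<^sub>R E p y) x = component (brank A) e x (X x) p *\<^sub>R br Y (E p) x
         + a x (Y x) (\<lambda>y. component (brank A) e y (X y) p) *\<^sub>R e p x"
        using br_leibniz[OF Y _ g(1)[OF p], of "E p"] E p N(2) g(2)[OF p N(2)] by simp
    qed
    finally show ?thesis .
  qed
  then show ?thesis using E N(2) by (intro exI[of _ E]) auto
qed

text \<open>Expand the second argument in the frame, exchange the arguments by antisymmetry and expand again.\<close>

lemma structure_fun_exists:
  assumes f: "(V, e) \<in> frames A" "x \<in> V"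
  shows "\<exists>C. structure_fun e x C"
proof -
  obtain E where E: "\<And>p. p < brank A \<Longrightarrow> E p \<in> sections M A" "\<And>p. p < brank A \<Longrightarrow> E p x = e p x"
    and exp: "\<And>X Y. Y \<in> sections M A \<Longrightarrow> X \<in> sections M A \<Longrightarrow> br Y X x =
      (\<Sum>p<brank A. component (brank A) e x (X x) p *\<^sub>R br Y (E p) x
         + a x (Y x) (\<lambda>y. component (brank A) e y (X y) p) *\<^sub>R e p x)"
    using br_frame_expansion[OF f] by blast
  let ?c = "component (brank A) e"
  define C where "C p q m = (if p < brank A \<and> q < brank A then ?c x (br (E p) (E q) x) m else 0)" for p q m
  have neg: "?c x (- v) m = - ?c x v m" if "v \<in> fibre A x" for v m
    using component_scaleR[OF f that, of "-1" m] by simp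
  have comp: "?c x (br Y X x) m = (\<Sum>p<brank A. ?c x (X x) p * ?c x (br Y (E p) x) m) + a x (Y x) (\<lambda>y. ?c y (X y) m)"
    if Y: "Y \<in> sections M A" and X: "X \<in> sections M A" and m: "m < brank A" for X Y m
  proof -
    have F: "br Y (E p) x \<in> fibre A x" if "p < brank A" for p
      using section_in_fibre[OF br_section[OF Y E(1)[OF that]]] .
    have "?c x (br Y X x) m = (\<Sum>p<brank A. ?c x (?c x (X x) p *\<^sub>R br Y (E p) x + a x (Y x) (\<lambda>y. ?c y (X y) p) *\<^sub>R e p x) m)"
      unfolding exp[OF Y X]
      by (rule component_sum[OF f]) (auto intro!: fibre_add fibre_scaleR F frame_in_fibre[OF f])
    also have "\<dots> = (\<Sum>p<brank A. ?c x (X x) p * ?c x (br Y (E p) x) m + a x (Y x) (\<lambda>y. ?c y (X y) p) * (if m = p then 1 else 0))"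
      by (rule sum.cong) (auto simp: component_add[OF f] component_scaleR[OF f] fibre_scaleR F
          frame_in_fibre[OF f] component_frame[OF f m])
    also have "\<dots> = (\<Sum>p<brank A. ?c x (X x) p * ?c x (br Y (E p) x) m) + a x (Y x) (\<lambda>y. ?c y (X y) m)"
      using m by (simp add: sum.distrib if_distrib[of "(*) _"] cong: if_cong)
    finally show ?thesis .
  qed
  have "?c x (br X Y x) m = (\<Sum>p<brank A. \<Sum>q<brank A. ?c x (X x) p * ?c x (Y x) q * C p q m)
        + a x (X x) (\<lambda>y. ?c y (Y y) m) - a x (Y x) (\<lambda>y. ?c y (X y) m)"
    if X: "X \<in> sections M A" and Y: "Y \<in> sections M A" and m: "m < brank A" for X Y m
  proof -
    have "?c x (br X (E q) x) m = (\<Sum>p<brank A. ?c x (X x) p * C p q m) - a x (e q x) (\<lambda>y. ?c y (X y) m)"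
      if q: "q < brank A" for q
    proof -
      have "?c x (br X (E q) x) m = - ?c x (br (E q) X x) m"
        using br_antisym[OF X E(1)[OF q]] neg[OF section_in_fibre[OF br_section[OF E(1)[OF q] X]]] by simp
      also have "\<dots> = - (\<Sum>p<brank A. ?c x (X x) p * ?c x (br (E q) (E p) x) m) - a x (e q x) (\<lambda>y. ?c y (X y) m)"
        using comp[OF E(1)[OF q] X m] E(2)[OF q] by simp
      also have "(\<Sum>p<brank A. ?c x (X x) p * ?c x (br (E q) (E p) x) m) = (\<Sum>p<brank A. ?c x (X x) p * (- C p q m))"
        by (rule sum.cong) (use q br_antisym[OF E(1)[OF q] E(1)]
            neg[OF section_in_fibre[OF br_section[OF E(1) E(1)[OF q]]]] in \<open>auto simp: C_def\<close>)
      finally show ?thesis by (simp add: sum_negf)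
    qed
    then have "(\<Sum>q<brank A. ?c x (Y x) q * ?c x (br X (E q) x) m) =
        (\<Sum>q<brank A. ?c x (Y x) q * (\<Sum>p<brank A. ?c x (X x) p * C p q m)) -
        (\<Sum>q<brank A. ?c x (Y x) q * a x (e q x) (\<lambda>y. ?c y (X y) m))"
      by (simp add: right_diff_distrib sum_subtractf)
    moreover have "(\<Sum>q<brank A. ?c x (Y x) q * a x (e q x) (\<lambda>y. ?c y (X y) m)) = a x (Y x) (\<lambda>y. ?c y (X y) m)"
      by (rule anchor_eval[OF f section_in_fibre[OF Y] section_component_smooth_near[OF X f(1) m f(2)], symmetric])
    moreover have "(\<Sum>q<brank A. ?c x (Y x) q * (\<Sum>p<brank A. ?c x (X x) p * C p q m)) =
        (\<Sum>p<brank A. \<Sum>q<brank A. ?c x (X x) p * ?c x (Y x) q * C p q m)"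
      unfolding sum_distrib_left by (subst sum.swap) (simp add: mult_ac)
    ultimately show ?thesis using comp[OF X Y m] by simp
  qed
  moreover have "C p q m = - C q p m" for p q m
    using br_antisym[OF E(1) E(1), of p q] neg[OF section_in_fibre[OF br_section[OF E(1) E(1)]], of q p]
    by (auto simp: C_def)
  ultimately show ?thesis unfolding structure_fun_def by blast
qed

lemma structure_fun_bracket:
  assumes "structure_fun e x C" "X \<in> sections M A" "Y \<in> sections M A" "m < brank A"
  shows "component (brank A) e x (br X Y x) m =
        (\<Sum>p<brank A. \<Sum>q<brank A. component (brank A) e x (X x) p * component (brank A) e x (Y x) q * C p q m)
        + a x (X x) (\<lambda>y. component (brank A) e y (Y y) m) - a x (Y x) (\<lambda>y. component (brank A) e y (X y) m)"
  using assms(1)[unfolded structure_fun_def, THEN conjunct2, THEN bspec, OF assms(2), THEN bspec, OF assms(3)] assms(4)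
  by blast

lemma structure_fun_antisym: "structure_fun e x C \<Longrightarrow> C p q m = - C q p m"
  unfolding structure_fun_def by (drule conjunct1) blast

subsection \<open>The differential in low degree\<close>

text \<open>The description defining the differential has a solution as soon as the Cartan formula gives
  the same value for all extensions of the vectors to sections, since extensions exist.\<close>

lemma lie_d_eqI:
  assumes "set vs \<subseteq> fibre A x"
    and "\<And>Xs. set Xs \<subseteq> sections M A \<Longrightarrow> map (\<lambda>X. X x) Xs = vs \<Longrightarrow> cartan a br \<omega> Xs x = t"
  shows "lie_d M A a br \<omega> x vs = t"
proof -
  obtain Xs where Xs: "set Xs \<subseteq> sections M A \<and> map (\<lambda>X. X x) Xs = vs"
    using sections_through[OF assms(1)] by blast
  have "(THE t. \<forall>Xs. set Xs \<subseteq> sections M A \<and> map (\<lambda>X. X x) Xs = vs \<longrightarrow> cartan a br \<omega> Xs x = t) = t"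
  proof (rule the_equality)
    show "\<forall>Xs. set Xs \<subseteq> sections M A \<and> map (\<lambda>X. X x) Xs = vs \<longrightarrow> cartan a br \<omega> Xs x = t"
      using assms(2) by blast
    fix t' assume "\<forall>Xs. set Xs \<subseteq> sections M A \<and> map (\<lambda>X. X x) Xs = vs \<longrightarrow> cartan a br \<omega> Xs x = t'"
    then have "cartan a br \<omega> Xs x = t'" using Xs by blast
    moreover have "cartan a br \<omega> Xs x = t" using Xs by (intro assms(2)) auto
    ultimately show "t' = t" by simp
  qed
  then show ?thesis using assms(1) by (simp add: lie_d_def)
qed

lemma lie_d_outside: "\<not> set vs \<subseteq> fibre A x \<Longrightarrow> lie_d M A a br \<omega> x vs = 0"
  by (simp add: lie_d_def)

lemma lie_d_one:
  assumes v: "v \<in> fibre A x"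
  shows "lie_d M A a br \<omega> x [v] = a x v (\<lambda>y. \<omega> y [])"
proof (rule lie_d_eqI)
  fix Xs assume "map (\<lambda>X. X x) Xs = [v]"
  then obtain X where X: "Xs = [X]" "X x = v" by auto
  show "cartan a br \<omega> Xs x = a x v (\<lambda>y. \<omega> y [])"
    unfolding X(1) cartan_def by (simp add: omit_def X(2))
qed (use v in simp)

lemma cartan_pair:
  "cartan a br \<omega> [X, Y] x =
    a x (X x) (\<lambda>y. \<omega> y [Y y]) - a x (Y x) (\<lambda>y. \<omega> y [X y]) - \<omega> x [br X Y x]"
  unfolding cartan_def by (simp add: omit_def lessThan_Suc numeral_2_eq_2)

text \<open>Derivatives of the components of the two sections appear in the Cartan formula both through
  the anchors and through the bracket, and cancel; hence the value depends only on the vectors.\<close>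

lemma lie_d_two:
  assumes f: "(V, e) \<in> frames A" "x \<in> V" and C: "structure_fun e x C"
    and \<omega>: "\<omega> \<in> forms M A" and u: "u \<in> fibre A x" and v: "v \<in> fibre A x"
  shows "lie_d M A a br \<omega> x [u, v] =
    (\<Sum>m<brank A. component (brank A) e x v m * a x u (\<lambda>y. \<omega> y [e m y]))
    - (\<Sum>m<brank A. component (brank A) e x u m * a x v (\<lambda>y. \<omega> y [e m y]))
    - (\<Sum>m<brank A. (\<Sum>p<brank A. \<Sum>q<brank A.
        component (brank A) e x u p * component (brank A) e x v q * C p q m) * \<omega> x [e m x])"
proof (rule lie_d_eqI)
  let ?c = "component (brank A) e"
  fix Xs assume Xs: "set Xs \<subseteq> sections M A" "map (\<lambda>X. X x) Xs = [u, v]"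
  then obtain X Y where XY: "Xs = [X, Y]" "X x = u" "Y x = v" "X \<in> sections M A" "Y \<in> sections M A"
    by (auto simp: map_eq_Cons_conv)
  have deriv: "a x w (\<lambda>y. \<omega> y [Z y]) =
      (\<Sum>m<brank A. a x w (\<lambda>y. ?c y (Z y) m) * \<omega> x [e m x] + ?c x (Z x) m * a x w (\<lambda>y. \<omega> y [e m y]))"
    if w: "w \<in> fibre A x" and Z: "Z \<in> sections M A" for w Z
  proof -
    note t = anchor_tangent[OF w]
    have s: "smooth_near M x (\<lambda>y. ?c y (Z y) m)" "smooth_near M x (\<lambda>y. \<omega> y [e m y])" if "m < brank A" for m
      using section_component_smooth_near[OF Z f(1) that f(2)] one_form_coefficient_smooth[OF \<omega> f that] .
    have "a x w (\<lambda>y. \<omega> y [Z y]) = a x w (\<lambda>y. \<Sum>m<brank A. ?c y (Z y) m * \<omega> y [e m y])"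
      by (rule tangent_vector_cong[OF t one_form_section_smooth[OF \<omega> Z] frame_open[OF f(1)] f(2)])
        (rule one_form_eval[OF \<omega> f(1) _ section_in_fibre[OF Z]])
    also have "\<dots> = (\<Sum>m<brank A. a x w (\<lambda>y. ?c y (Z y) m * \<omega> y [e m y]))"
      by (rule tangent_vector_sum[OF t]) (use s smooth_near_mult in auto)
    also have "\<dots> = (\<Sum>m<brank A. a x w (\<lambda>y. ?c y (Z y) m) * \<omega> x [e m x] + ?c x (Z x) m * a x w (\<lambda>y. \<omega> y [e m y]))"
      by (rule sum.cong[OF refl], rule tangent_vector_mult[OF t]) (use s in auto)
    finally show ?thesis .
  qed
  have "\<omega> x [br X Y x] = (\<Sum>m<brank A. ?c x (br X Y x) m * \<omega> x [e m x])"
    by (rule one_form_eval[OF \<omega> f section_in_fibre[OF br_section[OF XY(4,5)]]])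
  also have "\<dots> = (\<Sum>m<brank A. ((\<Sum>p<brank A. \<Sum>q<brank A. ?c x u p * ?c x v q * C p q m)
      + a x u (\<lambda>y. ?c y (Y y) m) - a x v (\<lambda>y. ?c y (X y) m)) * \<omega> x [e m x])"
    by (rule sum.cong[OF refl]) (simp add: structure_fun_bracket[OF C XY(4,5)] XY(2,3))
  finally have b: "\<omega> x [br X Y x] = (\<Sum>m<brank A. ((\<Sum>p<brank A. \<Sum>q<brank A. ?c x u p * ?c x v q * C p q m)
      + a x u (\<lambda>y. ?c y (Y y) m) - a x v (\<lambda>y. ?c y (X y) m)) * \<omega> x [e m x])" .
  show "cartan a br \<omega> Xs x = (\<Sum>m<brank A. ?c x v m * a x u (\<lambda>y. \<omega> y [e m y]))
    - (\<Sum>m<brank A. ?c x u m * a x v (\<lambda>y. \<omega> y [e m y]))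
    - (\<Sum>m<brank A. (\<Sum>p<brank A. \<Sum>q<brank A. ?c x u p * ?c x v q * C p q m) * \<omega> x [e m x])"
    unfolding XY(1) cartan_pair b XY(2,3) deriv[OF u XY(5)] deriv[OF v XY(4)]
    by (simp add: XY(2,3) sum.distrib sum_subtractf distrib_right left_diff_distrib)
qed (use u v in simp)

text \<open>Linearity can be read off the formula in a frame.\<close>

lemma lie_d_two_dual:
  assumes \<omega>: "\<omega> \<in> forms M A" and u: "u \<in> fibre A x"
  shows "(\<lambda>v. lie_d M A a br \<omega> x [u, v]) \<in> dual_fibre A x"
proof (rule dual_fibreI)
  obtain V e where f: "(V, e) \<in> frames A" "x \<in> V" using frame_at by blast
  obtain C where C: "structure_fun e x C" using structure_fun_exists[OF f] by blast
  fix v w c assume vw: "v \<in> fibre A x" "w \<in> fibre A x"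
  let ?c = "component (brank A) e x"
  have c: "?c (c *\<^sub>R v + w) m = c * ?c v m + ?c w m" for m
    using component_add[OF f fibre_scaleR[OF vw(1)] vw(2)] component_scaleR[OF f vw(1)] by simp
  have l: "(\<Sum>m<brank A. ?c u m * a x (c *\<^sub>R v + w) (\<lambda>y. \<omega> y [e m y])) =
    (\<Sum>m<brank A. ?c u m * (c * a x v (\<lambda>y. \<omega> y [e m y]) + a x w (\<lambda>y. \<omega> y [e m y])))"
    by (rule sum.cong[OF refl]) (simp add: anchor_linear[OF vw one_form_coefficient_smooth[OF \<omega> f]])
  have vw': "c *\<^sub>R v + w \<in> fibre A x" using vw by (intro fibre_add fibre_scaleR)
  show "lie_d M A a br \<omega> x [u, c *\<^sub>R v + w] = c * lie_d M A a br \<omega> x [u, v] + lie_d M A a br \<omega> x [u, w]"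
    unfolding lie_d_two[OF f C \<omega> u vw'] lie_d_two[OF f C \<omega> u vw(1)] lie_d_two[OF f C \<omega> u vw(2)] c l
    by (simp add: algebra_simps sum.distrib sum_distrib_left sum_distrib_right sum_subtractf)
next
  fix v assume "v \<notin> fibre A x"
  then show "lie_d M A a br \<omega> x [u, v] = 0" by (intro lie_d_outside) simp
qed

lemma length_omit: "i < length xs \<Longrightarrow> length (omit i xs) = length xs - 1"
  and set_omit: "set (omit i xs) \<subseteq> set xs"
  unfolding omit_def using set_take_subset[of i xs] set_drop_subset[of "Suc i" xs] by auto

text \<open>In each term of the Cartan formula the form is applied to one vector less, at \<open>x\<close> or near \<open>x\<close> under a
  derivative at \<open>x\<close>.\<close>

lemma lie_d_degree_zero:
  assumes vs: "set vs \<subseteq> fibre A x" and N: "open N" "x \<in> N"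
    and z: "\<And>y ws. y \<in> N \<Longrightarrow> set ws \<subseteq> fibre A y \<Longrightarrow> length ws + 1 = length vs \<Longrightarrow> \<omega> y ws = 0"
  shows "lie_d M A a br \<omega> x vs = 0"
proof (rule lie_d_eqI[OF vs])
  fix Xs assume Xs: "set Xs \<subseteq> sections M A" "map (\<lambda>X. X x) Xs = vs"
  then have len: "length Xs = length vs" by auto
  have fib: "X y \<in> fibre A y" if "X \<in> set Xs" for X y using section_in_fibre[of X y] Xs(1) that by blast
  have "a x ((Xs ! i) x) (\<lambda>y. \<omega> y (map (\<lambda>X. X y) (omit i Xs))) = 0" if i: "i < length Xs" for i
  proof -
    have t: "tangent_vector M x (a x ((Xs ! i) x))" by (rule anchor_tangent[OF fib]) (use i in simp)
    have "\<omega> y (map (\<lambda>X. X y) (omit i Xs)) = 0" if "y \<in> N" for y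
      by (rule z[OF that]) (use fib set_omit[of i Xs] length_omit[OF i] i len in auto)
    then have "a x ((Xs ! i) x) (\<lambda>y. 0) = a x ((Xs ! i) x) (\<lambda>y. \<omega> y (map (\<lambda>X. X y) (omit i Xs)))"
      by (intro tangent_vector_cong[OF t smooth_near_const N]) simp
    then show ?thesis using tangent_vector_const[OF t] by simp
  qed
  moreover have "\<omega> x (map (\<lambda>X. X x) (br (Xs ! i) (Xs ! j) # omit i (omit j Xs))) = 0"
    if ij: "j < length Xs" "i < j" for i j
  proof (rule z[OF N(2)])
    have l: "length (omit j Xs) = length Xs - 1" by (rule length_omit[OF ij(1)])
    then have "length (omit i (omit j Xs)) = length Xs - 2" using length_omit[of i "omit j Xs"] ij by simp
    then show "length (map (\<lambda>X. X x) (br (Xs ! i) (Xs ! j) # omit i (omit j Xs))) + 1 = length vs"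
      using ij len by simp
    have "br (Xs ! i) (Xs ! j) \<in> sections M A"
      by (rule br_section) (use Xs(1) ij in auto)
    moreover have "set (omit i (omit j Xs)) \<subseteq> set Xs" using set_omit[of i "omit j Xs"] set_omit[of j Xs] by simp
    ultimately show "set (map (\<lambda>X. X x) (br (Xs ! i) (Xs ! j) # omit i (omit j Xs))) \<subseteq> fibre A x"
      using fib section_in_fibre by auto
  qed
  ultimately show "cartan a br \<omega> Xs x = 0" unfolding cartan_def by simp
qed

lemma lie_deriv_one:
  assumes v: "v \<in> fibre A x"
  shows "lie_deriv M A a br X \<omega> x [v] = a x v (\<lambda>y. \<omega> y [X y]) + lie_d M A a br \<omega> x [X x, v]"
  unfolding lie_deriv_def using lie_d_one[OF v, of "contract X \<omega>"] by (simp add: contract_def)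

text \<open>Both terms of the Lie derivative of a one-form are functionals, so it is again a one-form.\<close>

lemma lie_deriv_dual:
  assumes \<omega>: "\<omega> \<in> forms M A" and X: "X \<in> sections M A"
  shows "(\<lambda>v. lie_deriv M A a br X \<omega> x [v]) \<in> dual_fibre A x"
proof -
  have "(\<lambda>v. lie_deriv M A a br X \<omega> x [v]) =
    (\<lambda>v. if v \<in> fibre A x then a x v (\<lambda>y. \<omega> y [X y]) else 0) + (\<lambda>v. lie_d M A a br \<omega> x [X x, v])"
  proof
    fix v
    show "lie_deriv M A a br X \<omega> x [v] =
      ((\<lambda>v. if v \<in> fibre A x then a x v (\<lambda>y. \<omega> y [X y]) else 0) + (\<lambda>v. lie_d M A a br \<omega> x [X x, v])) v"
    proof (cases "v \<in> fibre A x")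
      case True
      then show ?thesis by (simp add: lie_deriv_one)
    next
      case False
      then show ?thesis by (simp add: lie_deriv_def contract_def lie_d_outside)
    qed
  qed
  also have "\<dots> \<in> dual_fibre A x"
    by (intro dual_fibre_add anchor_dual one_form_section_smooth[OF \<omega> X] lie_d_two_dual[OF \<omega> section_in_fibre[OF X]])
  finally show ?thesis .
qed

lemma lie_d_frame:
  assumes f: "(V, e) \<in> frames A" "x \<in> V" and C: "structure_fun e x C"
    and \<omega>: "\<omega> \<in> forms M A" and u: "u \<in> fibre A x" and m: "m < brank A"
  shows "lie_d M A a br \<omega> x [u, e m x] = a x u (\<lambda>y. \<omega> y [e m y])
    - (\<Sum>k<brank A. component (brank A) e x u k * a x (e m x) (\<lambda>y. \<omega> y [e k y]))
    - (\<Sum>p<brank A. \<Sum>k<brank A. component (brank A) e x u p * C p m k * \<omega> x [e k x])"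
proof -
  let ?c = "component (brank A) e x"
  have d: "?c (e m x) k = (if k = m then 1 else 0)" if "k < brank A" for k
    using component_frame[OF f that m] .
  have "(\<Sum>k<brank A. ?c (e m x) k * a x u (\<lambda>y. \<omega> y [e k y])) = (\<Sum>k<brank A. if k = m then a x u (\<lambda>y. \<omega> y [e k y]) else 0)"
    by (rule sum.cong) (auto simp: d)
  moreover have "(\<Sum>q<brank A. ?c u p * ?c (e m x) q * C p q k) = ?c u p * C p m k" for p k
  proof -
    have "(\<Sum>q<brank A. ?c u p * ?c (e m x) q * C p q k) = (\<Sum>q<brank A. if q = m then ?c u p * C p q k else 0)"
      by (rule sum.cong) (auto simp: d)
    then show ?thesis using m by simp
  qed
  ultimately show ?thesis
    unfolding lie_d_two[OF f C \<omega> u frame_in_fibre[OF f m]]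
    using m sum.swap[of "\<lambda>k p. ?c u p * C p m k * \<omega> x [e k x]" "{..<brank A}" "{..<brank A}"]
    by (simp add: sum_distrib_right)
qed

text \<open>The terms with \<open>a(e\<^sub>m)\<close> applied to the coefficients of \<open>\<omega>\<close> cancel between the two parts of
  the Lie derivative.\<close>

lemma lie_deriv_frame:
  assumes f: "(V, e) \<in> frames A" "x \<in> V" and C: "structure_fun e x C"
    and \<omega>: "\<omega> \<in> forms M A" and X: "X \<in> sections M A" and m: "m < brank A"
  shows "lie_deriv M A a br X \<omega> x [e m x] = a x (X x) (\<lambda>y. \<omega> y [e m y])
    + (\<Sum>k<brank A. a x (e m x) (\<lambda>y. component (brank A) e y (X y) k) * \<omega> x [e k x])
    - (\<Sum>p<brank A. \<Sum>k<brank A. component (brank A) e x (X x) p * C p m k * \<omega> x [e k x])"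
proof -
  let ?c = "component (brank A) e"
  note t = anchor_tangent[OF frame_in_fibre[OF f m]]
  have s: "smooth_near M x (\<lambda>y. ?c y (X y) m)" "smooth_near M x (\<lambda>y. \<omega> y [e m y])" if "m < brank A" for m
    using section_component_smooth_near[OF X f(1) that f(2)] one_form_coefficient_smooth[OF \<omega> f that] .
  have "a x (e m x) (\<lambda>y. \<omega> y [X y]) = a x (e m x) (\<lambda>y. \<Sum>k<brank A. ?c y (X y) k * \<omega> y [e k y])"
    by (rule tangent_vector_cong[OF t one_form_section_smooth[OF \<omega> X] frame_open[OF f(1)] f(2)])
      (rule one_form_eval[OF \<omega> f(1) _ section_in_fibre[OF X]])
  also have "\<dots> = (\<Sum>k<brank A. a x (e m x) (\<lambda>y. ?c y (X y) k * \<omega> y [e k y]))"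
    by (rule tangent_vector_sum[OF t]) (use s smooth_near_mult in auto)
  also have "\<dots> = (\<Sum>k<brank A. a x (e m x) (\<lambda>y. ?c y (X y) k) * \<omega> x [e k x]
      + ?c x (X x) k * a x (e m x) (\<lambda>y. \<omega> y [e k y]))"
    by (rule sum.cong[OF refl], rule tangent_vector_mult[OF t]) (use s in auto)
  finally show ?thesis
    unfolding lie_deriv_one[OF frame_in_fibre[OF f m]] lie_d_frame[OF f C \<omega> section_in_fibre[OF X] m]
    by (simp add: sum.distrib)
qed

subsection \<open>The differential as a vector field\<close>

text \<open>A superfunction contains the values of a form on increasing lists of frame vectors only; by
  multilinearity these determine the form on \<open>N\<close>.\<close>

definition represents ::
    "('m \<Rightarrow> nat \<Rightarrow> real) \<Rightarrow> (nat \<Rightarrow> 'm \<Rightarrow> 'v) \<Rightarrow> ('m, 'v) form \<Rightarrow> superfun \<Rightarrow> 'm set \<Rightarrow> bool"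
  where "represents \<phi> e \<omega> G N \<longleftrightarrow> open N \<and>
    (\<forall>y\<in>N. \<forall>S\<subseteq>{..<brank A}. \<omega> y (map (\<lambda>a. e a y) (sorted_list_of_set S)) = G S (\<phi> y))"

context
  fixes U \<phi> V e c z x
  assumes ch: "(U, \<phi>) \<in> charts M" and fr: "(V, e) \<in> frames A" and z: "z \<in> \<phi> ` (U \<inter> V)"
  defines c: "c \<equiv> ((U, \<phi>), (V, e))" and x: "x \<equiv> inv_into U \<phi> z"
begin

lemma coords_point: "x \<in> U" "x \<in> V" "\<phi> x = z"
  using chart_inv_in[OF ch z] chart_inv_inv[OF ch z] unfolding x by auto

lemma base_point_chart: "y \<in> U \<Longrightarrow> base_point (mdim M) c (\<phi> y) = y"
proof -
  assume y: "y \<in> U"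
  have "trunc (mdim M) (\<phi> y) = \<phi> y"
    using chart_in_Rn[OF ch y] by (auto simp: trunc_def fun_eq_iff)
  then show ?thesis using chart_inv[OF ch y] by (simp add: base_point_def c)
qed

text \<open>A vector field acts on local functions through germs in the chart; this translates them to
  neighbourhoods in the manifold.\<close>

lemma form_germ_iff:
  "(\<exists>W. openin (Euclidean_space (mdim M)) W \<and> z \<in> W \<and> W \<subseteq> coord_dom c \<and>
       (\<forall>z'\<in>W. \<forall>S'\<subseteq>{..<brank A}. form_fun M \<omega> c S' z' = G S' z')) \<longleftrightarrow>
   (\<exists>N. x \<in> N \<and> N \<subseteq> U \<inter> V \<and> represents \<phi> e \<omega> G N)" (is "?L \<longleftrightarrow> ?R")
proof
  assume ?L
  then obtain W where W: "openin (Euclidean_space (mdim M)) W" "z \<in> W" "W \<subseteq> \<phi> ` (U \<inter> V)"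
    and G: "\<And>z' S'. z' \<in> W \<Longrightarrow> S' \<subseteq> {..<brank A} \<Longrightarrow> form_fun M \<omega> c S' z' = G S' z'"
    unfolding coord_dom_def c by auto
  define N where "N = {y \<in> U. \<phi> y \<in> W}"
  have "x \<in> N" unfolding N_def using coords_point W(2) by simp
  moreover have "N \<subseteq> U \<inter> V"
  proof
    fix y assume y: "y \<in> N"
    then have yU: "y \<in> U" and "\<phi> y \<in> \<phi> ` (U \<inter> V)" using W(3) unfolding N_def by auto
    then have "inv_into U \<phi> (\<phi> y) \<in> U \<inter> V" by (intro chart_inv_in[OF ch])
    then show "y \<in> U \<inter> V" using chart_inv[OF ch yU] by simp
  qed
  moreover have "represents \<phi> e \<omega> G N"
    unfolding represents_def
  proof (intro conjI ballI allI impI)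
    show "open N" unfolding N_def by (rule chart_preimage_open[OF ch W(1)])
    show "\<omega> y (map (\<lambda>a. e a y) (sorted_list_of_set S)) = G S (\<phi> y)"
      if "y \<in> N" "S \<subseteq> {..<brank A}" for y S
      using G[of "\<phi> y" S] that base_point_chart[of y] unfolding N_def form_fun_def by (simp add: c)
  qed
  ultimately show ?R by blast
next
  assume ?R
  then obtain N where N: "open N" "x \<in> N" "N \<subseteq> U \<inter> V"
    and G': "\<forall>y\<in>N. \<forall>S\<subseteq>{..<brank A}. \<omega> y (map (\<lambda>a. e a y) (sorted_list_of_set S)) = G S (\<phi> y)"
    unfolding represents_def by blast
  note G = G'[rule_format]
  have W1: "openin (Euclidean_space (mdim M)) (\<phi> ` (U \<inter> N))" by (rule chart_openin[OF ch N(1)])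
  have W2: "z \<in> \<phi> ` (U \<inter> N)" using N coords_point by force
  have W3: "\<phi> ` (U \<inter> N) \<subseteq> coord_dom c" using N unfolding coord_dom_def c by auto
  have W4: "form_fun M \<omega> c S' z' = G S' z'" if z': "z' \<in> \<phi> ` (U \<inter> N)" and "S' \<subseteq> {..<brank A}" for z' S'
  proof -
    obtain y where y: "y \<in> U" "y \<in> N" "z' = \<phi> y" using z' by blast
    then show ?thesis using G[OF y(2) that(2)] base_point_chart[OF y(1)] by (simp add: form_fun_def c)
  qed
  show ?L
    by (intro exI[of _ "\<phi> ` (U \<inter> N)"] conjI ballI allI impI W1 W2 W3) (rule W4)
qed

lemma vf_apply_eqI:
  assumes ex: "\<exists>\<omega>\<in>forms M A. \<exists>N. x \<in> N \<and> N \<subseteq> U \<inter> V \<and> represents \<phi> e \<omega> G N"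
    and val: "\<And>\<omega> N. \<omega> \<in> forms M A \<Longrightarrow> x \<in> N \<Longrightarrow> N \<subseteq> U \<inter> V \<Longrightarrow> represents \<phi> e \<omega> G N \<Longrightarrow>
       v \<omega> x (map (\<lambda>a. e a x) (sorted_list_of_set S)) = t"
  shows "vf_apply M A v c G S z = t"
proof -
  have ff: "form_fun M (v \<omega>) c S z = v \<omega> x (map (\<lambda>a. e a x) (sorted_list_of_set S))" for \<omega>
    using base_point_chart[OF coords_point(1)] coords_point(3) by (simp add: form_fun_def c)
  show ?thesis
    unfolding vf_apply_def form_germ_iff ff by (rule the_equality) (use ex val in blast)+
qed

lemma frame_list_in_fibre:
  "y \<in> V \<Longrightarrow> S \<subseteq> {..<brank A} \<Longrightarrow> set (map (\<lambda>a. e a y) (sorted_list_of_set S)) \<subseteq> fibre A y"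
  using frame_in_fibre[OF fr] finite_subset[of S "{..<brank A}"] by auto

text \<open>A coordinate has only a component of degree \<open>k = 0\<close> or \<open>k = 1\<close>. As the differential is local and of
  degree one, only the component of degree \<open>k + 1\<close> remains to be computed.\<close>

lemma lie_d_germ_degree:
  assumes \<omega>: "\<omega> \<in> forms M A" and N: "x \<in> N" "N \<subseteq> U \<inter> V" and rep: "represents \<phi> e \<omega> G N"
    and G: "\<And>y S. y \<in> N \<Longrightarrow> card S \<noteq> k \<Longrightarrow> G S (\<phi> y) = 0"
    and S: "S \<subseteq> {..<brank A}" "card S \<noteq> k + 1"
  shows "lie_d M A a br \<omega> x (map (\<lambda>a. e a x) (sorted_list_of_set S)) = 0"
proof (rule lie_d_degree_zero[OF frame_list_in_fibre[OF coords_point(2) S(1)] _ N(1)])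
  show "open N" using rep by (simp add: represents_def)
  fix y ws assume y: "y \<in> N" and ws: "set ws \<subseteq> fibre A y"
    "length ws + 1 = length (map (\<lambda>a. e a x) (sorted_list_of_set S))"
  show "\<omega> y ws = 0"
  proof (rule form_degree_zero[OF \<omega> fr _ _ ws(1) refl])
    show "y \<in> V" using y N(2) by blast
    fix T assume "T \<subseteq> {..<brank A}" "card T = length ws"
    then show "\<omega> y (map (\<lambda>a. e a y) (sorted_list_of_set T)) = 0"
      using rep G[OF y] y S(2) ws(2) by (simp add: represents_def)
  qed
qed

text \<open>The even coordinate \<open>x\<^sup>i\<close> is the germ of a function on \<open>M\<close>, and its differential is the anchor.\<close>

lemma vf_apply_even:
  assumes i: "i < mdim M" and S: "S \<subseteq> {..<brank A}"
  shows "vf_apply M A (lie_d M A a br) c (ecoord i) S z =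
    (if card S = 1 then a x (e (the_elem S) x) (\<lambda>y. \<phi> y i) else 0)"
proof (rule vf_apply_eqI)
  have UV: "open (U \<inter> V)" "x \<in> U \<inter> V" using chart_open[OF ch] frame_open[OF fr] coords_point by auto
  obtain \<beta> K N where \<beta>: "smooth_fun M UNIV \<beta>" and K: "closed K" "K \<subseteq> U \<inter> V" "\<forall>y. y \<notin> K \<longrightarrow> \<beta> y = 0"
    and N: "open N" "x \<in> N" "N \<subseteq> U \<inter> V" "\<forall>y\<in>N. \<beta> y = 1"
    using bump_function[OF UV] by metis
  define g where "g y = (if y \<in> U then \<beta> y * \<phi> y i else 0)" for y
  have "smooth_fun M UNIV g"
    unfolding g_def
    by (rule smooth_fun_extend_zero[OF chart_open[OF ch] K(1) _ open_UNIV \<beta>])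
      (use K(2,3) smooth_fun_chart_coord[OF ch i] in auto)
  then have "(\<lambda>y vs. if vs = [] then g y else 0) \<in> forms M A" by (rule zero_form_in_forms)
  moreover have "(if map (\<lambda>a. e a y) (sorted_list_of_set S) = [] then g y else 0) = ecoord i S (\<phi> y)"
    if "y \<in> N" "S \<subseteq> {..<brank A}" for y S
    using that N(3,4) finite_subset[of S "{..<brank A}"] by (auto simp: base_fun_def g_def)
  ultimately show "\<exists>\<omega>\<in>forms M A. \<exists>N. x \<in> N \<and> N \<subseteq> U \<inter> V \<and> represents \<phi> e \<omega> (ecoord i) N"
    using N(1-3)
    by (intro bexI[of _ "\<lambda>y vs. if vs = [] then g y else 0"] exI[of _ N]) (simp_all add: represents_def)
next
  fix \<omega> N
  assume \<omega>: "\<omega> \<in> forms M A" and N: "x \<in> N" "N \<subseteq> U \<inter> V" and rep: "represents \<phi> e \<omega> (ecoord i) N"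
  have oN: "open N" and G: "\<And>y S. y \<in> N \<Longrightarrow> S \<subseteq> {..<brank A} \<Longrightarrow>
      \<omega> y (map (\<lambda>a. e a y) (sorted_list_of_set S)) = ecoord i S (\<phi> y)"
    using rep by (auto simp: represents_def)
  show "lie_d M A a br \<omega> x (map (\<lambda>a. e a x) (sorted_list_of_set S)) =
    (if card S = 1 then a x (e (the_elem S) x) (\<lambda>y. \<phi> y i) else 0)"
  proof (cases "card S = 1")
    case True
    then obtain b where b: "S = {b}" using card_1_singletonE by blast
    have t: "tangent_vector M x (a x (e b x))"
      by (rule anchor_tangent) (use frame_in_fibre[OF fr coords_point(2)] S b in auto)
    have "a x (e b x) (\<lambda>y. \<phi> y i) = a x (e b x) (\<lambda>y. \<omega> y [])"
    proof (rule tangent_vector_cong[OF t _ oN N(1)])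
      show "smooth_near M x (\<lambda>y. \<phi> y i)"
        by (rule smooth_near_fun[OF chart_open[OF ch] coords_point(1) smooth_fun_chart_coord[OF ch i]])
      show "\<phi> y i = \<omega> y []" if "y \<in> N" for y using G[OF that, of "{}"] by (simp add: base_fun_def)
    qed
    then show ?thesis
      using lie_d_one[of "e b x" x \<omega>] frame_in_fibre[OF fr coords_point(2)] S by (simp add: b)
  next
    case False
    have "lie_d M A a br \<omega> x (map (\<lambda>a. e a x) (sorted_list_of_set S)) = 0"
      by (rule lie_d_germ_degree[OF \<omega> N rep _ S, of 0]) (use False in \<open>auto simp: base_fun_def\<close>)
    then show ?thesis using False by simp
  qed
qed

text \<open>The odd coordinate \<open>\<xi>\<^sup>m\<close> is the germ of a covector whose components in the frame are constant, so only the
  bracket term of the Cartan formula survives. The two elements of \<open>S\<close> are its minimum and maximum.\<close>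

lemma vf_apply_odd:
  assumes C: "structure_fun e x C" and m: "m < brank A" and S: "S \<subseteq> {..<brank A}"
  shows "vf_apply M A (lie_d M A a br) c (ocoord m) S z = (if card S = 2 then - C (Min S) (Max S) m else 0)"
proof (rule vf_apply_eqI)
  interpret dual: vbundle_on M "dual_bundle A" by (rule dual_vbundle_on)
  have fr': "(V, dual_frame A e) \<in> frames (dual_bundle A)" using fr by auto
  obtain \<xi> N where \<xi>: "\<xi> \<in> sections M (dual_bundle A)" and N: "open N" "x \<in> N" "N \<subseteq> V"
    and eq: "\<And>y. y \<in> N \<Longrightarrow> \<xi> y = dual_frame A e m y"
    using dual.frame_section[OF fr' coords_point(2), unfolded dual_bundle_simps, OF m] by metis
  have "cov_to_form \<xi> y (map (\<lambda>a. e a y) (sorted_list_of_set S)) = ocoord m S (\<phi> y)"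
    if y: "y \<in> N" and S: "S \<subseteq> {..<brank A}" for y S
  proof (cases "card S = 1")
    case True
    then obtain b where b: "S = {b}" using card_1_singletonE by blast
    then show ?thesis
      using eq[OF y] dual_frame_eval[OF fr _ m, of y b] N(3) y S by (auto simp: cov_to_form_def ocoord_def)
  next
    case False
    then have "cov_to_form \<xi> y (map (\<lambda>a. e a y) (sorted_list_of_set S)) = 0" by (intro cov_to_form_degree) simp
    moreover have "S \<noteq> {m}" using False by auto
    ultimately show ?thesis by (simp add: ocoord_def)
  qed
  moreover have "open (U \<inter> N)" "x \<in> U \<inter> N" "U \<inter> N \<subseteq> U \<inter> V"
    using N coords_point chart_open[OF ch] by auto
  ultimately show "\<exists>\<omega>\<in>forms M A. \<exists>N. x \<in> N \<and> N \<subseteq> U \<inter> V \<and> represents \<phi> e \<omega> (ocoord m) N"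
    by (intro bexI[OF _ cov_to_form_section[OF \<xi>]] exI[of _ "U \<inter> N"]) (simp add: represents_def)
next
  fix \<omega> N
  assume \<omega>: "\<omega> \<in> forms M A" and N: "x \<in> N" "N \<subseteq> U \<inter> V" and rep: "represents \<phi> e \<omega> (ocoord m) N"
  have oN: "open N" and G: "\<And>y S. y \<in> N \<Longrightarrow> S \<subseteq> {..<brank A} \<Longrightarrow>
      \<omega> y (map (\<lambda>a. e a y) (sorted_list_of_set S)) = ocoord m S (\<phi> y)"
    using rep by (auto simp: represents_def)
  show "lie_d M A a br \<omega> x (map (\<lambda>a. e a x) (sorted_list_of_set S)) =
    (if card S = 2 then - C (Min S) (Max S) m else 0)"
  proof (cases "card S = 2")
    case True
    have fin: "finite S" using S finite_subset by blast
    obtain p q where pq: "p < q" "S = {p, q}"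
      using True by (metis card_2_iff insert_commute linorder_less_linear)
    then have S_pq: "sorted_list_of_set S = [p, q]" "Min S = p" "Max S = q" by auto
    have pqr: "p < brank A" "q < brank A" using S pq by auto
    have \<omega>m: "\<omega> y [e k y] = (if k = m then 1 else 0)" if "y \<in> N" "k < brank A" for y k
      using G[OF that(1), of "{k}"] that(2) by (simp add: ocoord_def)
    note fp = frame_in_fibre[OF fr coords_point(2)]
    have zero: "a x (e b x) (\<lambda>y. \<omega> y [e k y]) = 0" if b: "b < brank A" and k: "k < brank A" for b k
    proof -
      note t = anchor_tangent[OF fp[OF b]]
      have "a x (e b x) (\<lambda>y. if k = m then 1 else 0) = a x (e b x) (\<lambda>y. \<omega> y [e k y])"
        by (rule tangent_vector_cong[OF t smooth_near_const oN N(1)]) (simp add: \<omega>m k)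
      then show ?thesis using tangent_vector_const[OF t] by simp
    qed
    have "lie_d M A a br \<omega> x [e p x, e q x] =
      - (\<Sum>p'<brank A. \<Sum>k<brank A. component (brank A) e x (e p x) p' * C p' q k * \<omega> x [e k x])"
      unfolding lie_d_frame[OF fr coords_point(2) C \<omega> fp[OF pqr(1)] pqr(2)]
      by (simp add: zero pqr)
    also have "(\<Sum>p'<brank A. \<Sum>k<brank A. component (brank A) e x (e p x) p' * C p' q k * \<omega> x [e k x]) =
      (\<Sum>p'<brank A. \<Sum>k<brank A. if k = m then (if p' = p then C p' q k else 0) else 0)"
      by (intro sum.cong refl)
        (auto simp: \<omega>m[OF N(1)] component_frame[OF fr coords_point(2) _ pqr(1)])
    also have "\<dots> = C p q m" using m pqr by simp
    finally show ?thesis using True by (simp add: S_pq)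
  next
    case False
    have "lie_d M A a br \<omega> x (map (\<lambda>a. e a x) (sorted_list_of_set S)) = 0"
      by (rule lie_d_germ_degree[OF \<omega> N rep _ S, of 1]) (use False in \<open>auto simp: ocoord_def\<close>)
    then show ?thesis using False by simp
  qed
qed

end

subsection \<open>The differential of a function as a section\<close>

lemma anchor_frame_smooth:
  assumes fr: "(V, e) \<in> frames A" and m: "m < brank A" and f: "smooth_fun M UNIV f"
  shows "smooth_fun M V (\<lambda>x. a x (e m x) f)"
proof (rule smooth_fun_local)
  fix x assume x: "x \<in> V"
  obtain X N where X: "X \<in> sections M A" and N: "open N" "x \<in> N" and eq: "\<And>y. y \<in> N \<Longrightarrow> X y = e m y"
    using frame_section[OF fr x m] by metis
  have "smooth_fun M N (\<lambda>x. a x (X x) f)"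
    by (rule anchor_smooth[OF X N(1) smooth_fun_subset[OF f subset_UNIV]])
  then have "smooth_fun M N (\<lambda>x. a x (e m x) f)"
    by (rule smooth_fun_cong[OF N(1)]) (simp add: eq)
  then show "\<exists>W'. open W' \<and> x \<in> W' \<and> smooth_fun M W' (\<lambda>x. a x (e m x) f)" using N by blast
qed

lemma anchor_covector_section:
  assumes f: "smooth_fun M UNIV f"
  shows "(\<lambda>x v. if v \<in> fibre A x then a x v f else 0) \<in> sections M (dual_bundle A)"
proof -
  interpret dual: vbundle_on M "dual_bundle A" by (rule dual_vbundle_on)
  have d: "(\<lambda>v. if v \<in> fibre A x then a x v f else 0) \<in> dual_fibre A x" for x
    by (rule anchor_dual[OF smooth_near_fun[OF open_UNIV UNIV_I f]])
  show ?thesis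
  proof (rule dual.sectionsI)
    fix V \<epsilon> m assume fr': "(V, \<epsilon>) \<in> frames (dual_bundle A)" "m < brank (dual_bundle A)"
    then obtain e where e: "\<epsilon> = dual_frame A e" and fr: "(V, e) \<in> frames A" and m: "m < brank A" by auto
    show "smooth_fun M V (\<lambda>x. component (brank (dual_bundle A)) \<epsilon> x (\<lambda>v. if v \<in> fibre A x then a x v f else 0) m)"
      by (rule smooth_fun_cong[OF frame_open[OF fr] anchor_frame_smooth[OF fr m f]])
        (simp add: e component_dual_frame[OF fr _ d m] frame_in_fibre[OF fr _ m])
  qed (simp add: d)
qed

end

section \<open>Superfunctions of low degree\<close>

lemma koszul_empty [simp]: "koszul {} T = 1" "koszul T {} = 1"
  by (simp_all add: koszul_def)

lemma koszul_singleton_left: "koszul {b} T = (-1) ^ card {j \<in> T. j < b}"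
proof -
  have "{(i, j). i \<in> {b} \<and> j \<in> T \<and> j < i} = Pair b ` {j \<in> T. j < b}" by auto
  then show ?thesis by (simp add: koszul_def card_image inj_on_def)
qed

lemma koszul_singleton_right: "koszul T {b} = (-1) ^ card {i \<in> T. b < i}"
proof -
  have "{(i, j). i \<in> T \<and> j \<in> {b} \<and> j < i} = (\<lambda>i. (i, b)) ` {i \<in> T. b < i}" by auto
  then show ?thesis by (simp add: koszul_def card_image inj_on_def)
qed

lemma smult_infinite: "infinite S \<Longrightarrow> (F \<odot> G) S z = 0"
  by (simp add: smult_def)

lemma base_smult: "(base_fun g \<odot> F) S z = (if finite S then g z * F S z else 0)"
proof (cases "finite S")
  case True
  have "(\<Sum>T\<in>Pow S. koszul T (S - T) * base_fun g T z * F (S - T) z) =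
      (\<Sum>T\<in>Pow S. if T = {} then g z * F S z else 0)"
    by (rule sum.cong) (auto simp: base_fun_def)
  also have "\<dots> = g z * F S z" using True by (subst sum.delta) auto
  finally show ?thesis using True by (simp add: smult_def)
qed (simp add: smult_infinite)

lemma smult_base: "(F \<odot> base_fun g) S z = (if finite S then F S z * g z else 0)"
proof (cases "finite S")
  case True
  have "(\<Sum>T\<in>Pow S. koszul T (S - T) * F T z * base_fun g (S - T) z) =
      (\<Sum>T\<in>Pow S. if T = S then F S z * g z else 0)"
    by (rule sum.cong) (auto simp: base_fun_def)
  also have "\<dots> = F S z * g z" using True by (subst sum.delta) auto
  finally show ?thesis using True by (simp add: smult_def)
qed (simp add: smult_infinite)

lemma ocoord_smult:
  "(ocoord b \<odot> F) S z = (if finite S \<and> b \<in> S then koszul {b} (S - {b}) * F (S - {b}) z else 0)"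
proof (cases "finite S")
  case True
  have "(\<Sum>T\<in>Pow S. koszul T (S - T) * ocoord b T z * F (S - T) z) =
      (\<Sum>T\<in>Pow S. if T = {b} then koszul {b} (S - {b}) * F (S - {b}) z else 0)"
    by (rule sum.cong) (auto simp: ocoord_def)
  also have "\<dots> = (if b \<in> S then koszul {b} (S - {b}) * F (S - {b}) z else 0)"
    using True by (subst sum.delta) auto
  finally show ?thesis using True by (simp add: smult_def)
qed (simp add: smult_infinite)

lemma smult_ocoord:
  "(F \<odot> ocoord b) S z = (if finite S \<and> b \<in> S then koszul (S - {b}) {b} * F (S - {b}) z else 0)"
proof (cases "finite S")
  case True
  have eq: "S - T = {b} \<longleftrightarrow> T = S - {b} \<and> b \<in> S" if "T \<subseteq> S" for T using that by auto
  have d: "S - (S - {b}) = {b}" if "b \<in> S" using that by auto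
  have "(\<Sum>T\<in>Pow S. koszul T (S - T) * F T z * ocoord b (S - T) z) =
      (\<Sum>T\<in>Pow S. if T = S - {b} then (if b \<in> S then koszul (S - {b}) {b} * F (S - {b}) z else 0) else 0)"
    by (rule sum.cong) (auto simp: ocoord_def eq d)
  also have "\<dots> = (if b \<in> S then koszul (S - {b}) {b} * F (S - {b}) z else 0)"
    using True by (subst sum.delta) auto
  finally show ?thesis using True by (simp add: smult_def)
qed (simp add: smult_infinite)

lemma foldr_ocoord_support:
  "foldr (\<odot>) (map ocoord bs) (base_fun (\<lambda>_. 1)) T z \<noteq> 0 \<Longrightarrow> T = set bs"
proof (induction bs arbitrary: T)
  case Nil
  then show ?case by (simp add: base_fun_def split: if_splits)
next
  case (Cons b bs)
  then have "b \<in> T" "foldr (\<odot>) (map ocoord bs) (base_fun (\<lambda>_. 1)) (T - {b}) z \<noteq> 0"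
    by (auto simp: ocoord_smult split: if_splits)
  then show ?case using Cons.IH by fastforce
qed

text \<open>No transposition is needed for increasing indices.\<close>

lemma foldr_ocoord_sorted:
  "sorted_wrt (<) bs \<Longrightarrow> foldr (\<odot>) (map ocoord bs) (base_fun (\<lambda>_. 1)) (set bs) z = 1"
proof (induction bs)
  case (Cons b bs)
  then have "b \<notin> set bs" by auto
  moreover have "{j \<in> set bs. j < b} = {}" using Cons.prems by auto
  then have "koszul {b} (set bs) = 1" by (simp only: koszul_singleton_left card.empty power_0)
  ultimately show ?case using Cons by (simp add: ocoord_smult)
qed (simp add: base_fun_def)

lemma foldr_ocoord:
  assumes "finite S"
  shows "foldr (\<odot>) (map ocoord (sorted_list_of_set S)) (base_fun (\<lambda>_. 1)) T z = (if T = S then 1 else 0)"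
  using foldr_ocoord_support[of "sorted_list_of_set S" T z]
    foldr_ocoord_sorted[of "sorted_list_of_set S" z] assms by auto

lemma pullback_ocoord:
  "pullback q u ocoord F T z = (if T \<subseteq> {..<q} then F T (u z) else 0)"
proof -
  have "pullback q u ocoord F T z = (\<Sum>S\<in>Pow {..<q}. if S = T then F T (u z) else 0)"
    unfolding pullback_def
    by (rule sum.cong[OF refl], subst foldr_ocoord) (auto intro: finite_subset[of _ "{..<q}"])
  also have "\<dots> = (if T \<subseteq> {..<q} then F T (u z) else 0)" by (subst sum.delta) auto
  finally show ?thesis .
qed

subsection \<open>Linear functions\<close>

text \<open>The functions \<open>\<Sum> w\<^sub>b \<zeta>\<^sub>b\<close>; sections of \<open>E\<close> have this form.\<close>

definition lin :: "nat \<Rightarrow> (nat \<Rightarrow> (nat \<Rightarrow> real) \<Rightarrow> real) \<Rightarrow> superfun"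
  where "lin N w S z = (\<Sum>b<N. if S = {b} then w b z else 0)"

lemma lin_singleton: "b < N \<Longrightarrow> lin N w {b} z = w b z"
proof -
  assume b: "b < N"
  have "lin N w {b} z = (\<Sum>c<N. if c = b then w b z else 0)"
    unfolding lin_def by (rule sum.cong) auto
  then show ?thesis using b by simp
qed

lemma lin_zero: "card S \<noteq> 1 \<Longrightarrow> lin N w S z = 0"
  unfolding lin_def by (rule sum.neutral) auto

lemma partial_zero: "partial i (\<lambda>z. 0) z = 0"
  by (simp add: partial_def)

lemma partial_even_lin: "partial_even i (lin N w) = lin N (\<lambda>b. partial i (w b))"
proof (intro ext)
  fix S z
  show "partial_even i (lin N w) S z = lin N (\<lambda>b. partial i (w b)) S z"
  proof (cases "\<exists>b<N. S = {b}")
    case True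
    then obtain b where "b < N" "S = {b}" by blast
    moreover from this have "lin N w {b} = w b" by (intro ext) (simp add: lin_singleton)
    ultimately show ?thesis by (simp add: partial_even_def lin_singleton)
  next
    case False
    then have "lin N v S z = 0" for v z unfolding lin_def by (intro sum.neutral) auto
    moreover from this have "lin N w S = (\<lambda>z. 0)" by blast
    ultimately show ?thesis by (simp add: partial_even_def partial_zero)
  qed
qed

lemma lin_insert: "b < N \<Longrightarrow> b \<notin> S \<Longrightarrow> lin N w (insert b S) z = (if S = {} then w b z else 0)"
proof (cases "S = {}")
  case False
  assume "b \<notin> S"
  then have "card (insert b S) \<noteq> 1" using False by (cases "finite S") auto
  then show ?thesis using False by (simp add: lin_zero)
qed (simp add: lin_singleton)

lemma left_odd_lin: "b < N \<Longrightarrow> left_odd b (lin N w) = base_fun (w b)"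
  by (intro ext) (auto simp: left_odd_def base_fun_def lin_insert)

lemma right_odd_lin: "b < N \<Longrightarrow> right_odd b (lin N w) = base_fun (w b)"
  by (intro ext) (auto simp: right_odd_def base_fun_def lin_insert)

text \<open>Only the products in which the second factor contributes a single coordinate are nonzero.\<close>

lemma smult_lin:
  assumes S: "S \<subseteq> {..<N}"
  shows "(F \<odot> lin N w) S z = (\<Sum>b\<in>S. koszul (S - {b}) {b} * F (S - {b}) z * w b z)"
proof -
  have fin: "finite S" using S finite_subset by blast
  have inj: "inj_on (\<lambda>b. S - {b}) S" by (rule inj_onI) blast
  have "(F \<odot> lin N w) S z = (\<Sum>T\<in>(\<lambda>b. S - {b}) ` S. koszul T (S - T) * F T z * lin N w (S - T) z)"
    unfolding smult_def
  proof (rule sum.mono_neutral_right)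
    show "\<forall>T\<in>Pow S - (\<lambda>b. S - {b}) ` S. koszul T (S - T) * F T z * lin N w (S - T) z = 0"
    proof
      fix T assume T: "T \<in> Pow S - (\<lambda>b. S - {b}) ` S"
      have "card (S - T) \<noteq> 1"
      proof
        assume "card (S - T) = 1"
        then obtain b where "S - T = {b}" using card_1_singletonE by blast
        then have "b \<in> S" "T = S - {b}" using T by auto
        then show False using T by blast
      qed
      then show "koszul T (S - T) * F T z * lin N w (S - T) z = 0" by (simp add: lin_zero)
    qed
  qed (use fin in auto)
  also have "\<dots> = (\<Sum>b\<in>S. koszul (S - {b}) (S - (S - {b})) * F (S - {b}) z * lin N w (S - (S - {b})) z)"
    by (simp add: sum.reindex[OF inj])
  also have "\<dots> = (\<Sum>b\<in>S. koszul (S - {b}) {b} * F (S - {b}) z * w b z)"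
  proof (rule sum.cong[OF refl])
    fix b assume b: "b \<in> S"
    then have "S - (S - {b}) = {b}" by blast
    then show "koszul (S - {b}) (S - (S - {b})) * F (S - {b}) z * lin N w (S - (S - {b})) z =
        koszul (S - {b}) {b} * F (S - {b}) z * w b z"
      using b S by (simp add: lin_singleton subset_iff)
  qed
  finally show ?thesis .
qed

subsection \<open>Poisson brackets with functions of the base and with linear functions\<close>

text \<open>Functions of the base coordinates \<open>x\<^sup>i\<close>, \<open>i < n\<close>, are written as compositions with \<open>trunc n\<close>.\<close>

lemma trunc_upd: "i < n \<Longrightarrow> trunc n (z(i := t)) = (trunc n z)(i := t)"
  by (auto simp: trunc_def fun_eq_iff)

lemma trunc_upd_momentum [simp]: "trunc n (z(n + i := t)) = trunc n z"
  by (auto simp: trunc_def fun_eq_iff)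

lemma trunc_trunc [simp]: "trunc n (trunc n z) = trunc n z"
  by (auto simp: trunc_def fun_eq_iff)

lemma partial_trunc: "i < n \<Longrightarrow> partial i (\<lambda>z. g (trunc n z)) z = partial i g (trunc n z)"
  by (simp add: partial_def trunc_upd) (simp add: trunc_def)

lemma partial_trunc_momentum [simp]: "partial (n + i) (\<lambda>z. g (trunc n z)) z = 0"
  by (simp add: partial_def)

lemma superfun_sum_apply: "(\<Sum>i\<in>I. F i :: superfun) S z = (\<Sum>i\<in>I. F i S z)"
  by (simp add: sum_fun_apply)

lemma poisson_apply:
  "poisson n r F G S z =
    (\<Sum>i<n. (partial_even (n + i) F \<odot> partial_even i G - partial_even i F \<odot> partial_even (n + i) G) S z) +
    (\<Sum>a<r. (right_odd (r + a) F \<odot> left_odd a G + right_odd a F \<odot> left_odd (r + a) G) S z)"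
  by (simp add: poisson_def superfun_sum_apply)

lemma smult_zero_right: "(\<And>T. T \<subseteq> S \<Longrightarrow> G T z = 0) \<Longrightarrow> (F \<odot> G) S z = 0"
  by (simp add: smult_def)

lemma poisson_base:
  assumes S: "S \<subseteq> {..<2 * r}"
  shows "poisson n r F (base_fun (\<lambda>z. g (trunc n z))) S z =
    (\<Sum>i<n. partial (n + i) (F S) z * partial i g (trunc n z))"
proof -
  have fin: "finite S" using S finite_subset by blast
  have pe: "partial_even j (base_fun h) = base_fun (partial j h)" for j h
    by (intro ext) (simp add: partial_even_def base_fun_def[abs_def] partial_zero)
  have lo: "left_odd b (base_fun h) = (\<lambda>S z. 0)" for b h
    by (intro ext) (simp add: left_odd_def base_fun_def)
  have "(partial_even (n + i) F \<odot> partial_even i (base_fun (\<lambda>z. g (trunc n z)))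
      - partial_even i F \<odot> partial_even (n + i) (base_fun (\<lambda>z. g (trunc n z)))) S z =
      partial (n + i) (F S) z * partial i g (trunc n z)" if "i < n" for i
    unfolding pe using fin that by (simp add: smult_base partial_trunc partial_even_def)
  moreover have "(right_odd b F \<odot> left_odd b' (base_fun (\<lambda>z. g (trunc n z)))) S z = 0" for b b'
    unfolding lo by (rule smult_zero_right) simp
  ultimately show ?thesis
    unfolding poisson_apply by simp
qed

text \<open>The odd derivatives of the linear function are functions of the base, and its \<open>x\<^sup>*\<close>-derivatives vanish, so
  only the \<open>x\<^sup>*\<close>-derivatives and the right odd derivatives of \<open>F\<close> contribute.\<close>

lemma poisson_lin:
  assumes S: "S \<subseteq> {..<2 * r}"
  shows "poisson n r F (lin (2 * r) (\<lambda>b z. w b (trunc n z))) S z =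
    (\<Sum>b\<in>S. koszul (S - {b}) {b} * (\<Sum>i<n. partial (n + i) (F (S - {b})) z * partial i (w b) (trunc n z)))
    + (\<Sum>a<r. right_odd (r + a) F S z * w a (trunc n z) + right_odd a F S z * w (r + a) (trunc n z))"
proof -
  let ?W = "\<lambda>b z. w b (trunc n z)"
  have fin: "finite S" using S finite_subset by blast
  have even: "(partial_even (n + i) F \<odot> partial_even i (lin (2 * r) ?W)
      - partial_even i F \<odot> partial_even (n + i) (lin (2 * r) ?W)) S z =
      (\<Sum>b\<in>S. koszul (S - {b}) {b} * (partial (n + i) (F (S - {b})) z * partial i (w b) (trunc n z)))"
    if "i < n" for i
    unfolding partial_even_lin
    using that by (simp add: smult_lin[OF S] partial_trunc partial_even_def mult.assoc)
  have odd: "(right_odd (r + a) F \<odot> left_odd a (lin (2 * r) ?W) + right_odd a F \<odot> left_odd (r + a) (lin (2 * r) ?W)) S z =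
      right_odd (r + a) F S z * w a (trunc n z) + right_odd a F S z * w (r + a) (trunc n z)" if "a < r" for a
    using that fin by (simp add: left_odd_lin smult_base)
  have "poisson n r F (lin (2 * r) ?W) S z =
     (\<Sum>i<n. \<Sum>b\<in>S. koszul (S - {b}) {b} * (partial (n + i) (F (S - {b})) z * partial i (w b) (trunc n z)))
    + (\<Sum>a<r. right_odd (r + a) F S z * w a (trunc n z) + right_odd a F S z * w (r + a) (trunc n z))"
    unfolding poisson_apply
    by (rule arg_cong2[where f = "(+)"]; rule sum.cong) (use even odd in simp_all)
  then show ?thesis by (subst (asm) sum.swap) (simp add: sum_distrib_left)
qed

lemma right_odd_empty: "right_odd b F {} z = F {b} z"
  by (simp add: right_odd_def)

lemma right_odd_singleton:
  "right_odd b F {k} z = (if b = k then 0 else (if b < k then -1 else 1) * F {k, b} z)"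
proof -
  have "{j \<in> {k}. b < j} = (if b < k then {k} else {})" by auto
  then show ?thesis by (simp add: right_odd_def insert_commute)
qed

lemma right_odd_pair:
  assumes "k \<noteq> l"
  shows "right_odd b F {k, l} z =
    (if b = k \<or> b = l then 0 else (if b < k then -1 else 1) * (if b < l then -1 else 1) * F {k, l, b} z)"
proof -
  have "{j \<in> {k, l}. b < j} = (if b < k then {k} else {}) \<union> (if b < l then {l} else {})" by auto
  moreover have "{k, l, b} = insert b {k, l}" by auto
  ultimately show ?thesis using assms by (simp add: right_odd_def)
qed

text \<open>Here the first factor has no \<open>x\<^sup>*\<close>-derivatives either, so only the odd part of the bracket is left.\<close>

lemma poisson_lin_lin:
  assumes S: "S \<subseteq> {..<2 * r}"
  shows "poisson n r (lin (2 * r) (\<lambda>b z. u b (trunc n z))) (lin (2 * r) (\<lambda>b z. w b (trunc n z))) S z =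
    (if S = {} then \<Sum>a<r. u (r + a) (trunc n z) * w a (trunc n z) + u a (trunc n z) * w (r + a) (trunc n z) else 0)"
proof -
  have 0: "partial (n + i) (lin (2 * r) (\<lambda>b z. u b (trunc n z)) T) z = 0" for i T
  proof -
    have "partial (n + i) (lin (2 * r) (\<lambda>b z. u b (trunc n z)) T) z =
        partial_even (n + i) (lin (2 * r) (\<lambda>b z. u b (trunc n z))) T z" by (simp add: partial_even_def)
    moreover have "lin (2 * r) (\<lambda>b. partial (n + i) (\<lambda>z. u b (trunc n z))) T z = 0"
      unfolding lin_def by (rule sum.neutral) simp
    ultimately show ?thesis unfolding partial_even_lin by simp
  qed
  have "(\<Sum>a<r. right_odd (r + a) (lin (2 * r) (\<lambda>b z. u b (trunc n z))) S z * w a (trunc n z)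
      + right_odd a (lin (2 * r) (\<lambda>b z. u b (trunc n z))) S z * w (r + a) (trunc n z)) =
      (\<Sum>a<r. if S = {} then u (r + a) (trunc n z) * w a (trunc n z) + u a (trunc n z) * w (r + a) (trunc n z) else 0)"
    by (rule sum.cong) (auto simp: right_odd_lin base_fun_def)
  then show ?thesis unfolding poisson_lin[OF S] 0 by simp
qed

subsection \<open>Brackets with a generating function\<close>

text \<open>The functions \<open>h\<^bsub>d_A\<^esub>\<close>, \<open>L\<^sup>* h\<^bsub>d_A*\<^esub>\<close> and their sum have the form
  \<open>\<Sum> \<alpha> b i x\<^sup>*\<^sub>i \<zeta>\<^sub>b + 1/6 \<Sum> K k l d \<zeta>\<^sub>k \<zeta>\<^sub>l \<zeta>\<^sub>d\<close> over each base point \<open>x\<close>, with \<open>K\<close> alternating. The locale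
  fixes one base point: in the brackets below, \<open>x\<close>-derivatives of \<open>\<alpha>\<close> and \<open>K\<close> are multiplied by
  \<open>x\<^sup>*\<close>-derivatives of functions that do not depend on \<open>x\<^sup>*\<close>.\<close>

definition sgn3 :: "nat \<Rightarrow> nat \<Rightarrow> nat \<Rightarrow> real"
  where "sgn3 k l d = (if l < k then -1 else 1) * (if d < k then -1 else 1) * (if d < l then -1 else 1)"

locale cubic_function =
  fixes n r :: nat and \<theta> :: superfun and x :: "nat \<Rightarrow> real"
    and \<alpha> :: "nat \<Rightarrow> nat \<Rightarrow> real" and K :: "nat \<Rightarrow> nat \<Rightarrow> nat \<Rightarrow> real"
  assumes degree_one: "b < 2 * r \<Longrightarrow> trunc n z = x \<Longrightarrow> \<theta> {b} z = (\<Sum>i<n. \<alpha> b i * z (n + i))"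
    and degree_three: "k < 2 * r \<Longrightarrow> l < 2 * r \<Longrightarrow> d < 2 * r \<Longrightarrow> distinct [k, l, d] \<Longrightarrow> trunc n z = x \<Longrightarrow>
      sgn3 k l d * \<theta> {k, l, d} z = K k l d"
    and degree_other: "S \<subseteq> {..<2 * r} \<Longrightarrow> card S \<noteq> 1 \<Longrightarrow> card S \<noteq> 3 \<Longrightarrow> trunc n z = x \<Longrightarrow> \<theta> S z = 0"
    and K_swap: "k < 2 * r \<Longrightarrow> l < 2 * r \<Longrightarrow> d < 2 * r \<Longrightarrow> K l k d = - K k l d"
    and K_diag: "k < 2 * r \<Longrightarrow> l < 2 * r \<Longrightarrow> K k l k = 0" "k < 2 * r \<Longrightarrow> l < 2 * r \<Longrightarrow> K k l l = 0"
begin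

text \<open>Along the line in direction \<open>x\<^sup>*\<^sub>i\<close> the function is affine with slope \<open>c i\<close>.\<close>

lemma partial_linear:
  assumes "i < n" "\<And>t. F (z(n + i := t)) = (\<Sum>j<n. c j * (z(n + i := t)) (n + j))"
  shows "partial (n + i) F z = c i"
proof -
  have "F (z(n + i := t)) = c i * t + (\<Sum>j\<in>{..<n} - {i}. c j * z (n + j))" for t
  proof -
    have "(\<Sum>j<n. c j * (z(n + i := t)) (n + j)) =
        c i * t + (\<Sum>j\<in>{..<n} - {i}. c j * (z(n + i := t)) (n + j))"
      using assms(1) by (subst sum.remove[of _ i]) auto
    also have "(\<Sum>j\<in>{..<n} - {i}. c j * (z(n + i := t)) (n + j)) = (\<Sum>j\<in>{..<n} - {i}. c j * z (n + j))"
      by (rule sum.cong) auto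
    finally show ?thesis using assms(2) by simp
  qed
  then have "(\<lambda>t. F (z(n + i := t))) = (\<lambda>t. c i * t + (\<Sum>j\<in>{..<n} - {i}. c j * z (n + j)))" by blast
  then show ?thesis unfolding partial_def by (auto intro!: DERIV_imp_deriv derivative_eq_intros)
qed

lemma partial_fibre_const:
  assumes z: "trunc n z = x" and "\<And>z. trunc n z = x \<Longrightarrow> F z = c"
  shows "partial (n + i) F z = 0"
proof -
  have "(\<lambda>t. F (z(n + i := t))) = (\<lambda>t. c)" using assms by simp
  then show ?thesis unfolding partial_def by simp
qed

lemma partial_degree_one:
  assumes "b < 2 * r" "i < n" "trunc n z = x"
  shows "partial (n + i) (\<theta> {b}) z = \<alpha> b i"
  by (rule partial_linear[OF assms(2)]) (rule degree_one, use assms in auto)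

lemma theta_fibre_const:
  assumes S: "S \<subseteq> {..<2 * r}" "card S \<noteq> 1"
  shows "\<exists>c. \<forall>z. trunc n z = x \<longrightarrow> \<theta> S z = c"
proof (cases "card S = 3")
  case True
  then obtain k l d where kld: "S = {k, l, d}" "distinct [k, l, d]"
    by (auto simp: card_3_iff)
  have "\<theta> S z = K k l d / sgn3 k l d" if "trunc n z = x" for z
    using degree_three[of k l d z] kld S that by (simp add: sgn3_def split: if_splits)
  then show ?thesis by blast
next
  case False
  then show ?thesis using degree_other[OF S] by blast
qed

lemma partial_theta:
  assumes S: "S \<subseteq> {..<2 * r}" "card S \<noteq> 1" and z: "trunc n z = x"
  shows "partial (n + i) (\<theta> S) z = 0"
  using theta_fibre_const[OF S] partial_fibre_const[OF z] by metis

lemma poisson_theta_base: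
  assumes S: "S \<subseteq> {..<2 * r}" and z: "trunc n z = x"
  shows "poisson n r \<theta> (base_fun (\<lambda>z. g (trunc n z))) S z =
    (if card S = 1 then \<Sum>i<n. \<alpha> (the_elem S) i * partial i g x else 0)"
proof (cases "card S = 1")
  case True
  then obtain b where b: "S = {b}" using card_1_singletonE by blast
  then have "partial (n + i) (\<theta> S) z = \<alpha> b i" if "i < n" for i using S z that by (simp add: partial_degree_one)
  then show ?thesis unfolding poisson_base[OF S] using z by (simp add: b)
next
  case False
  then show ?thesis by (simp add: poisson_base[OF S] partial_theta[OF S False z] z)
qed

context
  fixes u w :: "nat \<Rightarrow> (nat \<Rightarrow> real) \<Rightarrow> real"
begin

definition \<Phi>2 :: "nat \<Rightarrow> nat \<Rightarrow> real"
  where "\<Phi>2 k l = (\<Sum>i<n. \<alpha> k i * partial i (u l) x - \<alpha> l i * partial i (u k) x) +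
    (\<Sum>a<r. K k l (r + a) * u a x + K k l a * u (r + a) x)"

lemma right_odd_theta_pair:
  assumes "k < 2 * r" "l < 2 * r" "d < 2 * r" "k \<noteq> l" "trunc n z = x"
  shows "right_odd d \<theta> {k, l} z = (if l < k then -1 else 1) * K k l d"
  using degree_three[OF assms(1-3) _ assms(5)] K_diag(1)[OF assms(1,2)] K_diag(2)[OF assms(1,2)] assms(4)
  by (auto simp: right_odd_pair sgn3_def)

lemma bracket_degree_zero:
  assumes z: "trunc n z = x"
  shows "(poisson n r \<theta> (lin (2 * r) (\<lambda>b z. u b (trunc n z)))) {} z = (\<Sum>i<n. (\<Sum>a<r. \<alpha> (r + a) i * u a x + \<alpha> a i * u (r + a) x) * z (n + i))"
proof -
  have "(poisson n r \<theta> (lin (2 * r) (\<lambda>b z. u b (trunc n z)))) {} z = (\<Sum>a<r. (\<Sum>i<n. \<alpha> (r + a) i * z (n + i)) * u a x + (\<Sum>i<n. \<alpha> a i * z (n + i)) * u (r + a) x)"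
    using z by (simp add: poisson_lin right_odd_empty degree_one)
  also have "\<dots> = (\<Sum>a<r. \<Sum>i<n. (\<alpha> (r + a) i * u a x + \<alpha> a i * u (r + a) x) * z (n + i))"
    by (rule sum.cong[OF refl]) (simp add: sum_distrib_right sum_distrib_left sum.distrib algebra_simps)
  also have "\<dots> = (\<Sum>i<n. (\<Sum>a<r. \<alpha> (r + a) i * u a x + \<alpha> a i * u (r + a) x) * z (n + i))"
    by (subst sum.swap) (simp add: sum_distrib_right)
  finally show ?thesis .
qed

text \<open>\<open>\<Phi>2\<close> is antisymmetric; the sign refers to the order of \<open>k\<close> and \<open>l\<close> in the monomial.\<close>

lemma bracket_degree_two:
  assumes kl: "k < 2 * r" "l < 2 * r" "k \<noteq> l" and z: "trunc n z = x"
  shows "(poisson n r \<theta> (lin (2 * r) (\<lambda>b z. u b (trunc n z)))) {k, l} z = (if l < k then -1 else 1) * \<Phi>2 k l"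
proof -
  have S: "{k, l} \<subseteq> {..<2 * r}" using kl by auto
  have d: "{k, l} - {k} = {l}" "{k, l} - {l} = {k}" using kl by auto
  have k1: "koszul {l} {k} = (if k < l then -1 else 1)" "koszul {k} {l} = (if l < k then -1 else 1)"
  proof -
    have "{i \<in> {l}. k < i} = (if k < l then {l} else {})" "{i \<in> {k}. l < i} = (if l < k then {k} else {})" by auto
    then show "koszul {l} {k} = (if k < l then -1 else 1)" "koszul {k} {l} = (if l < k then -1 else 1)"
      by (simp_all add: koszul_singleton_right)
  qed
  have "(poisson n r \<theta> (lin (2 * r) (\<lambda>b z. u b (trunc n z)))) {k, l} z =
    (if k < l then -1 else 1) * (\<Sum>i<n. \<alpha> l i * partial i (u k) x)
    + (if l < k then -1 else 1) * (\<Sum>i<n. \<alpha> k i * partial i (u l) x)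
    + (\<Sum>a<r. (if l < k then -1 else 1) * K k l (r + a) * u a x + (if l < k then -1 else 1) * K k l a * u (r + a) x)"
    using kl z by (simp add: poisson_lin[OF S] d k1 partial_degree_one right_odd_theta_pair)
  also have "\<dots> = (if l < k then -1 else 1) * \<Phi>2 k l"
    using kl(3) unfolding \<Phi>2_def
    by (cases "l < k") (auto simp: sum_subtractf sum_distrib_left sum_negf algebra_simps sum.distrib)
  finally show ?thesis .
qed

lemma \<Phi>2_diag: "k < 2 * r \<Longrightarrow> \<Phi>2 k k = 0"
proof -
  assume k: "k < 2 * r"
  have "K k k d = 0" if "d < 2 * r" for d using K_swap[OF k k that] by simp
  then show ?thesis by (simp add: \<Phi>2_def)
qed

text \<open>The \<open>x\<^sup>*\<close>-derivatives of \<open>\<theta>\<close> have degree one and its odd derivatives have degrees zero and two.\<close>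

lemma bracket_degree_other:
  assumes S: "S \<subseteq> {..<2 * r}" "card S \<noteq> 0" "card S \<noteq> 2" and z: "trunc n z = x"
  shows "(poisson n r \<theta> (lin (2 * r) (\<lambda>b z. u b (trunc n z)))) S z = 0"
proof -
  have fin: "finite S" using S(1) finite_subset by blast
  have "partial (n + i) (\<theta> (S - {b})) z = 0" if "b \<in> S" for b i
    by (rule partial_theta) (use S that z fin in \<open>auto simp: card_Diff_singleton\<close>)
  moreover have "right_odd b \<theta> S z = 0" if b: "b < 2 * r" for b
  proof (cases "b \<in> S")
    case False
    have "\<theta> (insert b S) z = 0"
      by (rule degree_other) (use S b z fin False in auto)
    then show ?thesis by (simp add: right_odd_def)
  qed (simp add: right_odd_def)
  ultimately show ?thesis by (simp add: poisson_lin[OF S(1)])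
qed

text \<open>The three kinds of terms are those of the bracket on \<open>E\<close>: anchors applied to
  components, the symmetric term through \<open>\<D>\<close>, and structure functions.\<close>

lemma iterated_bracket:
  assumes S: "S \<subseteq> {..<2 * r}" and z: "trunc n z = x"
  shows "poisson n r (poisson n r \<theta> (lin (2 * r) (\<lambda>b z. u b (trunc n z)))) (lin (2 * r) (\<lambda>b z. w b (trunc n z))) S z =
    (if card S = 1 then
      (\<Sum>i<n. (\<Sum>a<r. \<alpha> (r + a) i * u a x + \<alpha> a i * u (r + a) x) * partial i (w (the_elem S)) x)
      + (\<Sum>a<r. \<Phi>2 (the_elem S) (r + a) * w a x + \<Phi>2 (the_elem S) a * w (r + a) x)
     else 0)"
proof (cases "card S = 1")
  case True
  then obtain l where l: "S = {l}" using card_1_singletonE by blast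
  have lr: "l < 2 * r" using S l by simp
  have p: "partial (n + i) ((poisson n r \<theta> (lin (2 * r) (\<lambda>b z. u b (trunc n z)))) {}) z = (\<Sum>a<r. \<alpha> (r + a) i * u a x + \<alpha> a i * u (r + a) x)" if "i < n" for i
    by (rule partial_linear[OF that]) (rule bracket_degree_zero, simp add: z)
  have o: "right_odd b (poisson n r \<theta> (lin (2 * r) (\<lambda>b z. u b (trunc n z)))) {l} z = \<Phi>2 l b" if b: "b < 2 * r" for b
    using bracket_degree_two[OF lr b _ z] \<Phi>2_diag[OF lr] by (auto simp: right_odd_singleton)
  show ?thesis using S lr by (simp add: l poisson_lin p o z)
next
  case False
  have fin: "finite S" using S(1) finite_subset by blast
  have "partial (n + i) ((poisson n r \<theta> (lin (2 * r) (\<lambda>b z. u b (trunc n z)))) (S - {b})) z = 0" if b: "b \<in> S" for b i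
  proof -
    have sub: "S - {b} \<subseteq> {..<2 * r}" using S by blast
    show ?thesis
    proof (cases "card (S - {b}) = 2")
      case True
      then obtain k l where kl: "S - {b} = {k, l}" "k \<noteq> l" by (auto simp: card_2_iff)
      then have "k < 2 * r" "l < 2 * r" using sub by auto
      then show ?thesis
        using partial_fibre_const[OF z, of "(poisson n r \<theta> (lin (2 * r) (\<lambda>b z. u b (trunc n z)))) (S - {b})"] bracket_degree_two[of k l] kl by metis
    next
      case F2: False
      have "card (S - {b}) \<noteq> 0"
      proof
        assume "card (S - {b}) = 0"
        then have "S - {b} = {}" using fin by (simp only: card_0_eq finite_Diff)
        then have "S = {b}" using b by blast
        then show False using False by simp
      qed
      then show ?thesis
        using partial_fibre_const[OF z, of "(poisson n r \<theta> (lin (2 * r) (\<lambda>b z. u b (trunc n z)))) (S - {b})"] bracket_degree_other[OF sub _ F2] by metis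
    qed
  qed
  moreover have "right_odd b (poisson n r \<theta> (lin (2 * r) (\<lambda>b z. u b (trunc n z)))) S z = 0" if b: "b < 2 * r" for b
  proof (cases "b \<in> S")
    case bS: False
    have "(poisson n r \<theta> (lin (2 * r) (\<lambda>b z. u b (trunc n z)))) (insert b S) z = 0"
      by (rule bracket_degree_other) (use S b z fin False bS in auto)
    then show ?thesis by (simp add: right_odd_def)
  qed (simp add: right_odd_def)
  ultimately show ?thesis using False by (simp add: poisson_lin[OF S])
qed

end

end

section \<open>The hamiltonian lifts in coordinates\<close>

lemma finite_subset_lessThan: "S \<subseteq> {..<k::nat} \<Longrightarrow> finite S"
  by (rule finite_subset) auto

lemma sum_if: "(\<Sum>i\<in>I. if P then f i else 0) = (if P then \<Sum>i\<in>I. f i else 0)"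
  by simp

text \<open>The coordinates \<open>\<zeta>\<^sub>r\<^sub>+\<^sub>m\<close> come after all \<open>\<zeta>\<^sub>b\<close> with \<open>b < r\<close>, so multiplying by them from the right produces no
  sign.\<close>

lemma (in algebroid_on) ham_lift_eval:
  assumes ch: "(U, \<phi>) \<in> charts M" and fr: "(V, e) \<in> frames A"
    and z: "trunc (mdim M) z \<in> \<phi> ` (U \<inter> V)" and x: "x = inv_into U \<phi> (trunc (mdim M) z)"
    and C: "structure_fun e x C" and S: "finite S"
  shows "ham_lift M A (lie_d M A a br) ((U, \<phi>), (V, e)) S z =
    (if S \<subseteq> {..<brank A} \<and> card S = 1 then \<Sum>i<mdim M. a x (e (the_elem S) x) (\<lambda>y. \<phi> y i) * z (mdim M + i) else 0)
    + (\<Sum>m<brank A. if brank A + m \<in> S \<and> S - {brank A + m} \<subseteq> {..<brank A} \<and> card (S - {brank A + m}) = 2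
        then - C (Min (S - {brank A + m})) (Max (S - {brank A + m})) m else 0)"
proof -
  let ?n = "mdim M" and ?r = "brank A" and ?c = "((U, \<phi>), (V, e))" and ?v = "lie_d M A a br"
  let ?\<pi> = "pullback ?r (trunc ?n) ocoord"
  have C': "structure_fun e (inv_into U \<phi> (trunc ?n z)) C" using C x by simp
  have 1: "(?\<pi> (vf_apply M A ?v ?c (ecoord i)) \<odot> ecoord (?n + i)) S z =
      (if S \<subseteq> {..<?r} \<and> card S = 1 then a x (e (the_elem S) x) (\<lambda>y. \<phi> y i) * z (?n + i) else 0)"
    if i: "i < ?n" for i
    using vf_apply_even[OF ch fr z i, of S] by (simp add: smult_base S pullback_ocoord x)
  have 2: "(?\<pi> (vf_apply M A ?v ?c (ocoord m)) \<odot> ocoord (?r + m)) S z =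
      (if ?r + m \<in> S \<and> S - {?r + m} \<subseteq> {..<?r} \<and> card (S - {?r + m}) = 2
        then - C (Min (S - {?r + m})) (Max (S - {?r + m})) m else 0)"
    if m: "m < ?r" for m
  proof -
    have "koszul (S - {?r + m}) {?r + m} = 1" if "S - {?r + m} \<subseteq> {..<?r}"
    proof -
      have "{i \<in> S - {?r + m}. ?r + m < i} = {}" using that by auto
      then show ?thesis by (simp only: koszul_singleton_right card.empty power_0)
    qed
    then show ?thesis
      using vf_apply_odd[OF ch fr z C' m, of "S - {?r + m}"] by (simp add: smult_ocoord S pullback_ocoord)
  qed
  have "ham_lift M A ?v ?c S z =
    (\<Sum>i<?n. (?\<pi> (vf_apply M A ?v ?c (ecoord i)) \<odot> ecoord (?n + i)) S z) +
    (\<Sum>m<?r. (?\<pi> (vf_apply M A ?v ?c (ocoord m)) \<odot> ocoord (?r + m)) S z)"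
    unfolding ham_lift_def Let_def by (simp add: superfun_sum_apply)
  also have "\<dots> = (\<Sum>i<?n. if S \<subseteq> {..<?r} \<and> card S = 1 then a x (e (the_elem S) x) (\<lambda>y. \<phi> y i) * z (?n + i) else 0)
    + (\<Sum>m<?r. if ?r + m \<in> S \<and> S - {?r + m} \<subseteq> {..<?r} \<and> card (S - {?r + m}) = 2
        then - C (Min (S - {?r + m})) (Max (S - {?r + m})) m else 0)"
    by (intro arg_cong2[where f = "(+)"] sum.cong refl) (use 1 2 in \<open>simp_all only: lessThan_iff\<close>)
  finally show ?thesis unfolding sum_if .
qed

context algebroid_on
begin

context
  fixes U \<phi> V e z x C
  assumes ch: "(U, \<phi>) \<in> charts M" and fr: "(V, e) \<in> frames A"
    and z: "trunc (mdim M) z \<in> \<phi> ` (U \<inter> V)" and x: "x = inv_into U \<phi> (trunc (mdim M) z)"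
    and C: "structure_fun e x C"
begin

lemma ham_lift_anchor:
  assumes b: "b < brank A"
  shows "ham_lift M A (lie_d M A a br) ((U, \<phi>), (V, e)) {b} z = (\<Sum>i<mdim M. a x (e b x) (\<lambda>y. \<phi> y i) * z (mdim M + i))"
  using b by (simp add: ham_lift_eval[OF ch fr z x C])

text \<open>Monomials are indexed by sets, hence the minimum and maximum of \<open>p\<close> and \<open>q\<close> in the coefficient;
  the antisymmetry of \<open>C\<close> turns them into a sign.\<close>

lemma ham_lift_structure:
  assumes p: "p < brank A" "q < brank A" "p \<noteq> q" "m < brank A"
  shows "ham_lift M A (lie_d M A a br) ((U, \<phi>), (V, e)) {p, q, brank A + m} z = (if p < q then 1 else -1) * (- C p q m)"
proof -
  let ?S = "{p, q, brank A + m}"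
  have d: "?S - {brank A + m} = {p, q}" using p by auto
  have card: "card ?S = 3" using p by auto
  have "(\<Sum>k<brank A. if brank A + k \<in> ?S \<and> ?S - {brank A + k} \<subseteq> {..<brank A} \<and> card (?S - {brank A + k}) = 2
        then - C (Min (?S - {brank A + k})) (Max (?S - {brank A + k})) k else 0) =
     (\<Sum>k<brank A. if k = m then - C (Min {p, q}) (Max {p, q}) m else 0)"
    by (rule sum.cong) (use p d in auto)
  also have "\<dots> = - C (Min {p, q}) (Max {p, q}) m" using p by simp
  also have "\<dots> = (if p < q then 1 else -1) * (- C p q m)"
    using p(3) structure_fun_antisym[OF C, of q p m] by (auto simp: min_def max_def)
  finally show ?thesis
    unfolding ham_lift_eval[OF ch fr z x C finite.insertI[OF finite.insertI[OF finite.insertI[OF finite.emptyI]]]]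
    by (simp add: card)
qed

text \<open>A monomial of the lift has either one \<open>\<xi>\<close> or two of them and one \<open>\<xi>\<^sup>*\<close>.\<close>

lemma ham_lift_zero:
  assumes S: "S \<subseteq> {..<2 * brank A}"
    and "card S = 1 \<Longrightarrow> S \<inter> {..<brank A} = {}"
    and "card S = 3 \<Longrightarrow> card (S \<inter> {..<brank A}) \<noteq> 2"
  shows "ham_lift M A (lie_d M A a br) ((U, \<phi>), (V, e)) S z = 0"
proof -
  have fin: "finite S" using S by (rule finite_subset_lessThan)
  have "\<not> (S \<subseteq> {..<brank A} \<and> card S = 1)"
  proof
    assume "S \<subseteq> {..<brank A} \<and> card S = 1"
    then have "S = {}" using assms(2) by blast
    then show False using \<open>S \<subseteq> {..<brank A} \<and> card S = 1\<close> by simp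
  qed
  moreover have "\<not> (brank A + m \<in> S \<and> S - {brank A + m} \<subseteq> {..<brank A} \<and> card (S - {brank A + m}) = 2)" for m
  proof
    assume *: "brank A + m \<in> S \<and> S - {brank A + m} \<subseteq> {..<brank A} \<and> card (S - {brank A + m}) = 2"
    then have "S \<inter> {..<brank A} = S - {brank A + m}" by auto
    moreover have "card S = 3" using card_Suc_Diff1[OF fin, of "brank A + m"] * by simp
    ultimately show False using assms(3) * by simp
  qed
  ultimately show ?thesis unfolding ham_lift_eval[OF ch fr z x C fin]
    by (simp only: if_False sum.neutral_const add_0_right)
qed

end

end

subsection \<open>The Legendre transform\<close>

text \<open>The effect of the Legendre transform on indices: \<open>\<theta>\<^sub>a\<close> goes to \<open>\<xi>\<^sup>*\<^sub>a\<close> and \<open>\<theta>\<^sub>*\<^sup>a\<close> to \<open>\<xi>\<^sup>a\<close>.\<close>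

definition swap :: "nat \<Rightarrow> nat \<Rightarrow> nat"
  where "swap r b = (if b < r then r + b else b - r)"

lemma swap_swap [simp]: "b < 2 * r \<Longrightarrow> swap r (swap r b) = b"
  by (auto simp: swap_def)

lemma swap_less: "b < 2 * r \<Longrightarrow> swap r b < 2 * r"
  by (auto simp: swap_def)

lemma swap_image_swap: "T \<subseteq> {..<2 * r} \<Longrightarrow> swap r ` swap r ` T = T"
  by (force simp: image_image subset_iff)

text \<open>Only the monomial with index set \<open>swap r ` T\<close> is mapped to a multiple of \<open>\<zeta>\<^sup>T\<close>; the second factor is the
  sign that reordering produces.\<close>

lemma legendre_pull_eval:
  assumes T: "T \<subseteq> {..<2 * brank A}"
  shows "legendre_pull A G (k, (V, e)) T z =
    G (k, (V, dual_frame A e)) (swap (brank A) ` T) z *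
    foldr (\<odot>) (map ocoord (map (swap (brank A)) (sorted_list_of_set (swap (brank A) ` T)))) (base_fun (\<lambda>_. 1)) T z"
proof -
  let ?r = "brank A" and ?G = "G (k, (V, dual_frame A e))"
  have h: "map (\<lambda>b. if b < ?r then ocoord (?r + b) else ocoord (b - ?r)) xs = map ocoord (map (swap ?r) xs)" for xs
    by (auto simp: swap_def)
  have "legendre_pull A G (k, (V, e)) T z = (\<Sum>S\<in>Pow {..<2 * ?r}. ?G S z *
      foldr (\<odot>) (map ocoord (map (swap ?r) (sorted_list_of_set S))) (base_fun (\<lambda>_. 1)) T z)"
    unfolding legendre_pull_def pullback_def h by simp
  also have "\<dots> = (\<Sum>S\<in>Pow {..<2 * ?r}. if S = swap ?r ` T then ?G (swap ?r ` T) z *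
      foldr (\<odot>) (map ocoord (map (swap ?r) (sorted_list_of_set (swap ?r ` T)))) (base_fun (\<lambda>_. 1)) T z else 0)"
  proof (rule sum.cong[OF refl])
    fix S assume S: "S \<in> Pow {..<2 * ?r}"
    then have fin: "finite S" using finite_subset_lessThan by blast
    have "foldr (\<odot>) (map ocoord (map (swap ?r) (sorted_list_of_set S))) (base_fun (\<lambda>_. 1)) T z = 0"
      if "S \<noteq> swap ?r ` T"
    proof (rule ccontr)
      assume "\<not> ?thesis"
      then have "T = swap ?r ` S" using foldr_ocoord_support fin by fastforce
      then have "S = swap ?r ` T" using swap_image_swap[of S] S by simp
      then show False using that by simp
    qed
    then show "?G S z * foldr (\<odot>) (map ocoord (map (swap ?r) (sorted_list_of_set S))) (base_fun (\<lambda>_. 1)) T z =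
      (if S = swap ?r ` T then ?G (swap ?r ` T) z *
      foldr (\<odot>) (map ocoord (map (swap ?r) (sorted_list_of_set (swap ?r ` T)))) (base_fun (\<lambda>_. 1)) T z else 0)"
      by simp
  qed
  also have "\<dots> = ?G (swap ?r ` T) z *
      foldr (\<odot>) (map ocoord (map (swap ?r) (sorted_list_of_set (swap ?r ` T)))) (base_fun (\<lambda>_. 1)) T z"
    using T swap_less by (subst sum.delta) auto
  finally show ?thesis .
qed

lemma legendre_pull_singleton:
  assumes "b < 2 * brank A"
  shows "legendre_pull A G (k, (V, e)) {b} z = G (k, (V, dual_frame A e)) {swap (brank A) b} z"
  using assms by (simp add: legendre_pull_eval ocoord_smult base_fun_def)

text \<open>Reordering \<open>\<xi>\<^sup>*\<^sub>q \<xi>\<^sup>*\<^sub>m \<xi>\<^sup>p\<close> to \<open>\<xi>\<^sup>p \<xi>\<^sup>*\<^sub>q \<xi>\<^sup>*\<^sub>m\<close> takes two transpositions, hence produces no sign.\<close>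

lemma legendre_pull_triple:
  assumes p: "p < brank A" "q < brank A" "m < brank A" "q \<noteq> m"
  shows "legendre_pull A G (k, (V, e)) {p, brank A + q, brank A + m} z =
    G (k, (V, dual_frame A e)) {q, m, brank A + p} z"
proof -
  let ?r = "brank A"
  have *: "legendre_pull A G (k, (V, e)) {p, ?r + q, ?r + m} z = G (k, (V, dual_frame A e)) {q, m, ?r + p} z"
    if qm: "q < m" "m < ?r" for q m
  proof -
    have S: "swap ?r ` {p, ?r + q, ?r + m} = {q, m, ?r + p}" using p qm by (auto simp: swap_def)
    have l: "sorted_list_of_set {q, m, ?r + p} = [q, m, ?r + p]" using p qm by simp
    have s: "map (swap ?r) [q, m, ?r + p] = [?r + q, ?r + m, p]" using p qm by (simp add: swap_def)
    have d: "{p, ?r + q, ?r + m} - {?r + q} = {p, ?r + m}" "{p, ?r + m} - {?r + m} = {p}" using p qm by auto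
    have c1: "{j \<in> {p, ?r + m}. j < ?r + q} = {p}" "{j \<in> {p}. j < ?r + m} = {p}" using p qm by auto
    have k: "koszul {?r + q} {p, ?r + m} = -1" "koszul {?r + m} {p} = -1"
      unfolding koszul_singleton_left c1 by simp_all
    have "foldr (\<odot>) (map ocoord [?r + q, ?r + m, p]) (base_fun (\<lambda>_. 1)) {p, ?r + q, ?r + m} z = 1"
      using p by (simp add: ocoord_smult d k base_fun_def)
    then show ?thesis
      using legendre_pull_eval[of "{p, ?r + q, ?r + m}" A G k V e z] p qm unfolding S l s by simp
  qed
  show ?thesis
  proof (cases "q < m")
    case False
    then have "m < q" using p by simp
    then show ?thesis using *[of m q] p by (simp add: insert_commute)
  qed (use * p in simp)
qed

section \<open>Pairs of Lie algebroids in duality\<close>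

locale dual_algebroids = algebroid_on M A a br
  for M :: "'m::{t2_space, second_countable_topology} manifold" and A :: "('m, 'v::real_vector) vbundle"
    and a br +
  fixes a' br'
  assumes dual_algebroid: "lie_algebroid M (dual_bundle A) a' br'"
begin

sublocale dual: algebroid_on M "dual_bundle A" a' br'
  by (intro algebroid_on.intro dual_vbundle_on algebroid_on_axioms.intro dual_algebroid)

definition generator :: "('m, 'v) gfun"
  where "generator = ham_lift M A (lie_d M A a br)
    + legendre_pull A (ham_lift M (dual_bundle A) (lie_d M (dual_bundle A) a' br'))"

text \<open>The alternating function \<open>K\<close> with \<open>K p q (r + m) = - C p q m\<close> and \<open>K m (r + p) (r + q) = - C' p q m\<close>; the
  remaining cases are permutations of these two.\<close>

definition cubic :: "(nat \<Rightarrow> nat \<Rightarrow> nat \<Rightarrow> real) \<Rightarrow> (nat \<Rightarrow> nat \<Rightarrow> nat \<Rightarrow> real) \<Rightarrow> nat \<Rightarrow> nat \<Rightarrow> nat \<Rightarrow> real"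
  where "cubic C C' k l d = (let r = brank A in
    if k < r then
      if l < r then if d < r then 0 else - C k l (d - r)
      else if d < r then C k d (l - r) else - C' (l - r) (d - r) k
    else
      if l < r then if d < r then - C l d (k - r) else C' (k - r) (d - r) l
      else if d < r then - C' (k - r) (l - r) d else 0)"

text \<open>The derivative along the \<open>b\<close>-th element of the frame of \<open>E\<close> that is dual to the coordinates \<open>\<zeta>\<^sub>b\<close>.\<close>

definition anchor_of :: "(nat \<Rightarrow> 'm \<Rightarrow> 'v) \<Rightarrow> 'm \<Rightarrow> nat \<Rightarrow> ('m \<Rightarrow> real) \<Rightarrow> real"
  where "anchor_of e x b f =
    (if b < brank A then a x (e b x) f else a' x (dual_frame A e (b - brank A) x) f)"

context
  fixes U \<phi> V e x0 x C C'
  assumes ch: "(U, \<phi>) \<in> charts M" and fr: "(V, e) \<in> frames A" and x0: "x0 \<in> \<phi> ` (U \<inter> V)"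
    and x: "x = inv_into U \<phi> x0"
    and C: "structure_fun e x C" and C': "dual.structure_fun (dual_frame A e) x C'"
begin

lemma fr': "(V, dual_frame A e) \<in> frames (dual_bundle A)"
  using fr by auto

lemma generator_apply:
  "generator ((U, \<phi>), (V, e)) S z = ham_lift M A (lie_d M A a br) ((U, \<phi>), (V, e)) S z
    + legendre_pull A (ham_lift M (dual_bundle A) (lie_d M (dual_bundle A) a' br')) ((U, \<phi>), (V, e)) S z"
  unfolding generator_def by simp

text \<open>A monomial with three odd coordinates of which two are \<open>\<xi>\<close> comes from \<open>\<mu>\<close> alone, one with two \<open>\<xi>\<^sup>*\<close> from the
  Legendre transform of \<open>\<gamma>\<close> alone, and monomials with three of a kind do not occur.\<close>

lemma generator_cubic:
  "cubic_function (mdim M) (brank A) (generator ((U, \<phi>), (V, e))) x0 (\<lambda>b i. anchor_of e x b (\<lambda>y. \<phi> y i)) (cubic C C')"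
proof -
  let ?r = "brank A"
  have lift: "trunc (mdim M) z \<in> \<phi> ` (U \<inter> V)" "x = inv_into U \<phi> (trunc (mdim M) z)"
    if "trunc (mdim M) z = x0" for z using that x0 x by auto
  note h1 = ham_lift_anchor[OF ch fr lift C] and h3 = ham_lift_structure[OF ch fr lift C]
    and h0 = ham_lift_zero[OF ch fr lift C]
  note d1 = dual.ham_lift_anchor[OF ch fr' lift C', simplified]
    and d3 = dual.ham_lift_structure[OF ch fr' lift C', simplified]
    and d0 = dual.ham_lift_zero[OF ch fr' lift C', simplified]
  have t3a: "generator ((U, \<phi>), (V, e)) {p, q, ?r + m} z = (if p < q then 1 else -1) * (- C p q m)"
    if "p < ?r" "q < ?r" "p \<noteq> q" "m < ?r" "trunc (mdim M) z = x0" for p q m z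
  proof -
    have "{p, q, ?r + m} \<subseteq> {..<2 * ?r}" using that by auto
    moreover have im: "swap ?r ` {p, q, ?r + m} = {?r + p, ?r + q, m}" using that by (auto simp: swap_def)
    moreover have "{?r + p, ?r + q, m} \<inter> {..<?r} = {m}" "card {?r + p, ?r + q, m} = 3" using that by auto
    moreover from this have "ham_lift M (dual_bundle A) (lie_d M (dual_bundle A) a' br')
        ((U, \<phi>), (V, dual_frame A e)) {?r + p, ?r + q, m} z = 0"
      by (intro d0) (use that in auto)
    ultimately show ?thesis
      using h3[OF that(5) that(5) that(1-4)] by (simp add: generator_apply legendre_pull_eval)
  qed
  have t3b: "generator ((U, \<phi>), (V, e)) {p, ?r + q, ?r + m} z = (if q < m then 1 else -1) * (- C' q m p)"
    if "p < ?r" "q < ?r" "m < ?r" "q \<noteq> m" "trunc (mdim M) z = x0" for p q m z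
  proof -
    have i: "{p, ?r + q, ?r + m} \<inter> {..<?r} = {p}" and c3: "card {p, ?r + q, ?r + m} = 3" using that by auto
    have "ham_lift M A (lie_d M A a br) ((U, \<phi>), (V, e)) {p, ?r + q, ?r + m} z = 0"
      by (rule h0[OF that(5) that(5)]) (use that c3 in \<open>simp_all only: i c3, auto\<close>)
    then show ?thesis
      using d3[OF that(5) that(5) that(2,3,4,1)] legendre_pull_triple[OF that(1-4)]
      by (simp add: generator_apply)
  qed
  have t3c: "generator ((U, \<phi>), (V, e)) S z = 0"
    if S: "S \<subseteq> {..<?r} \<or> S \<subseteq> {?r..<2 * ?r}" "card S = 3" and z: "trunc (mdim M) z = x0" for S z
  proof -
    have S2: "S \<subseteq> {..<2 * ?r}" using S by auto
    have fin: "finite S" using finite_subset_lessThan[OF S2] .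
    have inj: "inj_on (swap ?r) S" using swap_swap S2 by (intro inj_on_inverseI[of _ "swap ?r"]) auto
    have c: "card (swap ?r ` S) = 3" using card_image[OF inj] S by simp
    have i: "S \<inter> {..<?r} = {} \<or> S \<inter> {..<?r} = S" "swap ?r ` S \<inter> {..<?r} = {} \<or> swap ?r ` S \<inter> {..<?r} = swap ?r ` S"
      using S by (auto simp: swap_def)
    have "ham_lift M A (lie_d M A a br) ((U, \<phi>), (V, e)) S z = 0"
      by (rule h0[OF z z S2]) (use i(1) S in auto)
    moreover have "ham_lift M (dual_bundle A) (lie_d M (dual_bundle A) a' br')
        ((U, \<phi>), (V, dual_frame A e)) (swap ?r ` S) z = 0"
      by (rule d0[OF z z]) (use i(2) c S2 swap_less in auto)
    ultimately show ?thesis using legendre_pull_eval[OF S2] by (simp add: generator_apply)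
  qed
  note as = structure_fun_antisym[OF C] and as' = dual.structure_fun_antisym[OF C']
  have diag: "C p p m = 0" "C' p p m = 0" for p m using as[of p p m] as'[of p p m] by simp_all
  show ?thesis
  proof (unfold_locales, goal_cases)
    case (1 b z)
    show ?case
    proof (cases "b < ?r")
      case True
      have "ham_lift M (dual_bundle A) (lie_d M (dual_bundle A) a' br')
        ((U, \<phi>), (V, dual_frame A e)) {?r + b} z = 0"
        by (rule d0[OF 1(2) 1(2)]) (use True in auto)
      then show ?thesis
        using h1[OF 1(2) 1(2) True] legendre_pull_singleton[OF 1(1)] True
        by (simp add: generator_apply anchor_of_def swap_def)
    next
      case False
      have "ham_lift M A (lie_d M A a br) ((U, \<phi>), (V, e)) {b} z = 0"
        by (rule h0[OF 1(2) 1(2)]) (use False 1(1) in auto)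
      moreover have "b - ?r < ?r" using False 1(1) by simp
      ultimately show ?thesis
        using d1[OF 1(2) 1(2), of "b - ?r"] legendre_pull_singleton[OF 1(1)] False
        by (simp add: generator_apply anchor_of_def swap_def)
    qed
  next
    case (2 k l d z)
    \<comment> \<open>the types of the three indices; up to reordering only four essentially different cases\<close>
    consider (A1) "k < ?r" "l < ?r" "d < ?r" | (A2) m where "k < ?r" "l < ?r" "d = ?r + m" "m < ?r"
      | (A3) m where "k < ?r" "l = ?r + m" "m < ?r" "d < ?r"
      | (A4) m where "k = ?r + m" "m < ?r" "l < ?r" "d < ?r"
      | (A5) p q where "k < ?r" "l = ?r + p" "d = ?r + q" "p < ?r" "q < ?r"
      | (A6) p q where "l < ?r" "k = ?r + p" "d = ?r + q" "p < ?r" "q < ?r"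
      | (A7) p q where "d < ?r" "k = ?r + p" "l = ?r + q" "p < ?r" "q < ?r"
      | (A8) "\<not> k < ?r" "\<not> l < ?r" "\<not> d < ?r"
    proof -
      have ge: "b < ?r \<or> (\<exists>m<?r. b = ?r + m)" if "b < 2 * ?r" for b
        using that by (cases "b < ?r") (auto intro!: exI[of _ "b - ?r"])
      show ?thesis
        using ge[OF 2(1)] ge[OF 2(2)] ge[OF 2(3)] that by (elim disjE exE conjE) auto
    qed
    then show ?case
    proof cases
      case A1
      then show ?thesis using t3c[of "{k, l, d}" z] 2 by (simp add: cubic_def)
    next
      case A2
      then show ?thesis using t3a[of k l m z] 2 by (auto simp: cubic_def sgn3_def)
    next
      case A3
      have s: "{k, l, d} = {k, d, l}" by auto
      show ?thesis unfolding s using A3 t3a[of k d m z] 2 by (auto simp: cubic_def sgn3_def)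
    next
      case A4
      have s: "{k, l, d} = {l, d, k}" by auto
      show ?thesis unfolding s using A4 t3a[of l d m z] 2 by (auto simp: cubic_def sgn3_def)
    next
      case A5
      then show ?thesis using t3b[of k p q z] 2 by (auto simp: cubic_def sgn3_def)
    next
      case A6
      have s: "{k, l, d} = {l, k, d}" by auto
      show ?thesis unfolding s using A6 t3b[of l p q z] 2 by (auto simp: cubic_def sgn3_def)
    next
      case A7
      have s: "{k, l, d} = {d, k, l}" by auto
      show ?thesis unfolding s using A7 t3b[of d p q z] 2 by (auto simp: cubic_def sgn3_def)
    next
      case A8
      then show ?thesis using t3c[of "{k, l, d}" z] 2 by (simp add: cubic_def)
    qed
  next
    case (3 S z)
    have inj: "inj_on (swap ?r) S" using swap_swap 3(1) by (intro inj_on_inverseI[of _ "swap ?r"]) auto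
    have c: "card (swap ?r ` S) = card S" using card_image[OF inj] .
    have "ham_lift M A (lie_d M A a br) ((U, \<phi>), (V, e)) S z = 0"
      by (rule h0[OF 3(4) 3(4) 3(1)]) (use 3 in auto)
    moreover have "ham_lift M (dual_bundle A) (lie_d M (dual_bundle A) a' br')
        ((U, \<phi>), (V, dual_frame A e)) (swap ?r ` S) z = 0"
      by (rule d0[OF 3(4) 3(4)]) (use c 3 swap_less in auto)
    ultimately show ?case using legendre_pull_eval[OF 3(1)] by (simp add: generator_apply)
  next
    case (4 k l d)
    show ?case using as[of l k] as'[of "l - ?r" "k - ?r"] by (simp add: cubic_def Let_def)
  next
    case (5 k l)
    show ?case by (simp add: cubic_def Let_def diag)
  next
    case (6 k l)
    show ?case by (simp add: cubic_def Let_def diag)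
  qed
qed

end

end

lemma sum_lessThan_double: "(\<Sum>b<2 * r. g b) = (\<Sum>m<r. g m) + (\<Sum>m<r. g (r + m) :: real)" for r :: nat
proof -
  have "(\<Sum>b<r + k. g b) = (\<Sum>m<r. g m) + (\<Sum>m<k. g (r + m))" for k
    by (induction k) (simp_all add: add.assoc)
  from this[of r] show ?thesis by (simp add: mult_2)
qed

context dual_algebroids
begin

subsection \<open>Sections of the double as linear functions\<close>

text \<open>The coefficient of \<open>\<zeta>\<^sub>b\<close> in the function given by a section of \<open>E\<close>.\<close>

definition coeff :: "(nat \<Rightarrow> 'm \<Rightarrow> 'v) \<Rightarrow> ('m, 'v) esec \<Rightarrow> nat \<Rightarrow> 'm \<Rightarrow> real"
  where "coeff e s b y = (if b < brank A then component (brank A) (dual_frame A e) y (snd s y) b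
    else component (brank A) e y (fst s y) (b - brank A))"

lemma base_point_pair: "base_point n ((U, \<phi>), k) z = inv_into U \<phi> (trunc n z)"
  by (simp add: base_point_def)

lemma E_gfun_lin:
  "E_gfun M A s ((U, \<phi>), (V, e)) =
    lin (2 * brank A) (\<lambda>b z. coeff e s b (inv_into U \<phi> (trunc (mdim M) z)))"
proof (intro ext)
  fix S z
  obtain X \<xi> where s: "s = (X, \<xi>)" by (cases s)
  let ?r = "brank A" and ?y = "inv_into U \<phi> (trunc (mdim M) z)"
  have "E_gfun M A s ((U, \<phi>), (V, e)) S z =
    (\<Sum>m<?r. (base_gfun M (\<lambda>x. component ?r e x (X x) m) ((U, \<phi>), (V, e)) \<odot> ocoord (?r + m)) S z +
             (base_gfun M (\<lambda>x. component ?r (dual_frame A e) x (\<xi> x) m) ((U, \<phi>), (V, e)) \<odot> ocoord m) S z)"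
    unfolding s E_gfun.simps Let_def by (simp add: superfun_sum_apply)
  also have "\<dots> = (\<Sum>m<?r. (if S = {?r + m} then component ?r e ?y (X ?y) m else 0) +
      (if S = {m} then component ?r (dual_frame A e) ?y (\<xi> ?y) m else 0))"
    by (rule sum.cong[OF refl]) (auto simp: base_gfun_def base_smult ocoord_def base_point_pair)
  also have "\<dots> = lin (2 * ?r) (\<lambda>b z. coeff e s b (inv_into U \<phi> (trunc (mdim M) z))) S z"
    unfolding lin_def sum_lessThan_double sum.distrib
    by (subst add.commute, intro arg_cong2[where f = "(+)"] sum.cong refl) (auto simp: coeff_def s)
  finally show "E_gfun M A s ((U, \<phi>), (V, e)) S z =
    lin (2 * ?r) (\<lambda>b z. coeff e s b (inv_into U \<phi> (trunc (mdim M) z))) S z" .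
qed

lemma p_pull_E_gfun:
  "p_pull M A (E_gfun M A s) ((U, \<phi>), (V, e)) =
    lin (2 * brank A) (\<lambda>b z. coeff e s b (inv_into U \<phi> (trunc (mdim M) z)))"
proof (intro ext)
  fix S z
  have "lin (2 * brank A) w S z = 0" if "\<not> S \<subseteq> {..<2 * brank A}" for w
    unfolding lin_def by (rule sum.neutral) (use that in auto)
  moreover have "lin (2 * brank A) (\<lambda>b z. coeff e s b (inv_into U \<phi> (trunc (mdim M) z))) S (trunc (mdim M) z) =
      lin (2 * brank A) (\<lambda>b z. coeff e s b (inv_into U \<phi> (trunc (mdim M) z))) S z"
    unfolding lin_def trunc_trunc ..
  ultimately show "p_pull M A (E_gfun M A s) ((U, \<phi>), (V, e)) S z =
    lin (2 * brank A) (\<lambda>b z. coeff e s b (inv_into U \<phi> (trunc (mdim M) z))) S z"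
    unfolding p_pull_def pullback_ocoord E_gfun_lin by simp
qed

lemma p_pull_base_gfun:
  "p_pull M A (base_gfun M f) ((U, \<phi>), (V, e)) = base_fun (\<lambda>z. f (inv_into U \<phi> (trunc (mdim M) z)))"
  by (intro ext) (auto simp: p_pull_def pullback_ocoord base_gfun_def base_fun_def base_point_pair)

lemma E_sectionsD:
  assumes "s \<in> E_sections M A"
  shows "fst s \<in> sections M A" "snd s \<in> sections M (dual_bundle A)"
  using assms unfolding E_sections_def by auto

lemma covector_in_fibre: "s \<in> E_sections M A \<Longrightarrow> snd s x \<in> dual_fibre A x"
  using dual.section_in_fibre[OF E_sectionsD(2), of s x] by simp

lemma pairing_coeff:
  assumes s: "s \<in> E_sections M A" and t: "t \<in> E_sections M A" and f: "(V, e) \<in> frames A" "x \<in> V"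
  shows "E_pairing s t x =
    (\<Sum>m<brank A. coeff e s (brank A + m) x * coeff e t m x + coeff e s m x * coeff e t (brank A + m) x)"
proof -
  have "snd s x (fst t x) = (\<Sum>m<brank A. coeff e s m x * coeff e t (brank A + m) x)" 
    if s: "s \<in> E_sections M A" and t: "t \<in> E_sections M A" for s t
    using dual_fibre_eval[OF f covector_in_fibre[OF s] section_in_fibre[OF E_sectionsD(1)[OF t]]]
    by (simp add: coeff_def component_dual_frame[OF f covector_in_fibre[OF s]] mult.commute)
  from this[OF s t] this[OF t s] show ?thesis
    by (cases s; cases t) (simp add: sum.distrib mult.commute add.commute)
qed

subsection \<open>The operator on functions\<close>

text \<open>The differential of \<open>f\<close> with respect to \<open>A\<close> is a section of the dual bundle, and the one with respect to
  \<open>A\<^sup>*\<close> is, through the bidual, a section of \<open>A\<close>. Together they represent the anchor; testing with sections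
  through all vectors and covectors shows that nothing else does.\<close>

lemma E_D_spec:
  assumes f: "smooth_fun M UNIV f"
  shows "E_D M A a a' f \<in> E_sections M A"
    and "v \<in> fibre A x \<Longrightarrow> snd (E_D M A a a' f) x v = a x v f"
    and "\<alpha> \<in> dual_fibre A x \<Longrightarrow> \<alpha> (fst (E_D M A a a' f) x) = a' x \<alpha> f"
proof -
  have near: "smooth_near M x f" for x by (rule smooth_near_fun[OF open_UNIV UNIV_I f])
  define \<xi> where "\<xi> x v = (if v \<in> fibre A x then a x v f else 0)" for x v
  define X where "X x = (THE v. v \<in> fibre A x \<and> (\<forall>\<alpha>\<in>dual_fibre A x. a' x \<alpha> f = \<alpha> v))" for x
  have X: "X x \<in> fibre A x \<and> (\<forall>\<alpha>\<in>dual_fibre A x. a' x \<alpha> f = \<alpha> (X x))" for x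
    unfolding X_def
    by (rule theI'[OF bidual_vector]) (rule dual.anchor_linear[unfolded dual_bundle_simps, OF _ _ near])
  have \<xi>_sec: "\<xi> \<in> sections M (dual_bundle A)"
    using anchor_covector_section[OF f] unfolding \<xi>_def[abs_def] .
  have X_sec: "X \<in> sections M A"
  proof (rule sectionsI)
    fix V e m assume fr: "(V, e) \<in> frames A" and m: "m < brank A"
    have "smooth_fun M V (\<lambda>x. a' x (dual_frame A e m x) f)"
      by (rule dual.anchor_frame_smooth) (use fr m f in auto)
    then show "smooth_fun M V (\<lambda>x. component (brank A) e x (X x) m)"
    proof (rule smooth_fun_cong[OF frame_open[OF fr]])
      fix x assume x: "x \<in> V"
      have "a' x (dual_frame A e m x) f = dual_frame A e m x (X x)"
        using X[of x] dual_frame_in[OF fr x] by blast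
      then show "a' x (dual_frame A e m x) f = component (brank A) e x (X x) m"
        using X[of x] by (simp add: dual_frame_def)
    qed
  qed (use X in blast)
  have zero: "a x 0 f = 0" "a' x 0 f = 0" for x
    using anchor_linear[OF fibre_zero fibre_zero near, where c = 1]
      dual.anchor_linear[OF dual.fibre_zero dual.fibre_zero near, where c = 1] by simp_all
  have "E_D M A a a' f = (X, \<xi>)"
    unfolding E_D_def
  proof (rule the_equality)
    show "(X, \<xi>) \<in> E_sections M A \<and> (\<forall>e\<in>E_sections M A. E_pairing (X, \<xi>) e = E_anchor a a' e f)"
    proof (intro conjI ballI)
      show "(X, \<xi>) \<in> E_sections M A" using X_sec \<xi>_sec by (simp add: E_sections_def)
      fix s assume s: "s \<in> E_sections M A"
      obtain Y \<eta> where [simp]: "s = (Y, \<eta>)" by (cases s)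
      have "Y x \<in> fibre A x" "\<eta> x \<in> dual_fibre A x" for x
        using section_in_fibre[OF E_sectionsD(1)[OF s]] covector_in_fibre[OF s] by simp_all
      then show "E_pairing (X, \<xi>) s = E_anchor a a' s f"
        using X by (intro ext) (simp add: \<xi>_def)
    qed
  next
    fix s assume s: "s \<in> E_sections M A \<and> (\<forall>e\<in>E_sections M A. E_pairing s e = E_anchor a a' e f)"
    obtain Z \<zeta> where sZ: "s = (Z, \<zeta>)" by (cases s)
    have Z: "Z x \<in> fibre A x" "\<zeta> x \<in> dual_fibre A x" for x
      using section_in_fibre[OF E_sectionsD(1)] covector_in_fibre s sZ by fastforce+
    have p: "\<zeta> x (Y x) + \<eta> x (Z x) = a x (Y x) f + a' x (\<eta> x) f"
      if "Y \<in> sections M A" "\<eta> \<in> sections M (dual_bundle A)" for x Y \<eta>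
    proof -
      have "(Y, \<eta>) \<in> E_sections M A" using that by (simp add: E_sections_def)
      then have "E_pairing s (Y, \<eta>) x = E_anchor a a' (Y, \<eta>) f x" using s by metis
      then show ?thesis by (simp add: sZ)
    qed
    have "\<zeta> x v = \<xi> x v" for x v
    proof (cases "v \<in> fibre A x")
      case True
      obtain Y where Y: "Y \<in> sections M A" "Y x = v" using section_through[OF True] by blast
      show ?thesis using p[OF Y(1) dual.sections_zero, of x] Y(2) zero True by (simp add: \<xi>_def)
    next
      case False
      then show ?thesis using dual_fibre_outside[OF Z(2)] by (simp add: \<xi>_def)
    qed
    moreover have "Z x = X x" for x
    proof (rule fibre_eqI[of _ x])
      show "Z x \<in> fibre A x" "X x \<in> fibre A x" using Z(1) X by blast+
      fix \<alpha> assume \<alpha>: "\<alpha> \<in> dual_fibre A x"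
      then obtain \<eta> where \<eta>: "\<eta> \<in> sections M (dual_bundle A)" "\<eta> x = \<alpha>"
        using dual.section_through[of \<alpha> x] by auto
      have "\<zeta> x 0 = 0" using dual_fibre_linear(2)[OF Z(2) fibre_zero, of x 0] by simp
      then have "\<alpha> (Z x) = a' x \<alpha> f" using p[OF sections_zero \<eta>(1), of x] \<eta>(2) zero by simp
      then show "\<alpha> (Z x) = \<alpha> (X x)" using X[of x] \<alpha> by metis
    qed
    ultimately show "s = (X, \<xi>)" unfolding sZ by blast
  qed
  then show "E_D M A a a' f \<in> E_sections M A"
    and "v \<in> fibre A x \<Longrightarrow> snd (E_D M A a a' f) x v = a x v f"
    and "\<alpha> \<in> dual_fibre A x \<Longrightarrow> \<alpha> (fst (E_D M A a a' f) x) = a' x \<alpha> f"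
    using X_sec \<xi>_sec X by (simp_all add: E_sections_def \<xi>_def)
qed

lemma E_D_coeff:
  assumes f: "smooth_fun M UNIV f" and fr: "(V, e) \<in> frames A" "x \<in> V" and b: "b < 2 * brank A"
  shows "coeff e (E_D M A a a' f) b x = anchor_of e x b f"
proof (cases "b < brank A")
  case True
  then show ?thesis
    using component_dual_frame[OF fr covector_in_fibre[OF E_D_spec(1)[OF f]] True]
      E_D_spec(2)[OF f frame_in_fibre[OF fr True]]
    by (simp add: coeff_def anchor_of_def)
next
  case False
  then show ?thesis
    using E_D_spec(3)[OF f dual_frame_in[OF fr], of "b - brank A"]
      section_in_fibre[OF E_sectionsD(1)[OF E_D_spec(1)[OF f]]]
    by (simp add: coeff_def anchor_of_def dual_frame_def)
qed

subsection \<open>Components of the bracket\<close>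

lemma vec_to_form_eval: "\<alpha> \<in> dual_fibre A x \<Longrightarrow> vec_to_form A X x [\<alpha>] = \<alpha> (X x)"
  by (simp add: vec_to_form_def)

lemma form_to_vec_spec:
  assumes "(\<lambda>\<alpha>. \<omega> x [\<alpha>]) \<in> dual_fibre (dual_bundle A) x"
  shows "form_to_vec A \<omega> x \<in> fibre A x" "\<alpha> \<in> dual_fibre A x \<Longrightarrow> \<alpha> (form_to_vec A \<omega> x) = \<omega> x [\<alpha>]"
proof -
  have "form_to_vec A \<omega> x \<in> fibre A x \<and> (\<forall>\<alpha>\<in>dual_fibre A x. \<omega> x [\<alpha>] = \<alpha> (form_to_vec A \<omega> x))"
    unfolding form_to_vec_def
  proof (rule theI'[OF bidual_vector])
    fix \<alpha> \<beta> c assume "\<alpha> \<in> dual_fibre A x" "\<beta> \<in> dual_fibre A x"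
    then show "\<omega> x [c *\<^sub>R \<alpha> + \<beta>] = c * \<omega> x [\<alpha>] + \<omega> x [\<beta>]"
      using dual.dual_fibre_linear[OF assms] dual_fibre_scaleR[of \<alpha> x c] by simp
  qed
  then show "form_to_vec A \<omega> x \<in> fibre A x" "\<alpha> \<in> dual_fibre A x \<Longrightarrow> \<alpha> (form_to_vec A \<omega> x) = \<omega> x [\<alpha>]"
    by auto
qed

context
  fixes V e x C C' s t
  assumes fr: "(V, e) \<in> frames A" "x \<in> V"
    and C: "structure_fun e x C" and C': "dual.structure_fun (dual_frame A e) x C'"
    and s: "s \<in> E_sections M A" and t: "t \<in> E_sections M A"
begin

lemma frd: "(V, dual_frame A e) \<in> frames (dual_bundle A)"
  using fr(1) by auto

text \<open>The one-forms of a covector and of a vector have the components of the section as coefficients, but only over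
  the domain of the frame; the following two lemmas pass to derivatives by locality.\<close>

lemma coeff_form:
  assumes q: "q \<in> E_sections M A" and m: "m < brank A" and y: "y \<in> V"
  shows "cov_to_form (snd q) y [e m y] = coeff e q m y"
    and "vec_to_form A (fst q) y [dual_frame A e m y] = coeff e q (brank A + m) y"
  using component_dual_frame[OF fr(1) y covector_in_fibre[OF q] m]
    vec_to_form_eval[OF dual_frame_in[OF fr(1) y], of "fst q" m] section_in_fibre[OF E_sectionsD(1)[OF q], of y] m
  by (simp_all add: coeff_def cov_to_form_def dual_frame_def)

lemma anchor_coeff_form:
  assumes q: "q \<in> E_sections M A" and m: "m < brank A" and v: "v \<in> fibre A x"
  shows "a x v (\<lambda>y. cov_to_form (snd q) y [e m y]) = a x v (coeff e q m)"
  by (rule tangent_vector_cong[OF anchor_tangent[OF v]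
      one_form_coefficient_smooth[OF cov_to_form_section[OF E_sectionsD(2)[OF q]] fr m] frame_open[OF fr(1)] fr(2)])
    (rule coeff_form(1)[OF q m])

lemma dual_anchor_coeff_form:
  assumes q: "q \<in> E_sections M A" and m: "m < brank A" and v: "\<alpha> \<in> dual_fibre A x"
  shows "a' x \<alpha> (\<lambda>y. vec_to_form A (fst q) y [dual_frame A e m y]) = a' x \<alpha> (coeff e q (brank A + m))"
  by (rule tangent_vector_cong[OF dual.anchor_tangent
      dual.one_form_coefficient_smooth[OF vec_to_form_section[OF E_sectionsD(1)[OF q]] frd fr(2)] frame_open[OF fr(1)] fr(2)])
    (use m v coeff_form(2)[OF q m] in simp_all)

text \<open>The three lines are the components of \<open>[\<xi>,\<eta>]\<close>, of the Lie derivative of \<open>\<eta>\<close> along \<open>X\<close>, and of the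
  contraction of \<open>d\<^sub>A \<xi>\<close> with \<open>Y\<close>, for \<open>s = (X,\<xi>)\<close> and \<open>t = (Y,\<eta>)\<close>.\<close>

lemma bracket_covector_coeff:
  assumes m: "m < brank A"
  defines "u \<equiv> coeff e s" and "w \<equiv> coeff e t"
  shows "coeff e (E_bracket M A a br a' br' s t) m x =
    ((\<Sum>p<brank A. \<Sum>q<brank A. u p x * w q x * C' p q m) + a' x (snd s x) (w m) - a' x (snd t x) (u m))
    + (a x (fst s x) (w m) + (\<Sum>k<brank A. a x (e m x) (u (brank A + k)) * w k x) - (\<Sum>p<brank A. \<Sum>k<brank A. u (brank A + p) x * C p m k * w k x))
    - (a x (fst t x) (u m) - (\<Sum>k<brank A. w (brank A + k) x * a x (e m x) (u k)) - (\<Sum>p<brank A. \<Sum>k<brank A. w (brank A + p) x * C p m k * u k x))"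
proof -
  obtain X \<xi> Y \<eta> where st: "s = (X, \<xi>)" "t = (Y, \<eta>)" by (cases s; cases t)
  have X: "X \<in> sections M A" "\<xi> \<in> sections M (dual_bundle A)" and Y: "Y \<in> sections M A" "\<eta> \<in> sections M (dual_bundle A)"
    using E_sectionsD[OF s] E_sectionsD[OF t] st by auto
  let ?L = "\<lambda>v. lie_deriv M A a br X (cov_to_form \<eta>) x [v]"
  let ?I = "\<lambda>v. lie_d M A a br (cov_to_form \<xi>) x [Y x, v]"
  have L: "?L \<in> dual_fibre A x" by (rule lie_deriv_dual[OF cov_to_form_section[OF Y(2)] X(1)])
  have I: "?I \<in> dual_fibre A x" by (rule lie_d_two_dual[OF cov_to_form_section[OF X(2)] section_in_fibre[OF Y(1)]])
  have B: "br' \<xi> \<eta> x \<in> dual_fibre A x" using dual.section_in_fibre[OF dual.br_section[OF X(2) Y(2)]] by simp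
  have eq: "snd (E_bracket M A a br a' br' s t) x = br' \<xi> \<eta> x + ?L - ?I"
    by (intro ext) (simp add: st form_to_cov_def contract_def)
  have in_dual: "br' \<xi> \<eta> x + ?L - ?I \<in> dual_fibre A x"
    by (rule subspace_diff[OF dual_fibre_subspace subspace_add[OF dual_fibre_subspace B L] I])
  have "coeff e (E_bracket M A a br a' br' s t) m x = br' \<xi> \<eta> x (e m x) + ?L (e m x) - ?I (e m x)"
    using m component_dual_frame[OF fr in_dual m] unfolding coeff_def eq by simp
  also have "br' \<xi> \<eta> x (e m x) = (\<Sum>p<brank A. \<Sum>q<brank A. u p x * w q x * C' p q m) + a' x (\<xi> x) (w m) - a' x (\<eta> x) (u m)"
    using dual.structure_fun_bracket[OF C' X(2) Y(2), of m] m component_dual_frame[OF fr B m]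
    by (simp add: u_def w_def coeff_def[abs_def] st)
  also have "?L (e m x) = a x (X x) (w m) + (\<Sum>k<brank A. a x (e m x) (u (brank A + k)) * w k x) - (\<Sum>p<brank A. \<Sum>k<brank A. u (brank A + p) x * C p m k * w k x)"
    unfolding lie_deriv_frame[OF fr C cov_to_form_section[OF Y(2)] X(1) m]
    using anchor_coeff_form[OF t m section_in_fibre[OF X(1)]] coeff_form(1)[OF t _ fr(2)]
    by (simp add: st u_def w_def coeff_def[abs_def])
  also have "?I (e m x) = a x (Y x) (u m) - (\<Sum>k<brank A. w (brank A + k) x * a x (e m x) (u k)) - (\<Sum>p<brank A. \<Sum>k<brank A. w (brank A + p) x * C p m k * u k x)"
    unfolding lie_d_frame[OF fr C cov_to_form_section[OF X(2)] section_in_fibre[OF Y(1)] m]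
    using anchor_coeff_form[OF s m section_in_fibre[OF Y(1)]] coeff_form(1)[OF s _ fr(2)]
      anchor_coeff_form[OF s _ frame_in_fibre[OF fr m]]
    by (simp add: st u_def w_def coeff_def[abs_def])
  finally show ?thesis by (simp add: st)
qed

text \<open>The same with the roles of \<open>A\<close> and \<open>A\<^sup>*\<close> exchanged. The forms are now forms on the dual bundle, and
  are turned back into vectors through the bidual.\<close>

lemma bracket_vector_coeff:
  assumes m: "m < brank A"
  defines "u \<equiv> coeff e s" and "w \<equiv> coeff e t"
  shows "coeff e (E_bracket M A a br a' br' s t) (brank A + m) x =
    ((\<Sum>p<brank A. \<Sum>q<brank A. u (brank A + p) x * w (brank A + q) x * C p q m) + a x (fst s x) (w (brank A + m)) - a x (fst t x) (u (brank A + m)))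
    + (a' x (snd s x) (w (brank A + m)) + (\<Sum>k<brank A. a' x (dual_frame A e m x) (u k) * w (brank A + k) x)
        - (\<Sum>p<brank A. \<Sum>k<brank A. u p x * C' p m k * w (brank A + k) x))
    - (a' x (snd t x) (u (brank A + m)) - (\<Sum>k<brank A. w k x * a' x (dual_frame A e m x) (u (brank A + k)))
        - (\<Sum>p<brank A. \<Sum>k<brank A. w p x * C' p m k * u (brank A + k) x))"
proof -
  obtain X \<xi> Y \<eta> where st: "s = (X, \<xi>)" "t = (Y, \<eta>)" by (cases s; cases t)
  have X: "X \<in> sections M A" "\<xi> \<in> sections M (dual_bundle A)" and Y: "Y \<in> sections M A" "\<eta> \<in> sections M (dual_bundle A)"
    using E_sectionsD[OF s] E_sectionsD[OF t] st by auto
  let ?d = "dual_bundle A" and ?\<epsilon> = "dual_frame A e"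
  let ?\<omega>L = "lie_deriv M ?d a' br' \<xi> (vec_to_form A Y)"
  let ?\<omega>I = "contract \<eta> (lie_d M ?d a' br' (vec_to_form A X))"
  have L: "(\<lambda>v. ?\<omega>L x [v]) \<in> dual_fibre ?d x" by (rule dual.lie_deriv_dual[OF vec_to_form_section[OF Y(1)] X(2)])
  have I: "(\<lambda>v. ?\<omega>I x [v]) \<in> dual_fibre ?d x"
    using dual.lie_d_two_dual[OF vec_to_form_section[OF X(1)] dual.section_in_fibre[OF Y(2)]]
    by (simp add: contract_def)
  have vL: "form_to_vec A ?\<omega>L x \<in> fibre A x" by (rule form_to_vec_spec(1)[where \<omega> = ?\<omega>L, OF L])
  have vI: "form_to_vec A ?\<omega>I x \<in> fibre A x" by (rule form_to_vec_spec(1)[where \<omega> = ?\<omega>I, OF I])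
  have B: "br X Y x \<in> fibre A x" by (rule section_in_fibre[OF br_section[OF X(1) Y(1)]])
  have eq: "fst (E_bracket M A a br a' br' s t) x = br X Y x + form_to_vec A ?\<omega>L x - form_to_vec A ?\<omega>I x"
    by (simp add: st)
  have dm: "?\<epsilon> m x \<in> dual_fibre A x" by (rule dual_frame_in[OF fr])
  have comp: "component (brank A) e x (form_to_vec A \<omega> x) m = \<omega> x [?\<epsilon> m x]"
    if "(\<lambda>v. \<omega> x [v]) \<in> dual_fibre ?d x" for \<omega>
    using form_to_vec_spec(2)[where \<omega> = \<omega>, OF that dm] form_to_vec_spec(1)[where \<omega> = \<omega>, OF that] by (simp add: dual_frame_def)
  have "coeff e (E_bracket M A a br a' br' s t) (brank A + m) x =
      component (brank A) e x (br X Y x) m + ?\<omega>L x [?\<epsilon> m x] - lie_d M ?d a' br' (vec_to_form A X) x [\<eta> x, ?\<epsilon> m x]"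
    unfolding coeff_def eq
    using component_diff[OF fr fibre_add[OF B vL] vI]
      component_add[OF fr B vL] comp[where \<omega> = ?\<omega>L, OF L] comp[where \<omega> = ?\<omega>I, OF I]
    by (simp add: contract_def)
  also have "component (brank A) e x (br X Y x) m = (\<Sum>p<brank A. \<Sum>q<brank A. u (brank A + p) x * w (brank A + q) x * C p q m)
      + a x (X x) (w (brank A + m)) - a x (Y x) (u (brank A + m))"
    using structure_fun_bracket[OF C X(1) Y(1) m] by (simp add: u_def w_def coeff_def[abs_def] st)
  also have "?\<omega>L x [?\<epsilon> m x] = a' x (\<xi> x) (w (brank A + m)) + (\<Sum>k<brank A. a' x (?\<epsilon> m x) (u k) * w (brank A + k) x)
      - (\<Sum>p<brank A. \<Sum>k<brank A. u p x * C' p m k * w (brank A + k) x)"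
    using dual.lie_deriv_frame[OF frd fr(2) C' vec_to_form_section[OF Y(1)] X(2), of m] m
      dual_anchor_coeff_form[OF t m, of "\<xi> x"] covector_in_fibre[OF s, of x] coeff_form(2)[OF t _ fr(2)]
    by (simp add: st u_def w_def coeff_def[abs_def])
  also have "lie_d M ?d a' br' (vec_to_form A X) x [\<eta> x, ?\<epsilon> m x] =
      a' x (\<eta> x) (u (brank A + m)) - (\<Sum>k<brank A. w k x * a' x (?\<epsilon> m x) (u (brank A + k))) - (\<Sum>p<brank A. \<Sum>k<brank A. w p x * C' p m k * u (brank A + k) x)"
    using dual.lie_d_frame[OF frd fr(2) C' vec_to_form_section[OF X(1)] dual.section_in_fibre[OF Y(2)], of m] m
      dual_anchor_coeff_form[OF s m, of "\<eta> x"] covector_in_fibre[OF t, of x] coeff_form(2)[OF s _ fr(2)]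
      dual_anchor_coeff_form[OF s _ dm]
    by (simp add: st u_def w_def coeff_def[abs_def])
  finally show ?thesis by (simp add: st)
qed

end

text \<open>The contraction of the alternating coefficients with two elements of the fibre of \<open>E\<close>. Covector
  and vector components \<open>U m\<close> and \<open>U (r + m)\<close> are paired with the indices \<open>r + m\<close> and \<open>m\<close>.\<close>

definition cubic_part ::
    "(nat \<Rightarrow> nat \<Rightarrow> nat \<Rightarrow> real) \<Rightarrow> (nat \<Rightarrow> nat \<Rightarrow> nat \<Rightarrow> real) \<Rightarrow> nat \<Rightarrow> (nat \<Rightarrow> real) \<Rightarrow> (nat \<Rightarrow> real) \<Rightarrow> real"
  where "cubic_part C C' b U W = (let r = brank A in \<Sum>m<r. \<Sum>k<r.
      (cubic C C' b (r + m) (r + k) * U k + cubic C C' b (r + m) k * U (r + k)) * W m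
    + (cubic C C' b m (r + k) * U k + cubic C C' b m k * U (r + k)) * W (r + m))"

context
  fixes U \<phi> V e x0 x
  assumes ch: "(U, \<phi>) \<in> charts M" and fr: "(V, e) \<in> frames A" and x0: "x0 \<in> \<phi> ` (U \<inter> V)"
    and x: "x = inv_into U \<phi> x0"
begin

lemma point: "x \<in> U" "x \<in> V" "\<phi> x = x0"
  using chart_inv_in[OF ch x0] chart_inv_inv[OF ch x0] unfolding x by auto

text \<open>The coefficients of the generating function are the anchors applied to the coordinates.\<close>

lemma anchor_of_coords:
  assumes b: "b < 2 * brank A" and f: "smooth_near M x f"
  shows "(\<Sum>i<mdim M. anchor_of e x b (\<lambda>y. \<phi> y i) * partial i (\<lambda>z. f (inv_into U \<phi> z)) x0) = anchor_of e x b f"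
proof (cases "b < brank A")
  case True
  have "tangent_vector M x (a x (e b x))"
    by (rule anchor_tangent[OF frame_in_fibre[OF fr point(2) True]])
  from tangent_vector_chart[OF this ch point(1) f] show ?thesis using True by (simp add: anchor_of_def point(3))
next
  case False
  have "tangent_vector M x (a' x (dual_frame A e (b - brank A) x))"
    by (rule dual.anchor_tangent) (simp add: dual_frame_in[OF fr point(2)])
  from tangent_vector_chart[OF this ch point(1) f] show ?thesis using False by (simp add: anchor_of_def point(3))
qed

lemma coeff_smooth_near:
  assumes s: "s \<in> E_sections M A" and b: "b < 2 * brank A"
  shows "smooth_near M x (coeff e s b)"
proof (cases "b < brank A")
  case True
  then show ?thesis
    using dual.section_component_smooth_near[OF E_sectionsD(2)[OF s], of V "dual_frame A e" b x] fr point(2)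
    unfolding coeff_def[abs_def] by auto
next
  case False
  then show ?thesis
    using section_component_smooth_near[OF E_sectionsD(1)[OF s] fr, of "b - brank A"] b point(2)
    unfolding coeff_def[abs_def] by auto
qed

text \<open>The pairing exchanges vectors and covectors: the anchor of the section involves the coefficients with
  index \<open>r + m\<close> for \<open>A\<close> and those with index \<open>m\<close> for \<open>A\<^sup>*\<close>.\<close>

lemma anchor_coeff_sum:
  assumes s: "s \<in> E_sections M A" and f: "smooth_near M x f"
  shows "(\<Sum>m<brank A. coeff e s (brank A + m) x * anchor_of e x m f) = a x (fst s x) f"
    and "(\<Sum>m<brank A. coeff e s m x * anchor_of e x (brank A + m) f) = a' x (snd s x) f"
proof -
  show "(\<Sum>m<brank A. coeff e s (brank A + m) x * anchor_of e x m f) = a x (fst s x) f"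
    unfolding anchor_eval[OF fr point(2) section_in_fibre[OF E_sectionsD(1)[OF s]] f]
    by (rule sum.cong) (auto simp: coeff_def anchor_of_def)
  have "a' x (snd s x) f = (\<Sum>m<brank A. component (brank A) (dual_frame A e) x (snd s x) m * a' x (dual_frame A e m x) f)"
    using dual.anchor_eval[of V "dual_frame A e" x "snd s x" f] fr point(2) covector_in_fibre[OF s] f by auto
  then show "(\<Sum>m<brank A. coeff e s m x * anchor_of e x (brank A + m) f) = a' x (snd s x) f"
    by (simp add: coeff_def anchor_of_def)
qed

text \<open>The two lemmas on components of the bracket and the alternating coefficients combine to one formula
  for vector and covector components. The anchor terms on \<open>s\<close> and \<open>t\<close> come from the brackets of
  sections and from the Lie derivatives, the next sum is the symmetric part, and the last term collects
  the structure functions of \<open>A\<close> and of \<open>A\<^sup>*\<close>.\<close>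

lemma bracket_eq_iterated:
  fixes s t
  assumes C: "structure_fun e x C" and C': "dual.structure_fun (dual_frame A e) x C'"
    and s: "s \<in> E_sections M A" and t: "t \<in> E_sections M A" and b: "b < 2 * brank A"
  defines "u \<equiv> coeff e s" and "w \<equiv> coeff e t"
  shows "coeff e (E_bracket M A a br a' br' s t) b x =
    a x (fst s x) (w b) + a' x (snd s x) (w b) - a x (fst t x) (u b) - a' x (snd t x) (u b)
    + (\<Sum>m<brank A. anchor_of e x b (u (brank A + m)) * w m x + anchor_of e x b (u m) * w (brank A + m) x)
    + cubic_part C C' b (\<lambda>k. u k x) (\<lambda>k. w k x)"
proof (cases "b < brank A")
  let ?r = "brank A"
  note as = structure_fun_antisym[OF C] and as' = dual.structure_fun_antisym[OF C']
  case True
  have 1: "(\<Sum>p<?r. \<Sum>q<?r. u p x * w q x * C' p q b) = (\<Sum>m<?r. \<Sum>k<?r. - C' m k b * u k x * w m x)"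
    by (subst sum.swap) (intro sum.cong refl, subst as', simp)
  have 2: "(\<Sum>p<?r. \<Sum>k<?r. u (?r + p) x * C p b k * w k x) = (\<Sum>m<?r. \<Sum>k<?r. - (C b k m * u (?r + k) x * w m x))"
    by (subst sum.swap) (intro sum.cong refl, subst as, simp)
  have 3: "(\<Sum>p<?r. \<Sum>k<?r. w (?r + p) x * C p b k * u k x) = (\<Sum>m<?r. \<Sum>k<?r. - C b m k * u k x * w (?r + m) x)"
    by (intro sum.cong refl, subst as, simp)
  have "cubic_part C C' b (\<lambda>k. u k x) (\<lambda>k. w k x) =
    (\<Sum>m<?r. \<Sum>k<?r. - C' m k b * u k x * w m x - - (C b k m * u (?r + k) x * w m x) + - C b m k * u k x * w (?r + m) x)"
    unfolding cubic_part_def Let_def by (intro sum.cong refl) (use True in \<open>simp add: cubic_def algebra_simps\<close>)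
  then have cub: "cubic_part C C' b (\<lambda>k. u k x) (\<lambda>k. w k x) =
    (\<Sum>m<?r. \<Sum>k<?r. - C' m k b * u k x * w m x) - (\<Sum>m<?r. \<Sum>k<?r. - (C b k m * u (?r + k) x * w m x))
      + (\<Sum>m<?r. \<Sum>k<?r. - C b m k * u k x * w (?r + m) x)"
    by (simp only: sum.distrib sum_subtractf)
  have anc: "(\<Sum>m<?r. anchor_of e x b (u (?r + m)) * w m x + anchor_of e x b (u m) * w (?r + m) x) =
      (\<Sum>k<?r. a x (e b x) (u (?r + k)) * w k x) + (\<Sum>k<?r. w (?r + k) x * a x (e b x) (u k))"
    unfolding sum.distrib[symmetric] by (rule sum.cong[OF refl]) (simp add: anchor_of_def True)
  show ?thesis
    unfolding bracket_covector_coeff[OF fr point(2) C C' s t True, folded u_def w_def] cub anc 1 2 3 by simp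
next
  let ?r = "brank A"
  note as = structure_fun_antisym[OF C] and as' = dual.structure_fun_antisym[OF C']
  case False
  define l where "l = b - ?r"
  have l: "l < ?r" "b = ?r + l" using False b by (auto simp: l_def)
  have 1: "(\<Sum>p<?r. \<Sum>q<?r. u (?r + p) x * w (?r + q) x * C p q l) = (\<Sum>m<?r. \<Sum>k<?r. - C m k l * u (?r + k) x * w (?r + m) x)"
    by (subst sum.swap) (intro sum.cong refl, subst as, simp)
  have 2: "(\<Sum>p<?r. \<Sum>k<?r. u p x * C' p l k * w (?r + k) x) = (\<Sum>m<?r. \<Sum>k<?r. - (C' l k m * u k x * w (?r + m) x))"
    by (subst sum.swap) (intro sum.cong refl, subst as', simp)
  have 3: "(\<Sum>p<?r. \<Sum>k<?r. w p x * C' p l k * u (?r + k) x) = (\<Sum>m<?r. \<Sum>k<?r. - C' l m k * u (?r + k) x * w m x)"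
    by (intro sum.cong refl, subst as', simp)
  have "cubic_part C C' b (\<lambda>k. u k x) (\<lambda>k. w k x) =
    (\<Sum>m<?r. \<Sum>k<?r. - C m k l * u (?r + k) x * w (?r + m) x - - (C' l k m * u k x * w (?r + m) x) + - C' l m k * u (?r + k) x * w m x)"
    unfolding cubic_part_def Let_def by (intro sum.cong refl) (use l in \<open>simp add: cubic_def algebra_simps\<close>)
  then have cub: "cubic_part C C' b (\<lambda>k. u k x) (\<lambda>k. w k x) =
    (\<Sum>m<?r. \<Sum>k<?r. - C m k l * u (?r + k) x * w (?r + m) x) - (\<Sum>m<?r. \<Sum>k<?r. - (C' l k m * u k x * w (?r + m) x))
      + (\<Sum>m<?r. \<Sum>k<?r. - C' l m k * u (?r + k) x * w m x)"
    by (simp only: sum.distrib sum_subtractf)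
  have anc: "(\<Sum>m<?r. anchor_of e x b (u (?r + m)) * w m x + anchor_of e x b (u m) * w (?r + m) x) =
      (\<Sum>k<?r. a' x (dual_frame A e l x) (u k) * w (?r + k) x) + (\<Sum>k<?r. w k x * a' x (dual_frame A e l x) (u (?r + k)))"
    unfolding sum.distrib[symmetric] by (rule sum.cong[OF refl]) (simp add: anchor_of_def l)
  show ?thesis
    unfolding cub anc 1[symmetric] 2[symmetric] 3[symmetric]
    unfolding l(2) bracket_vector_coeff[OF fr point(2) C C' s t l(1), folded u_def w_def] by simp
qed

lemma poisson_generator_base:
  assumes z: "trunc (mdim M) z = x0" and S: "S \<subseteq> {..<2 * brank A}" and f: "smooth_near M x f"
  shows "poisson (mdim M) (brank A) (generator ((U, \<phi>), (V, e)))
      (base_fun (\<lambda>z. f (inv_into U \<phi> (trunc (mdim M) z)))) S z =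
    (if card S = 1 then anchor_of e x (the_elem S) f else 0)"
proof -
  obtain C where C: "structure_fun e x C" using structure_fun_exists[OF fr point(2)] by blast
  obtain C' where C': "dual.structure_fun (dual_frame A e) x C'"
    using dual.structure_fun_exists[of V "dual_frame A e" x] fr point(2) by auto
  interpret cubic_function "mdim M" "brank A" "generator ((U, \<phi>), (V, e))" x0
    "\<lambda>b i. anchor_of e x b (\<lambda>y. \<phi> y i)" "cubic C C'"
    by (rule generator_cubic[OF ch fr x0 x C C'])
  show ?thesis
  proof (cases "card S = 1")
    case True
    then obtain b where b: "S = {b}" using card_1_singletonE by blast
    then have "b < 2 * brank A" using S by simp
    then show ?thesis
      using poisson_theta_base[OF S z, of "\<lambda>z. f (inv_into U \<phi> z)"] anchor_of_coords[OF _ f] True by (simp add: b)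
  next
    case False
    then show ?thesis using poisson_theta_base[OF S z, of "\<lambda>z. f (inv_into U \<phi> z)"] by simp
  qed
qed

lemma poisson_generator_iterated:
  assumes z: "trunc (mdim M) z = x0" and S: "S \<subseteq> {..<2 * brank A}"
    and s: "s \<in> E_sections M A" and t: "t \<in> E_sections M A"
  shows "poisson (mdim M) (brank A)
      (poisson (mdim M) (brank A) (generator ((U, \<phi>), (V, e)))
        (lin (2 * brank A) (\<lambda>b z. coeff e s b (inv_into U \<phi> (trunc (mdim M) z)))))
      (lin (2 * brank A) (\<lambda>b z. coeff e t b (inv_into U \<phi> (trunc (mdim M) z)))) S z =
    (if card S = 1 then coeff e (E_bracket M A a br a' br' s t) (the_elem S) x else 0)"
proof -
  let ?r = "brank A" and ?n = "mdim M"
  obtain C where C: "structure_fun e x C" using structure_fun_exists[OF fr point(2)] by blast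
  obtain C' where C': "dual.structure_fun (dual_frame A e) x C'"
    using dual.structure_fun_exists[of V "dual_frame A e" x] fr point(2) by auto
  interpret cubic_function ?n ?r "generator ((U, \<phi>), (V, e))" x0
    "\<lambda>b i. anchor_of e x b (\<lambda>y. \<phi> y i)" "cubic C C'"
    by (rule generator_cubic[OF ch fr x0 x C C'])
  define u where "u b z = coeff e s b (inv_into U \<phi> z)" for b z
  define w where "w b z = coeff e t b (inv_into U \<phi> z)" for b z
  have u0: "u b x0 = coeff e s b x" and w0: "w b x0 = coeff e t b x" for b by (simp_all add: u_def w_def x)
  have du: "(\<Sum>i<?n. anchor_of e x k (\<lambda>y. \<phi> y i) * partial i (u b) x0) = anchor_of e x k (coeff e s b)"
    and dw: "(\<Sum>i<?n. anchor_of e x k (\<lambda>y. \<phi> y i) * partial i (w b) x0) = anchor_of e x k (coeff e t b)"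
    if "k < 2 * ?r" "b < 2 * ?r" for k b
    using anchor_of_coords[OF that(1) coeff_smooth_near[OF s that(2)]]
      anchor_of_coords[OF that(1) coeff_smooth_near[OF t that(2)]]
    unfolding u_def[abs_def] w_def[abs_def] by simp_all
  have Phi: "\<Phi>2 u b k = anchor_of e x b (coeff e s k) - anchor_of e x k (coeff e s b)
      + (\<Sum>m<?r. cubic C C' b k (?r + m) * coeff e s m x + cubic C C' b k m * coeff e s (?r + m) x)"
    if "b < 2 * ?r" "k < 2 * ?r" for b k
    unfolding \<Phi>2_def sum_subtractf du[OF that] du[OF that(2,1)] u0 ..
  have anchors: "(\<Sum>i<?n. (\<Sum>m<?r. anchor_of e x (?r + m) (\<lambda>y. \<phi> y i) * u m x0
      + anchor_of e x m (\<lambda>y. \<phi> y i) * u (?r + m) x0) * partial i (w b) x0) =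
      a x (fst s x) (coeff e t b) + a' x (snd s x) (coeff e t b)" if b: "b < 2 * ?r" for b
  proof -
    have "(\<Sum>i<?n. (\<Sum>m<?r. anchor_of e x (?r + m) (\<lambda>y. \<phi> y i) * u m x0
        + anchor_of e x m (\<lambda>y. \<phi> y i) * u (?r + m) x0) * partial i (w b) x0) =
      (\<Sum>m<?r. u m x0 * (\<Sum>i<?n. anchor_of e x (?r + m) (\<lambda>y. \<phi> y i) * partial i (w b) x0)
        + u (?r + m) x0 * (\<Sum>i<?n. anchor_of e x m (\<lambda>y. \<phi> y i) * partial i (w b) x0))"
      unfolding sum_distrib_right sum_distrib_left sum.distrib[symmetric]
      by (subst sum.swap) (intro sum.cong refl, simp add: algebra_simps)
    also have "\<dots> = (\<Sum>m<?r. coeff e s m x * anchor_of e x (?r + m) (coeff e t b)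
        + coeff e s (?r + m) x * anchor_of e x m (coeff e t b))"
      by (rule sum.cong[OF refl]) (simp add: dw b u0)
    finally show ?thesis
      using anchor_coeff_sum[OF s coeff_smooth_near[OF t b]] by (simp add: sum.distrib)
  qed
  note it = iterated_bracket[OF S z, of u w]
  show ?thesis
  proof (cases "card S = 1")
    case True
    then obtain b where b: "S = {b}" using card_1_singletonE by blast
    then have br: "b < 2 * ?r" using S by simp
    have step: "\<Phi>2 u b (?r + m) * w m x0 + \<Phi>2 u b m * w (?r + m) x0 =
        (anchor_of e x b (coeff e s (?r + m)) * coeff e t m x + anchor_of e x b (coeff e s m) * coeff e t (?r + m) x)
        - (coeff e t m x * anchor_of e x (?r + m) (coeff e s b) + coeff e t (?r + m) x * anchor_of e x m (coeff e s b))
        + (\<Sum>k<?r. (cubic C C' b (?r + m) (?r + k) * coeff e s k x + cubic C C' b (?r + m) k * coeff e s (?r + k) x) * coeff e t m x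
          + (cubic C C' b m (?r + k) * coeff e s k x + cubic C C' b m k * coeff e s (?r + k) x) * coeff e t (?r + m) x)"
      if "m \<in> {..<?r}" for m
    proof -
      have m: "m < 2 * ?r" "?r + m < 2 * ?r" using that by auto
      show ?thesis
        unfolding Phi[OF br m(1)] Phi[OF br m(2)] w0 sum.distrib[of "\<lambda>k. _ k * coeff e t m x"] sum_distrib_right[symmetric]
        by (simp add: algebra_simps)
    qed
    have quad: "(\<Sum>m<?r. \<Phi>2 u b (?r + m) * w m x0 + \<Phi>2 u b m * w (?r + m) x0) =
      (\<Sum>m<?r. anchor_of e x b (coeff e s (?r + m)) * coeff e t m x + anchor_of e x b (coeff e s m) * coeff e t (?r + m) x)
        - (a' x (snd t x) (coeff e s b) + a x (fst t x) (coeff e s b))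
        + cubic_part C C' b (\<lambda>k. coeff e s k x) (\<lambda>k. coeff e t k x)"
      unfolding cubic_part_def Let_def anchor_coeff_sum[OF t coeff_smooth_near[OF s br], symmetric]
      by (rule trans[OF sum.cong[OF refl step]], assumption) (simp only: sum.distrib sum_subtractf)
    show ?thesis
      using it unfolding b u_def[abs_def, symmetric] w_def[abs_def, symmetric]
      using anchors[OF br] quad bracket_eq_iterated[OF C C' s t br] by (simp add: u_def[abs_def] w_def[abs_def])
  next
    case False
    then show ?thesis using it by (simp add: u_def[abs_def] w_def[abs_def])
  qed
qed

end

end

lemma poisson_zero_right: "poisson n r F (\<lambda>S z. 0) = (\<lambda>S z. 0)"
  and poisson_zero_left: "poisson n r (\<lambda>S z. 0) G = (\<lambda>S z. 0)"
proof -
  have "partial_even i (\<lambda>S z. 0) = (\<lambda>S z. 0)" "left_odd b (\<lambda>S z. 0) = (\<lambda>S z. 0)"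
    "right_odd b (\<lambda>S z. 0) = (\<lambda>S z. 0)" for i b
    by (intro ext; simp add: partial_even_def partial_zero left_odd_def right_odd_def)+
  moreover have "F \<odot> (\<lambda>S z. 0) = (\<lambda>S z. 0)" "(\<lambda>S z. 0) \<odot> F = (\<lambda>S z. 0)" for F
    by (intro ext; simp add: smult_def)+
  ultimately show "poisson n r F (\<lambda>S z. 0) = (\<lambda>S z. 0)" "poisson n r (\<lambda>S z. 0) G = (\<lambda>S z. 0)"
    by (intro ext; simp add: poisson_apply)+
qed

text \<open>A linear function is odd, so only the summand \<open>k = 1\<close> of the derived bracket is present, with sign \<open>+\<close>.\<close>

lemma derived_bracket_lin:
  assumes F: "F c = lin N w"
  shows "derived_bracket M A (poisson_TPi M A \<theta>) F G c =
    poisson_TPi M A (poisson_TPi M A \<theta> F) G c"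
proof (intro ext)
  fix S z
  have even: "lin N w S z = 0" if "even (card S)" for S z
    using that by (intro lin_zero) auto
  have p0: "parity_part 0 F c = (\<lambda>S z. 0)"
    by (intro ext) (use even in \<open>auto simp: parity_part_def F mod2_eq_if\<close>)
  have p1: "parity_part 1 F c = F c"
    by (intro ext) (use even in \<open>auto simp: parity_part_def F mod2_eq_if\<close>)
  show "derived_bracket M A (poisson_TPi M A \<theta>) F G c S z = poisson_TPi M A (poisson_TPi M A \<theta> F) G c S z"
    using p0 p1
    by (simp add: derived_bracket_def poisson_TPi_def lessThan_Suc numeral_2_eq_2 poisson_zero_right poisson_zero_left
        scaleR_fun_def)
qed

theorem theorem3p7p1:
  fixes M :: "'m::{t2_space, second_countable_topology} manifold"
    and A :: "('m, 'v::real_vector) vbundle"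
    and a :: "('m, 'v) anchor" and br :: "('m, 'v) bracket"
    and a_star :: "('m, 'v \<Rightarrow> real) anchor" and br_star :: "('m, 'v \<Rightarrow> real) bracket"
    and \<mu> \<theta> :: "('m, 'v) gfun" and \<gamma> :: "('m, 'v \<Rightarrow> real) gfun"
    and D :: "('m, 'v) gfun \<Rightarrow> ('m, 'v) gfun"
    and e\<^sub>1 e\<^sub>2 :: "('m, 'v) esec" and f :: "'m \<Rightarrow> real"
  assumes "smooth_manifold M"
    and "vector_bundle M A"
    and "lie_algebroid M A a br"
    and "lie_algebroid M (dual_bundle A) a_star br_star"
    and "\<mu> = ham_lift M A (lie_d M A a br)"
    and "\<gamma> = ham_lift M (dual_bundle A) (lie_d M (dual_bundle A) a_star br_star)"
    and "\<theta> = \<mu> + legendre_pull A \<gamma>"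
    and "D = poisson_TPi M A \<theta>"
    and "e\<^sub>1 \<in> E_sections M A" and "e\<^sub>2 \<in> E_sections M A"
    and "smooth_fun M UNIV f"
  shows "
    eq_TPi M A (p_pull M A (base_gfun M (E_pairing e\<^sub>1 e\<^sub>2)))
      (poisson_TPi M A (p_pull M A (E_gfun M A e\<^sub>1)) (p_pull M A (E_gfun M A e\<^sub>2))) \<and>
    (eq_TPi M A (p_pull M A (E_gfun M A (E_D M A a a_star f))) (D (p_pull M A (base_gfun M f))) \<and>
     eq_TPi M A (D (p_pull M A (base_gfun M f))) (poisson_TPi M A \<theta> (p_pull M A (base_gfun M f)))) \<and>
    (eq_TPi M A (p_pull M A (E_gfun M A (E_bracket M A a br a_star br_star e\<^sub>1 e\<^sub>2)))
       (derived_bracket M A D (p_pull M A (E_gfun M A e\<^sub>1)) (p_pull M A (E_gfun M A e\<^sub>2))) \<and>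
     eq_TPi M A
       (derived_bracket M A D (p_pull M A (E_gfun M A e\<^sub>1)) (p_pull M A (E_gfun M A e\<^sub>2)))
       (poisson_TPi M A (poisson_TPi M A \<theta> (p_pull M A (E_gfun M A e\<^sub>1)))
          (p_pull M A (E_gfun M A e\<^sub>2))))"
proof -
  interpret dual_algebroids M A a br a_star br_star
    by unfold_locales (fact assms(1-4))+
  have \<theta>: "\<theta> = generator" using assms(5-7) by (simp add: generator_def)
  note e1 = \<open>e\<^sub>1 \<in> E_sections M A\<close> and e2 = \<open>e\<^sub>2 \<in> E_sections M A\<close> and f = \<open>smooth_fun M UNIV f\<close>
  have eqI: "eq_TPi M A F G"
    if "\<And>U \<phi> V e z S. (U, \<phi>) \<in> charts M \<Longrightarrow> (V, e) \<in> frames A \<Longrightarrow> trunc (mdim M) z \<in> \<phi> ` (U \<inter> V) \<Longrightarrow>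
      S \<subseteq> {..<2 * brank A} \<Longrightarrow> F ((U, \<phi>), (V, e)) S z = G ((U, \<phi>), (V, e)) S z" for F G :: "('m, 'v) gfun"
    unfolding eq_TPi_def coord_dom_def using that by auto
  have lin_eq: "lin (2 * brank A) (\<lambda>b z. coeff e s b (inv_into U \<phi> (trunc (mdim M) z))) S z =
      (if card S = 1 then coeff e s (the_elem S) (inv_into U \<phi> (trunc (mdim M) z)) else 0)"
    if "S \<subseteq> {..<2 * brank A}" for e s U \<phi> S z
  proof (cases "card S = 1")
    case True
    then obtain b where "S = {b}" using card_1_singletonE by blast
    then show ?thesis using that by (simp add: lin_singleton)
  qed (simp add: lin_zero)
  have derived: "derived_bracket M A D (p_pull M A (E_gfun M A e\<^sub>1)) (p_pull M A (E_gfun M A e\<^sub>2)) ((U, \<phi>), (V, e)) =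
      poisson_TPi M A (poisson_TPi M A \<theta> (p_pull M A (E_gfun M A e\<^sub>1))) (p_pull M A (E_gfun M A e\<^sub>2)) ((U, \<phi>), (V, e))"
    for U \<phi> V e
    unfolding \<open>D = poisson_TPi M A \<theta>\<close> by (rule derived_bracket_lin[where F = "p_pull M A (E_gfun M A e\<^sub>1)", OF p_pull_E_gfun])
  have bracket: "p_pull M A (E_gfun M A (E_bracket M A a br a_star br_star e\<^sub>1 e\<^sub>2)) ((U, \<phi>), (V, e)) S z =
      poisson_TPi M A (poisson_TPi M A \<theta> (p_pull M A (E_gfun M A e\<^sub>1))) (p_pull M A (E_gfun M A e\<^sub>2)) ((U, \<phi>), (V, e)) S z"
    if "(U, \<phi>) \<in> charts M" "(V, e) \<in> frames A" "trunc (mdim M) z \<in> \<phi> ` (U \<inter> V)" "S \<subseteq> {..<2 * brank A}"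
    for U \<phi> V e z S
    unfolding poisson_TPi_def p_pull_E_gfun lin_eq[OF that(4)] \<theta>
      poisson_generator_iterated[OF that(1-3) refl refl that(4) e1 e2] ..
  show ?thesis
  proof (intro conjI)
    show "eq_TPi M A (p_pull M A (base_gfun M (E_pairing e\<^sub>1 e\<^sub>2)))
      (poisson_TPi M A (p_pull M A (E_gfun M A e\<^sub>1)) (p_pull M A (E_gfun M A e\<^sub>2)))"
    proof (rule eqI)
      fix U \<phi> V e z S
      assume c: "(U, \<phi>) \<in> charts M" "(V, e) \<in> frames A" "trunc (mdim M) z \<in> \<phi> ` (U \<inter> V)"
        and S: "S \<subseteq> {..<2 * brank A}"
      have "inv_into U \<phi> (trunc (mdim M) z) \<in> V" using chart_inv_in[OF c(1,3)] by simp
      note pair = pairing_coeff[OF e1 e2 c(2) this]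
      show "p_pull M A (base_gfun M (E_pairing e\<^sub>1 e\<^sub>2)) ((U, \<phi>), (V, e)) S z =
        poisson_TPi M A (p_pull M A (E_gfun M A e\<^sub>1)) (p_pull M A (E_gfun M A e\<^sub>2)) ((U, \<phi>), (V, e)) S z"
        unfolding poisson_TPi_def p_pull_E_gfun p_pull_base_gfun
          poisson_lin_lin[OF S, of _ "\<lambda>b z. coeff e e\<^sub>1 b (inv_into U \<phi> z)" "\<lambda>b z. coeff e e\<^sub>2 b (inv_into U \<phi> z)"]
        by (simp add: base_fun_def pair)
    qed
    show "eq_TPi M A (p_pull M A (E_gfun M A (E_D M A a a_star f))) (D (p_pull M A (base_gfun M f)))"
    proof (rule eqI)
      fix U \<phi> V e z S
      assume c: "(U, \<phi>) \<in> charts M" "(V, e) \<in> frames A" "trunc (mdim M) z \<in> \<phi> ` (U \<inter> V)"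
        and S: "S \<subseteq> {..<2 * brank A}"
      let ?x = "inv_into U \<phi> (trunc (mdim M) z)"
      have x: "?x \<in> V" using chart_inv_in[OF c(1,3)] by simp
      have near: "smooth_near M ?x f" by (rule smooth_near_fun[OF open_UNIV UNIV_I f])
      have "coeff e (E_D M A a a_star f) (the_elem S) ?x = anchor_of e ?x (the_elem S) f" if "card S = 1"
      proof -
        obtain b where "S = {b}" using \<open>card S = 1\<close> by (rule card_1_singletonE)
        then show ?thesis using E_D_coeff[OF f c(2) x, of b] S by simp
      qed
      then show "p_pull M A (E_gfun M A (E_D M A a a_star f)) ((U, \<phi>), (V, e)) S z =
        D (p_pull M A (base_gfun M f)) ((U, \<phi>), (V, e)) S z"
        unfolding \<open>D = poisson_TPi M A \<theta>\<close> \<theta> poisson_TPi_def p_pull_E_gfun p_pull_base_gfun lin_eq[OF S]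
          poisson_generator_base[OF c refl refl S near] by simp
    qed
    show "eq_TPi M A (D (p_pull M A (base_gfun M f))) (poisson_TPi M A \<theta> (p_pull M A (base_gfun M f)))"
      unfolding \<open>D = poisson_TPi M A \<theta>\<close> by (rule eqI) (rule refl)
    show "eq_TPi M A (p_pull M A (E_gfun M A (E_bracket M A a br a_star br_star e\<^sub>1 e\<^sub>2)))
       (derived_bracket M A D (p_pull M A (E_gfun M A e\<^sub>1)) (p_pull M A (E_gfun M A e\<^sub>2)))"
      by (rule eqI) (simp only: derived bracket)
    show "eq_TPi M A (derived_bracket M A D (p_pull M A (E_gfun M A e\<^sub>1)) (p_pull M A (E_gfun M A e\<^sub>2)))
       (poisson_TPi M A (poisson_TPi M A \<theta> (p_pull M A (E_gfun M A e\<^sub>1))) (p_pull M A (E_gfun M A e\<^sub>2)))"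
      by (rule eqI) (simp only: derived)
  qed
qed

end
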